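(* Let $X=\mathbb R^d$ with Lebesgue measure, and let $K$ be a bounded self-adjoint nonnegative operator on the real space $L^2(\mathbb R^d,dx)$, locally of trace class, such that the integral kernel of $\sqrt K$ has the form $\varkappa(x-y)$ for a function $\varkappa$ on $\mathbb R^d$ satisfying $$\lim_{y\to0}\int_{\mathbb R^d}(\varkappa(x)-\varkappa(x+y))^2dx=0.$$ Let $a:\mathbb R^d\to[0,\infty)$ be bounded, measurable, integrable, with compact support, and such that $a(x)=\tilde a(|x|)$ for some function $\tilde a$ on $[0,\infty)$. For $\varepsilon>0$ put $a_\varepsilon(x)=\varepsilon^{-d-2}a(x/\varepsilon)$. Fix $l\in\mathbb N$, let $\mu=\mu^{(l)}$ and $r=r^{(l)}$ be as in the context, and let $\mathcal E_\varepsilon$ be the bilinear form $$\mathcal E_\varepsilon(F,G)=\frac12\int_\Gamma\mu(d\gamma)\int_{\mathbb R^d}\gamma(dx)\int_{\mathbb R^d}dy\,c_\varepsilon(x,y,\gamma\setminus x)(F(\gamma\setminus x\cup y)-F(\gamma))(G(\gamma\setminus x\cup y)-G(\gamma)),$$ where $c_\varepsilon(x,y,\gamma)=a_\varepsilon(x-y)\,r(x,\gamma)^{-1/2}r(y,\gamma)^{1/2}\chi_{\{r>0\}}(x,\gamma)\chi_{\{r>0\}}(y,\gamma)$ (with $0/0:=0$). Define $$\mathcal E_0(F,G)=c\int_\Gamma\mu(d\gamma)\int_{\mathbb R^d}dx\,r(x,\gamma)\langle\nabla_xF(\gamma\cup x),\nabla_xG(\gamma\cup x)\rangle,\qquad c:=\frac12\int_{\mathbb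 R^d}a(x)x_1^2\,dx.$$ Then for all $F,G\in\mathcal FC^\infty_{\mathrm b}(C^\infty_0(\mathbb R^d),\Gamma)$, $\mathcal E_\varepsilon(F,G)\to\mathcal E_0(F,G)$ as $\varepsilon\to0$.
   Context: $\Gamma$ is the set of locally finite subsets of $\mathbb R^d$ (identified with $\sum_{x\in\gamma}\varepsilon_x$) with the vague topology and Borel $\sigma$-algebra; $\gamma\setminus x:=\gamma\setminus\{x\}$, $\gamma\cup x:=\gamma\cup\{x\}$, $\langle\varphi,\gamma\rangle=\sum_{x\in\gamma}\varphi(x)$. "Locally of trace class" means $\operatorname{Tr}(P_\Lambda KP_\Lambda)<\infty$ for bounded Borel $\Lambda$, $P_\Lambda$ = multiplication by $\chi_\Lambda$. $k(x,y)=\int\varkappa(x-z)\varkappa(y-z)dz$ is the kernel of $K$. $Y_1,\dots,Y_l$ are independent copies on $(\Omega,\mathcal A,\mathbb P)$ of a measurable random field $Y$ with $Y(x)$ centered Gaussian and $\mathbb E(Y(x)Y(y))=k(x,y)$ (a.e.); $g^{(l)}=\sum_iY_i^2$; $\mu^{(l)}(d\gamma)=\int_\Omega\mathbb P(d\omega)\pi_{g^{(l)}(x,\omega)dx}(d\gamma)$ is the Cox process ($\pi_{g\,dx}$ = Poisson point process with intensity $g(x)dx$); its Papangelou intensity is $r^{(l)}(x,\gamma)=\widetilde{\mathbb E}(g^{(l)}(x)\mid\mathcal F)(\gamma)$, where $\widetilde{\mathbb P}(d\omega,d\gamma)=\mathbb P(d\omega)\pi_{g^{(l)}(x,\omega)dx}(d\gamma)$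 and $\mathcal F$ is the $\sigma$-algebra generated by $(\omega,\gamma)\mapsto F(\gamma)$. $\mathcal FC^\infty_{\mathrm b}(C^\infty_0(\mathbb R^d),\Gamma)$ is the set of functions $F(\gamma)=g(\langle\varphi_1,\gamma\rangle,\dots,\langle\varphi_N,\gamma\rangle)$ with $N\in\mathbb N$, $\varphi_i\in C^\infty_0(\mathbb R^d)$, $g$ smooth and bounded on $\mathbb R^N$ with all derivatives bounded. $x_1$ is the first coordinate of $x$, $\nabla_x$ the gradient in $x$, $\langle\cdot,\cdot\rangle$ the Euclidean scalar product. *)

theory Defs
  imports "HOL-Probability.Probability"
begin

definition Gamma :: "('a::euclidean_space) set set" where
  "Gamma = {\<gamma>. \<forall>B. bounded B \<longrightarrow> finite (\<gamma> \<inter> B)}"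

text \<open>Borel sigma-algebra of the vague topology = sigma-algebra generated by the
  counting maps N_B(gamma) = card (gamma Int B), B bounded Borel.\<close>
definition Gamma_M :: "('a::euclidean_space) set measure" where
  "Gamma_M = sigma Gamma
     {{\<gamma>\<in>Gamma. card (\<gamma> \<inter> B) = n} | B n. B \<in> sets borel \<and> bounded B}"

definition pairing :: "('a \<Rightarrow> real) \<Rightarrow> 'a set \<Rightarrow> real" where
  "pairing \<phi> \<gamma> = (\<Sum>x\<in>{x\<in>\<gamma>. \<phi> x \<noteq> 0}. \<phi> x)"

definition poisson_pp :: "('a::euclidean_space \<Rightarrow> real) \<Rightarrow> 'a set measure \<Rightarrow> bool" where
  "poisson_pp \<rho> M \<longleftrightarrow> sets M = sets Gamma_M \<and> prob_space M \<and>
     (\<forall>B n. B \<in> sets borel \<and> bounded B \<longrightarrow>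
        (\<integral>\<^sup>+x\<in>B. ennreal (\<rho> x) \<partial>lborel) < \<infinity> \<and>
        (let L = enn2real (\<integral>\<^sup>+x\<in>B. ennreal (\<rho> x) \<partial>lborel) in
          emeasure M {\<gamma>\<in>space M. card (\<gamma> \<inter> B) = n} = ennreal (exp (- L) * L ^ n / fact n))) \<and>
     (\<forall>Bs::'a set list. (\<forall>B\<in>set Bs. B \<in> sets borel \<and> bounded B) \<and>
        (\<forall>i<length Bs. \<forall>j<length Bs. i \<noteq> j \<longrightarrow> Bs ! i \<inter> Bs ! j = {}) \<longrightarrow>
        prob_space.indep_vars M (\<lambda>_. count_space UNIV) (\<lambda>i \<gamma>. card (\<gamma> \<inter> Bs ! i)) {..<length Bs})"

definition pi_pp :: "('a::euclidean_space \<Rightarrow> real) \<Rightarrow> 'a set measure" where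
  "pi_pp \<rho> = (THE M. poisson_pp \<rho> M)"

definition cox :: "'w measure \<Rightarrow> ('a::euclidean_space \<Rightarrow> 'w \<Rightarrow> real) \<Rightarrow> 'a set measure" where
  "cox P g = measure_of (space Gamma_M) (sets Gamma_M)
      (\<lambda>A. \<integral>\<^sup>+\<omega>. emeasure (pi_pp (\<lambda>x. g x \<omega>)) A \<partial>P)"

definition cox_joint :: "'w measure \<Rightarrow> ('a::euclidean_space \<Rightarrow> 'w \<Rightarrow> real) \<Rightarrow> ('w \<times> 'a set) measure" where
  "cox_joint P g = measure_of (space P \<times> space Gamma_M) (sets (P \<Otimes>\<^sub>M Gamma_M))
      (\<lambda>S. \<integral>\<^sup>+\<omega>. emeasure (pi_pp (\<lambda>x. g x \<omega>)) (Pair \<omega> -` S) \<partial>P)"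

definition cox_F :: "'w measure \<Rightarrow> ('a::euclidean_space \<Rightarrow> 'w \<Rightarrow> real) \<Rightarrow> ('w \<times> 'a set) measure" where
  "cox_F P g = vimage_algebra (space (cox_joint P g)) snd Gamma_M"

definition is_papangelou :: "'w measure \<Rightarrow> ('a::euclidean_space \<Rightarrow> 'w \<Rightarrow> real) \<Rightarrow> ('a \<Rightarrow> 'a set \<Rightarrow> real) \<Rightarrow> bool" where
  "is_papangelou P g r \<longleftrightarrow>
     (\<lambda>(x, \<gamma>). r x \<gamma>) \<in> borel_measurable (lborel \<Otimes>\<^sub>M Gamma_M) \<and>
     (AE x in lborel. AE p in cox_joint P g.
        r x (snd p) = real_cond_exp (cox_joint P g) (cox_F P g) (\<lambda>q. g x (fst q)) p)"

definition centered_gaussian :: "'w measure \<Rightarrow> ('w \<Rightarrow> real) \<Rightarrow> bool" where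
  "centered_gaussian P X \<longleftrightarrow> (AE \<omega> in P. X \<omega> = 0) \<or>
     (\<exists>\<sigma>>0. distributed P lborel X (\<lambda>t. ennreal (normal_density 0 \<sigma> t)))"

text \<open>Kernel k(x,y) = int kappa(x-z) kappa(y-z) dz of K\<close>
definition kern :: "('a::euclidean_space \<Rightarrow> real) \<Rightarrow> 'a \<Rightarrow> 'a \<Rightarrow> real" where
  "kern \<kappa> x y = (\<integral>z. \<kappa> (x - z) * \<kappa> (y - z) \<partial>lborel)"

definition gaussian_field :: "'w measure \<Rightarrow> ('a::euclidean_space \<Rightarrow> 'w \<Rightarrow> real) \<Rightarrow> ('a \<Rightarrow> 'a \<Rightarrow> real) \<Rightarrow> bool" where
  "gaussian_field P Y k \<longleftrightarrow>
     (\<lambda>(x, \<omega>). Y x \<omega>) \<in> borel_measurable (lborel \<Otimes>\<^sub>M P) \<and>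
     (\<forall>S c. finite S \<longrightarrow> centered_gaussian P (\<lambda>\<omega>. \<Sum>x\<in>S. c x * Y x \<omega>)) \<and>
     (AE p in lborel \<Otimes>\<^sub>M lborel.
        prob_space.expectation P (\<lambda>\<omega>. Y (fst p) \<omega> * Y (snd p) \<omega>) = k (fst p) (snd p))"

definition sq_int :: "('a::euclidean_space \<Rightarrow> real) \<Rightarrow> bool" where
  "sq_int f \<longleftrightarrow> f \<in> borel_measurable lborel \<and> integrable lborel (\<lambda>x. (f x)\<^sup>2)"

definition conv_op :: "('a::euclidean_space \<Rightarrow> real) \<Rightarrow> ('a \<Rightarrow> real) \<Rightarrow> 'a \<Rightarrow> real" where
  "conv_op \<kappa> f = (\<lambda>x. \<integral>y. \<kappa> (x - y) * f y \<partial>lborel)"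

text \<open>The operator T with kernel kappa(x-y) is a bounded, self-adjoint, nonnegative
  operator on real L2 (T = sqrt K, K = T^2).\<close>
definition bdd_sa_nonneg_kernel_op :: "('a::euclidean_space \<Rightarrow> real) \<Rightarrow> bool" where
  "bdd_sa_nonneg_kernel_op \<kappa> \<longleftrightarrow>
     (\<exists>C. \<forall>f. sq_int f \<longrightarrow>
         (AE x in lborel. integrable lborel (\<lambda>y. \<kappa> (x - y) * f y)) \<and>
         sq_int (conv_op \<kappa> f) \<and>
         (\<integral>x. (conv_op \<kappa> f x)\<^sup>2 \<partial>lborel) \<le> C * (\<integral>x. (f x)\<^sup>2 \<partial>lborel)) \<and>
     (\<forall>f g. sq_int f \<and> sq_int g \<longrightarrow>
         (\<integral>x. g x * conv_op \<kappa> f x \<partial>lborel) = (\<integral>x. conv_op \<kappa> g x * f x \<partial>lborel)) \<and>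
     (\<forall>f. sq_int f \<longrightarrow> (\<integral>x. f x * conv_op \<kappa> f x \<partial>lborel) \<ge> 0)"

text \<open>K = (sqrt K)^2 locally of trace class:
  Tr(P_L K P_L) = ||sqrt K P_L||_HS^2 = int_L int kappa(x-y)^2 dy dx < infinity.\<close>
definition locally_trace_class :: "('a::euclidean_space \<Rightarrow> real) \<Rightarrow> bool" where
  "locally_trace_class \<kappa> \<longleftrightarrow> (\<forall>L. L \<in> sets borel \<and> bounded L \<longrightarrow>
      (\<integral>\<^sup>+x\<in>L. \<integral>\<^sup>+y. ennreal ((\<kappa> (x - y))\<^sup>2) \<partial>lborel \<partial>lborel) < \<infinity>)"

fun pderivs :: "'a list \<Rightarrow> ('a::real_normed_vector \<Rightarrow> real) \<Rightarrow> 'a \<Rightarrow> real" where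
  "pderivs [] f = f"
| "pderivs (v # vs) f = (\<lambda>x. frechet_derivative (pderivs vs f) (at x) v)"

definition smooth_fun :: "('a::euclidean_space \<Rightarrow> real) \<Rightarrow> bool" where
  "smooth_fun f \<longleftrightarrow> (\<forall>vs. set vs \<subseteq> Basis \<longrightarrow> (\<forall>x. pderivs vs f differentiable (at x)))"

definition smooth_bdd :: "('a::euclidean_space \<Rightarrow> real) \<Rightarrow> bool" where
  "smooth_bdd f \<longleftrightarrow> smooth_fun f \<and> (\<forall>vs. set vs \<subseteq> Basis \<longrightarrow> bounded (range (pderivs vs f)))"

definition test_fun :: "('a::euclidean_space \<Rightarrow> real) \<Rightarrow> bool" where
  "test_fun \<phi> \<longleftrightarrow> smooth_fun \<phi> \<and> compact (closure {x. \<phi> x \<noteq> 0})"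

definition cyl_fun :: "('a::euclidean_space set \<Rightarrow> real) \<Rightarrow> ('n::finite \<Rightarrow> 'a \<Rightarrow> real) \<Rightarrow> (real^'n \<Rightarrow> real) \<Rightarrow> bool" where
  "cyl_fun F \<phi> h \<longleftrightarrow> (\<forall>i. test_fun (\<phi> i)) \<and> smooth_bdd h \<and>
     (\<forall>\<gamma>\<in>Gamma. F \<gamma> = h (\<chi> i. pairing (\<phi> i) \<gamma>))"

definition grad :: "('a::euclidean_space \<Rightarrow> real) \<Rightarrow> 'a \<Rightarrow> 'a" where
  "grad f x = (\<Sum>b\<in>Basis. frechet_derivative f (at x) b *\<^sub>R b)"

definition a_eps :: "('a::euclidean_space \<Rightarrow> real) \<Rightarrow> real \<Rightarrow> 'a \<Rightarrow> real" where
  "a_eps a \<epsilon> x = inverse (\<epsilon> ^ (DIM('a) + 2)) * a (x /\<^sub>R \<epsilon>)"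

definition c_eps :: "('a::euclidean_space \<Rightarrow> real) \<Rightarrow> ('a \<Rightarrow> 'a set \<Rightarrow> real) \<Rightarrow> real \<Rightarrow> 'a \<Rightarrow> 'a \<Rightarrow> 'a set \<Rightarrow> real" where
  "c_eps a r \<epsilon> x y \<gamma> =
     (if r x \<gamma> > 0 \<and> r y \<gamma> > 0 then a_eps a \<epsilon> (x - y) * sqrt (r y \<gamma>) / sqrt (r x \<gamma>) else 0)"

definition E_eps :: "'a set measure \<Rightarrow> ('a::euclidean_space \<Rightarrow> real) \<Rightarrow> ('a \<Rightarrow> 'a set \<Rightarrow> real) \<Rightarrow> real
    \<Rightarrow> ('a set \<Rightarrow> real) \<Rightarrow> ('a set \<Rightarrow> real) \<Rightarrow> real" where
  "E_eps \<mu> a r \<epsilon> F G = 1/2 * (\<integral>\<gamma>. (\<integral>x. (\<integral>y.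
       c_eps a r \<epsilon> x y (\<gamma> - {x}) * (F (insert y (\<gamma> - {x})) - F \<gamma>) * (G (insert y (\<gamma> - {x})) - G \<gamma>)
     \<partial>lborel) \<partial>count_space \<gamma>) \<partial>\<mu>)"

definition E_0 :: "'a set measure \<Rightarrow> ('a::euclidean_space \<Rightarrow> real) \<Rightarrow> ('a \<Rightarrow> 'a set \<Rightarrow> real) \<Rightarrow> 'a
    \<Rightarrow> ('a set \<Rightarrow> real) \<Rightarrow> ('a set \<Rightarrow> real) \<Rightarrow> real" where
  "E_0 \<mu> a r e1 F G = (1/2 * (\<integral>x. a x * (x \<bullet> e1)\<^sup>2 \<partial>lborel)) *
     (\<integral>\<gamma>. (\<integral>x. r x \<gamma> * (grad (\<lambda>z. F (insert z \<gamma>)) x \<bullet> grad (\<lambda>z. G (insert z \<gamma>)) x) \<partial>lborel) \<partial>\<mu>)"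

end

theory Submission
  imports Defs
begin

text \<open>
  The Mecke formula for the Cox process with Papangelou intensity \<open>r\<close> turns \<open>\<E>\<^sub>\<epsilon>(F,G)\<close> into one half of the
  \<open>\<mu>\<close>-mean of \<open>\<integral>\<integral> a\<^sub>\<epsilon>(x-y) sqrt(r(x,\<gamma>) r(y,\<gamma>)) (F(\<gamma>\<union>y)-F(\<gamma>\<union>x)) (G(\<gamma>\<union>y)-G(\<gamma>\<union>x)) dx dy\<close>. For a fixed
  configuration \<open>\<gamma>\<close> only local integrability of \<open>r(\<cdot>,\<gamma>)\<close> is needed: substitute \<open>y = x + \<epsilon>h\<close>, replace
  \<open>r(x+\<epsilon>h,\<gamma>)\<close> by \<open>r(x,\<gamma>)\<close> using continuity of translations in \<open>L\<^sup>1\<close>, and let the difference quotients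
  converge; since \<open>a\<close> is radial, its second moment matrix is a multiple of the identity. The inner
  integrals are dominated by a multiple of \<open>\<integral>\<^sub>\<Lambda> r(x,\<gamma>) dx\<close>, whose mean \<open>\<integral>\<^sub>\<Lambda> E g(x) dx\<close> is finite because
  \<open>E Y(x)\<^sup>2\<close> is at most the supremum of the covariance kernel for almost every \<open>x\<close>.

  The Mecke formula is easily verified for an independent sample of Poisson size and is stable under
  independent superposition. It implies the Poisson law and the independence of the counts in disjoint
  sets, so the process built in this way is the Poisson process, and it passes to Cox processes by
  mixing and conditioning.
\<close>

section \<open>Configurations\<close>

text \<open>The difficulties lie less in the limit than in the objects. \<open>pi_pp\<close> is a
  definite description, so nothing is known about it until a Poisson process has been constructed
  and shown to be unique. The Bochner integral of a non-integrable function is 0, so integrals may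
  be reweighted only after nonnegative estimates; the Mecke formula is therefore kept in nonnegative
  form until the last section. A configuration is a set: inserting a point that is already there
  changes nothing, so \<open>F (insert x \<gamma>)\<close> is a smooth function of \<open>x\<close>
  only off \<gamma>. As \<gamma> is countable, hence a Lebesgue null set, a function that is smooth
  everywhere can replace it under the integrals.

  Why local integrability of r suffices: the Mecke factor r(x) turns the asymmetric weight
  r(x)^(-1/2) r(y)^(1/2) into the geometric mean sqrt(r(x) r(y)), which is at most (r(x) + r(y)) /
  2. No lower bound and no continuity of r in x enters.\<close>

lemma space_Gamma_M [simp]: "space (Gamma_M :: 'a::euclidean_space set measure) = Gamma"
  unfolding Gamma_M_def by (rule space_measure_of) auto

lemma finite_Gamma: "\<gamma> \<in> Gamma \<Longrightarrow> bounded B \<Longrightarrow> finite (\<gamma> \<inter> B)"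
  by (auto simp: Gamma_def)

lemma empty_in_Gamma [simp]: "{} \<in> Gamma" by (simp add: Gamma_def)

lemma insert_in_Gamma [simp]: "insert x \<gamma> \<in> Gamma \<longleftrightarrow> \<gamma> \<in> Gamma"
  by (auto simp: Gamma_def Int_insert_left)

lemma subset_in_Gamma: "\<gamma> \<in> Gamma \<Longrightarrow> \<gamma>' \<subseteq> \<gamma> \<Longrightarrow> \<gamma>' \<in> Gamma"
  unfolding Gamma_def mem_Collect_eq
  using finite_subset[OF Int_mono[OF _ subset_refl]] by metis

lemma remove_in_Gamma: "\<gamma> \<in> Gamma \<Longrightarrow> \<gamma> - A \<in> Gamma"
  by (erule subset_in_Gamma) auto

lemma countable_Gamma:
  fixes \<gamma> :: "'a::euclidean_space set"
  assumes "\<gamma> \<in> Gamma" shows "countable \<gamma>"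
proof -
  have "\<gamma> = (\<Union>n::nat. \<gamma> \<inter> ball 0 (real n))"
    using reals_Archimedean2 by (auto simp: dist_norm)
  moreover have "countable (\<Union>n::nat. \<gamma> \<inter> ball 0 (real n))"
    using assms by (intro countable_UN countableI_type countable_finite finite_Gamma[OF assms] bounded_ball)
  ultimately show ?thesis by simp
qed

lemma AE_notin_Gamma: "\<gamma> \<in> Gamma \<Longrightarrow> AE x in lborel. x \<notin> \<gamma>"
  by (rule AE_not_in[OF countable_imp_null_set_lborel[OF countable_Gamma]])

lemma card_Gamma_measurable [measurable]:
  assumes "B \<in> sets borel" "bounded B"
  shows "(\<lambda>\<gamma>. card (\<gamma> \<inter> B)) \<in> Gamma_M \<rightarrow>\<^sub>M count_space UNIV"
proof (subst measurable_count_space_eq2_countable, simp_all, intro allI)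
  fix n
  have "{\<gamma>\<in>Gamma. card (\<gamma> \<inter> B) = n} \<in> sets Gamma_M"
    unfolding Gamma_M_def using assms by (intro sets_measure_of[THEN equalityD2, THEN subsetD] sigma_sets.Basic) auto
  moreover have "(\<lambda>\<gamma>. card (\<gamma> \<inter> B)) -` {n} \<inter> Gamma = {\<gamma>\<in>Gamma. card (\<gamma> \<inter> B) = n}" by auto
  ultimately show "(\<lambda>\<gamma>. card (\<gamma> \<inter> B)) -` {n} \<inter> Gamma \<in> sets Gamma_M" by simp
qed

lemma sets_card_slice:
  assumes E: "E \<in> sets Gamma_M" and B: "B \<in> sets borel" "bounded B"
  shows "{\<gamma>\<in>E. card (\<gamma> \<inter> B) = n} \<in> sets Gamma_M"
proof -
  have "{\<gamma>\<in>E. card (\<gamma> \<inter> B) = n} = E \<inter> ((\<lambda>\<gamma>. card (\<gamma> \<inter> B)) -` {n} \<inter> space Gamma_M)"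
    using sets.sets_into_space[OF E] by auto
  also have "\<dots> \<in> sets Gamma_M"
    using card_Gamma_measurable[OF B] by (intro sets.Int measurable_sets E) auto
  finally show ?thesis .
qed

lemma measurable_GammaI:
  fixes f :: "'w \<Rightarrow> 'a::euclidean_space set"
  assumes "\<And>\<omega>. \<omega> \<in> space N \<Longrightarrow> f \<omega> \<in> Gamma"
  assumes "\<And>B. B \<in> sets borel \<Longrightarrow> bounded B \<Longrightarrow> (\<lambda>\<omega>. card (f \<omega> \<inter> B)) \<in> N \<rightarrow>\<^sub>M count_space UNIV"
  shows "f \<in> N \<rightarrow>\<^sub>M Gamma_M"
  unfolding Gamma_M_def
proof (rule measurable_measure_of)
  fix y :: "'a set set" assume "y \<in> {{\<gamma> \<in> Gamma. card (\<gamma> \<inter> B) = n} |B n. B \<in> sets borel \<and> bounded B}"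
  then obtain B n where y: "y = {\<gamma> \<in> Gamma. card (\<gamma> \<inter> B) = n}" "B \<in> sets borel" "bounded B" by auto
  have "f -` y \<inter> space N = (\<lambda>\<omega>. card (f \<omega> \<inter> B)) -` {n} \<inter> space N"
    using assms(1) y by auto
  also have "\<dots> \<in> sets N" using assms(2)[OF y(2,3)] by (rule measurable_sets) auto
  finally show "f -` y \<inter> space N \<in> sets N" .
qed (use assms(1) in auto)

text \<open>A point outside a locally finite set has positive distance from it, so a small ball with
  centre in the dense set \<open>D\<close> separates the two. This turns membership into countably
  many conditions on counts once \<open>D\<close> is countable, and hence makes it jointly
  measurable in the point and the configuration.\<close>

lemma in_Gamma_iff_balls:
  fixes x :: "'a::euclidean_space"
  assumes D: "\<And>X. open X \<Longrightarrow> X \<noteq> {} \<Longrightarrow> \<exists>d\<in>D. d \<in> X" and \<gamma>: "\<gamma> \<in> Gamma"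
  shows "x \<in> \<gamma> \<longleftrightarrow> (\<forall>q\<in>D. \<forall>n::nat. x \<in> ball q (1 / Suc n) \<longrightarrow> card (\<gamma> \<inter> ball q (1 / Suc n)) \<noteq> 0)"
    (is "_ \<longleftrightarrow> ?R")
proof
  assume x: "x \<in> \<gamma>"
  show ?R using x finite_Gamma[OF \<gamma> bounded_ball] by (auto simp: card_eq_0_iff)
next
  assume R: ?R
  show "x \<in> \<gamma>"
  proof (rule ccontr)
    assume x: "x \<notin> \<gamma>"
    have "finite (\<gamma> \<inter> ball x 1)" using \<gamma> by (rule finite_Gamma) simp
    then obtain d where d: "d > 0" "\<forall>y\<in>\<gamma> \<inter> ball x 1. y \<noteq> x \<longrightarrow> d \<le> dist x y"
      using finite_set_avoid by blast
    define e where "e = min d 1"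
    have e: "e > 0" "\<gamma> \<inter> ball x e = {}" using d x unfolding e_def by fastforce+
    \<comment> \<open>Half of \<open>e\<close>: the ball around \<open>q\<close> contains
      \<open>x\<close>, so its points are within twice its radius of \<open>x\<close>.\<close>
    obtain n :: nat where n: "1 / Suc n < e / 2" using e(1)
      by (metis half_gt_zero nat_approx_posE)
    obtain q where q: "q \<in> D" "q \<in> ball x (1 / Suc n)"
      using D[of "ball x (1 / Suc n)"] by auto
    have "\<gamma> \<inter> ball q (1 / Suc n) \<subseteq> \<gamma> \<inter> ball x e"
    proof -
      have "ball q (1 / Suc n) \<subseteq> ball x e"
      proof
        fix y assume y: "y \<in> ball q (1 / Suc n)"
        have "dist x y \<le> dist x q + dist q y" by (rule dist_triangle)
        then show "y \<in> ball x e" using y q n by auto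
      qed
      then show ?thesis by auto
    qed
    then have "\<gamma> \<inter> ball q (1 / Suc n) = {}" using e by auto
    then show False using R[rule_format, OF q(1), of n] q(2) by (simp add: dist_commute)
  qed
qed

lemma pred_in_Gamma [measurable (raw)]:
  fixes f :: "'w \<Rightarrow> 'a::euclidean_space"
  assumes [measurable]: "f \<in> N \<rightarrow>\<^sub>M borel" "h \<in> N \<rightarrow>\<^sub>M Gamma_M"
  shows "Measurable.pred N (\<lambda>\<omega>. f \<omega> \<in> h \<omega>)"
proof -
  obtain D :: "'a set" where D: "countable D" "\<And>X. open X \<Longrightarrow> X \<noteq> {} \<Longrightarrow> \<exists>d\<in>D. d \<in> X"
    using countable_dense_setE by blast
  have "D \<noteq> {}" using D(2)[of UNIV] by auto
  then have rD: "range (from_nat_into D) = D" using D(1) by (rule range_from_nat_into)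
   have all_from_nat_into: "(\<forall>q\<in>D. P q) \<longleftrightarrow> (\<forall>k. P (from_nat_into D k))" for P
    using rD by (metis rangeE rangeI)
  have "Measurable.pred N (\<lambda>\<omega>. \<forall>k n::nat. f \<omega> \<in> ball (from_nat_into D k) (1 / Suc n) \<longrightarrow> card (h \<omega> \<inter> ball (from_nat_into D k) (1 / Suc n)) \<noteq> 0)"
    (is "Measurable.pred N (\<lambda>\<omega>. \<forall>k n::nat. ?P k n \<omega> \<longrightarrow> ?Q k n \<omega>)")
  proof (intro pred_intros_countable pred_intros_logic(4))
    fix k n :: nat
    show "Measurable.pred N (?P k n)" unfolding mem_ball by measurable
    have "(\<lambda>\<omega>. card (h \<omega> \<inter> ball (from_nat_into D k) (1 / Suc n))) \<in> N \<rightarrow>\<^sub>M count_space UNIV"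
      by (rule measurable_compose[OF assms(2) card_Gamma_measurable]) auto
    then show "Measurable.pred N (?Q k n)" by measurable
  qed
  then have "Measurable.pred N (\<lambda>\<omega>. \<forall>q\<in>D. \<forall>n::nat. f \<omega> \<in> ball q (1 / Suc n) \<longrightarrow> card (h \<omega> \<inter> ball q (1 / Suc n)) \<noteq> 0)"
    unfolding all_from_nat_into .
  also have "?this \<longleftrightarrow> ?thesis"
    using in_Gamma_iff_balls[OF D(2)] measurable_space[OF assms(2)] by (intro measurable_cong) auto
  finally show ?thesis .
qed

lemma measurable_insert_Gamma [measurable (raw)]:
  fixes f :: "'w \<Rightarrow> 'a::euclidean_space"
  assumes [measurable]: "f \<in> N \<rightarrow>\<^sub>M borel" "h \<in> N \<rightarrow>\<^sub>M Gamma_M"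
  shows "(\<lambda>\<omega>. insert (f \<omega>) (h \<omega>)) \<in> N \<rightarrow>\<^sub>M Gamma_M"
proof (rule measurable_GammaI)
  show "insert (f \<omega>) (h \<omega>) \<in> Gamma" if "\<omega> \<in> space N" for \<omega>
    using measurable_space[OF assms(2) that] by simp
  fix B :: "'a set" assume B[measurable]: "B \<in> sets borel" and "bounded B"
  have [measurable]: "(\<lambda>\<omega>. card (h \<omega> \<inter> B)) \<in> N \<rightarrow>\<^sub>M count_space UNIV"
    by (rule measurable_compose[OF assms(2) card_Gamma_measurable]) fact+
  have "(\<lambda>\<omega>. card (h \<omega> \<inter> B) + (if f \<omega> \<in> B \<and> f \<omega> \<notin> h \<omega> then 1 else 0)) \<in> N \<rightarrow>\<^sub>M count_space UNIV"
    by measurable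
  also have "?this \<longleftrightarrow> (\<lambda>\<omega>. card (insert (f \<omega>) (h \<omega>) \<inter> B)) \<in> N \<rightarrow>\<^sub>M count_space UNIV"
  proof (rule measurable_cong)
    fix \<omega> assume "\<omega> \<in> space N"
    then have "finite (h \<omega> \<inter> B)" using measurable_space[OF assms(2)] \<open>bounded B\<close> by (auto intro: finite_Gamma)
    then show "card (h \<omega> \<inter> B) + (if f \<omega> \<in> B \<and> f \<omega> \<notin> h \<omega> then 1 else 0) = card (insert (f \<omega>) (h \<omega>) \<inter> B)"
      by (auto simp: Int_insert_left insert_absorb card_insert_if)
  qed
  finally show "(\<lambda>\<omega>. card (insert (f \<omega>) (h \<omega>) \<inter> B)) \<in> N \<rightarrow>\<^sub>M count_space UNIV" .
qed

lemma measurable_remove_Gamma [measurable (raw)]: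
  fixes f :: "'w \<Rightarrow> 'a::euclidean_space"
  assumes [measurable]: "f \<in> N \<rightarrow>\<^sub>M borel" "h \<in> N \<rightarrow>\<^sub>M Gamma_M"
  shows "(\<lambda>\<omega>. h \<omega> - {f \<omega>}) \<in> N \<rightarrow>\<^sub>M Gamma_M"
proof (rule measurable_GammaI)
  show "h \<omega> - {f \<omega>} \<in> Gamma" if "\<omega> \<in> space N" for \<omega>
    using measurable_space[OF assms(2) that] by (simp add: remove_in_Gamma)
  fix B :: "'a set" assume B[measurable]: "B \<in> sets borel" and "bounded B"
  have [measurable]: "(\<lambda>\<omega>. card (h \<omega> \<inter> B)) \<in> N \<rightarrow>\<^sub>M count_space UNIV"
    by (rule measurable_compose[OF assms(2) card_Gamma_measurable]) fact+
  have "(\<lambda>\<omega>. card (h \<omega> \<inter> B) - (if f \<omega> \<in> B \<and> f \<omega> \<in> h \<omega> then 1 else 0)) \<in> N \<rightarrow>\<^sub>M count_space UNIV"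
    by measurable
  also have "?this \<longleftrightarrow> (\<lambda>\<omega>. card ((h \<omega> - {f \<omega>}) \<inter> B)) \<in> N \<rightarrow>\<^sub>M count_space UNIV"
  proof (rule measurable_cong)
    fix \<omega> assume "\<omega> \<in> space N"
    then have "finite (h \<omega> \<inter> B)" using measurable_space[OF assms(2)] \<open>bounded B\<close> by (auto intro: finite_Gamma)
    moreover have "(h \<omega> - {f \<omega>}) \<inter> B = h \<omega> \<inter> B - {f \<omega>}" by auto
    ultimately show "card (h \<omega> \<inter> B) - (if f \<omega> \<in> B \<and> f \<omega> \<in> h \<omega> then 1 else 0) = card ((h \<omega> - {f \<omega>}) \<inter> B)"
      by (simp add: card_Diff_singleton_if)
  qed
  finally show "(\<lambda>\<omega>. card ((h \<omega> - {f \<omega>}) \<inter> B)) \<in> N \<rightarrow>\<^sub>M count_space UNIV" .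
qed

lemma nn_integral_count_space_Gamma_SUP:
  fixes f :: "'a::euclidean_space \<Rightarrow> ennreal"
  shows "(\<integral>\<^sup>+x. f x \<partial>count_space \<gamma>) = (SUP n::nat. \<integral>\<^sup>+x. f x * indicator (ball 0 (real n)) x \<partial>count_space \<gamma>)"
proof -
  have "(\<integral>\<^sup>+x. f x \<partial>count_space \<gamma>) = (\<integral>\<^sup>+x. (SUP n::nat. f x * indicator (ball 0 (real n)) x) \<partial>count_space \<gamma>)"
  proof (rule nn_integral_cong)
    fix x :: 'a
    obtain n :: nat where "norm x < real n" using reals_Archimedean2 by blast
    then have "f x * indicator (ball 0 (real n)) x = f x" by simp
    then show "f x = (SUP n::nat. f x * indicator (ball 0 (real n)) x)"
      by (intro antisym SUP_least SUP_upper2[of n]) (auto simp: indicator_def)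
  qed
  also have "\<dots> = (SUP n::nat. \<integral>\<^sup>+x. f x * indicator (ball 0 (real n)) x \<partial>count_space \<gamma>)"
    by (rule nn_integral_monotone_convergence_SUP)
       (auto simp: incseq_def le_fun_def indicator_def intro!: mult_left_mono)
  finally show ?thesis .
qed

text \<open>The counting measure on \<open>h \<omega>\<close> is not a subprobability, so
  measurability of kernel integrals does not apply to it directly. Inside a ball it becomes a
  subprobability kernel after division by one plus the number of points there; the factor is
  multiplied back, and the balls exhaust the space monotonically.\<close>

lemma nn_integral_count_space_Gamma_measurable [measurable (raw)]:
  fixes f :: "'w \<Rightarrow> 'a::euclidean_space \<Rightarrow> ennreal"
  assumes f[measurable]: "(\<lambda>(\<omega>, x). f \<omega> x) \<in> borel_measurable (N \<Otimes>\<^sub>M borel)"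
    and h[measurable]: "h \<in> N \<rightarrow>\<^sub>M Gamma_M"
  shows "(\<lambda>\<omega>. \<integral>\<^sup>+x. f \<omega> x \<partial>count_space (h \<omega>)) \<in> borel_measurable N"
proof -
  have hG: "h \<omega> \<in> Gamma" if "\<omega> \<in> space N" for \<omega> using measurable_space[OF h that] by simp
  have "(\<lambda>\<omega>. \<integral>\<^sup>+x. f \<omega> x * indicator (ball 0 (real n)) x \<partial>count_space (h \<omega>)) \<in> borel_measurable N" for n :: nat
  proof -
    define \<Lambda> where "\<Lambda> = ball (0::'a) (real n)"
    have \<Lambda>[measurable]: "\<Lambda> \<in> sets borel" "bounded \<Lambda>" by (auto simp: \<Lambda>_def)
    \<comment> \<open>Adding 1 keeps the weight defined on an empty window and keeps the total mass
      below 1.\<close>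
    define c :: "'w \<Rightarrow> ennreal" where "c = (\<lambda>\<omega>. ennreal (1 / (1 + real (card (h \<omega> \<inter> \<Lambda>)))))"
    define K where "K = (\<lambda>\<omega>. distr (density (count_space (h \<omega> \<inter> \<Lambda>)) (\<lambda>_. c \<omega>)) borel id)"
    have cm: "(\<lambda>\<omega>. card (h \<omega> \<inter> \<Lambda> \<inter> B)) \<in> N \<rightarrow>\<^sub>M count_space UNIV" if "B \<in> sets borel" for B
      using \<Lambda> that unfolding Int_assoc
      by (intro measurable_compose[OF h card_Gamma_measurable]) auto
    have [measurable]: "(\<lambda>\<omega>. card (h \<omega> \<inter> \<Lambda>)) \<in> N \<rightarrow>\<^sub>M count_space UNIV"
      by (rule measurable_compose[OF h card_Gamma_measurable]) fact+
    have eK: "emeasure (K \<omega>) B = ennreal (real (card (h \<omega> \<inter> \<Lambda> \<inter> B)) / (1 + real (card (h \<omega> \<inter> \<Lambda>))))"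
      if "\<omega> \<in> space N" "B \<in> sets borel" for \<omega> B
    proof -
      have fin: "finite (h \<omega> \<inter> \<Lambda>)" using hG[OF that(1)] \<Lambda>(2) by (rule finite_Gamma)
      have "emeasure (K \<omega>) B = emeasure (density (count_space (h \<omega> \<inter> \<Lambda>)) (\<lambda>_. c \<omega>)) (h \<omega> \<inter> \<Lambda> \<inter> B)"
        unfolding K_def using that(2) by (subst emeasure_distr) (simp_all, rule arg_cong2[where f=emeasure], auto)
      also have "\<dots> = (\<integral>\<^sup>+x. c \<omega> * indicator (h \<omega> \<inter> \<Lambda> \<inter> B) x \<partial>count_space (h \<omega> \<inter> \<Lambda>))"
        by (rule emeasure_density) auto
      also have "\<dots> = c \<omega> * emeasure (count_space (h \<omega> \<inter> \<Lambda>)) (h \<omega> \<inter> \<Lambda> \<inter> B)"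
        by (subst nn_integral_cmult_indicator) auto
      also have "emeasure (count_space (h \<omega> \<inter> \<Lambda>)) (h \<omega> \<inter> \<Lambda> \<inter> B) = ennreal (real (card (h \<omega> \<inter> \<Lambda> \<inter> B)))"
        using fin by (subst emeasure_count_space_finite) (auto simp: ennreal_of_nat_eq_real_of_nat)
      finally show ?thesis by (simp add: c_def ennreal_mult'[symmetric])
    qed
    have K: "K \<in> N \<rightarrow>\<^sub>M subprob_algebra borel"
    proof (rule measurable_subprob_algebra)
      fix \<omega> assume w: "\<omega> \<in> space N"
      show "subprob_space (K \<omega>)"
        by (rule subprob_spaceI) (use eK[OF w, of UNIV] in \<open>auto simp: K_def\<close>)
      show "sets (K \<omega>) = sets borel" by (simp add: K_def)
    next
      fix B :: "'a set" assume B: "B \<in> sets borel"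
      note [measurable] = cm[OF B]
      have "(\<lambda>\<omega>. ennreal (real (card (h \<omega> \<inter> \<Lambda> \<inter> B)) / (1 + real (card (h \<omega> \<inter> \<Lambda>))))) \<in> borel_measurable N"
        by measurable
      then show "(\<lambda>\<omega>. emeasure (K \<omega>) B) \<in> borel_measurable N"
        by (rule measurable_cong[THEN iffD1, rotated]) (simp add: eK B)
    qed
    have "(\<lambda>\<omega>. (1 + of_nat (card (h \<omega> \<inter> \<Lambda>))) * (\<integral>\<^sup>+x. f \<omega> x \<partial>K \<omega>)) \<in> borel_measurable N"
      using f by (intro borel_measurable_times_ennreal nn_integral_measurable_subprob_algebra2[OF _ K]) measurable
    also have "?this \<longleftrightarrow> (\<lambda>\<omega>. \<integral>\<^sup>+x. f \<omega> x * indicator \<Lambda> x \<partial>count_space (h \<omega>)) \<in> borel_measurable N"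
    proof (rule measurable_cong)
      fix \<omega> assume w: "\<omega> \<in> space N"
      have [measurable]: "f \<omega> \<in> borel_measurable borel" using f w by measurable
      have "(\<integral>\<^sup>+x. f \<omega> x \<partial>K \<omega>) = (\<integral>\<^sup>+x. c \<omega> * f \<omega> x \<partial>count_space (h \<omega> \<inter> \<Lambda>))"
        unfolding K_def by (subst nn_integral_distr) (auto simp: nn_integral_density)
      also have "\<dots> = c \<omega> * (\<integral>\<^sup>+x. f \<omega> x \<partial>count_space (h \<omega> \<inter> \<Lambda>))"
        by (subst nn_integral_cmult) auto
      also have "(\<integral>\<^sup>+x. f \<omega> x \<partial>count_space (h \<omega> \<inter> \<Lambda>)) = (\<integral>\<^sup>+x. f \<omega> x * indicator \<Lambda> x \<partial>count_space (h \<omega>))"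
        by (subst (1 2) nn_integral_count_space_indicator)
           (auto intro!: nn_integral_cong simp: indicator_def split: if_splits)

      finally have "(\<integral>\<^sup>+x. f \<omega> x \<partial>K \<omega>) = c \<omega> * (\<integral>\<^sup>+x. f \<omega> x * indicator \<Lambda> x \<partial>count_space (h \<omega>))" .
      moreover have "(1 + of_nat (card (h \<omega> \<inter> \<Lambda>))) * c \<omega> = 1"
      proof -
        have e: "1 + of_nat (card (h \<omega> \<inter> \<Lambda>)) = ennreal (1 + real (card (h \<omega> \<inter> \<Lambda>)))"
          by (subst ennreal_plus) (auto simp: ennreal_of_nat_eq_real_of_nat)
        show ?thesis unfolding c_def e by (subst ennreal_mult[symmetric]) auto
      qed
      ultimately show "(1 + of_nat (card (h \<omega> \<inter> \<Lambda>))) * (\<integral>\<^sup>+x. f \<omega> x \<partial>K \<omega>)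
          = (\<integral>\<^sup>+x. f \<omega> x * indicator \<Lambda> x \<partial>count_space (h \<omega>))"
        by (metis mult.assoc mult_1)
    qed
    finally show ?thesis by (simp add: \<Lambda>_def)
  qed
  then show ?thesis
    by (subst nn_integral_count_space_Gamma_SUP) (intro borel_measurable_SUP countableI_type)
qed

section \<open>Poisson point processes and the Mecke formula\<close>

text \<open>Mecke's characterization of the Poisson process. \<open>f\<close> sees the whole
  configuration together with one of its points, hence the inserted point on the right. Nonnegative
  test functions avoid all integrability conditions, and an \<open>ennreal\<close> intensity can be
  cut off by indicators without change of type.\<close>

definition mecke :: "('a::euclidean_space \<Rightarrow> ennreal) \<Rightarrow> 'a set measure \<Rightarrow> bool" where
  "mecke \<rho> M \<longleftrightarrow> sets M = sets Gamma_M \<and> prob_space M \<and>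
     (\<forall>f. (\<lambda>(\<gamma>, x). f \<gamma> x) \<in> borel_measurable (Gamma_M \<Otimes>\<^sub>M borel) \<longrightarrow>
        (\<integral>\<^sup>+\<gamma>. \<integral>\<^sup>+x. f \<gamma> x \<partial>count_space \<gamma> \<partial>M) =
        (\<integral>\<^sup>+\<gamma>. \<integral>\<^sup>+x. \<rho> x * f (insert x \<gamma>) x \<partial>lborel \<partial>M))"

lemma meckeD:
  assumes "mecke \<rho> M"
  shows "sets M = sets Gamma_M" "prob_space M"
    "(\<lambda>(\<gamma>, x). f \<gamma> x) \<in> borel_measurable (Gamma_M \<Otimes>\<^sub>M borel) \<Longrightarrow>
        (\<integral>\<^sup>+\<gamma>. \<integral>\<^sup>+x. f \<gamma> x \<partial>count_space \<gamma> \<partial>M) =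
        (\<integral>\<^sup>+\<gamma>. \<integral>\<^sup>+x. \<rho> x * f (insert x \<gamma>) x \<partial>lborel \<partial>M)"
  using assms by (auto simp: mecke_def)

lemma nn_integral_count_space_empty [simp]: "(\<integral>\<^sup>+x. f x \<partial>count_space {}) = 0"
  by (rule nn_integral_empty) simp

lemma nn_integral_count_space_insert:
  assumes "x \<notin> A"
  shows "(\<integral>\<^sup>+y. f y \<partial>count_space (insert x A)) = f x + (\<integral>\<^sup>+y. f y \<partial>count_space A)"
proof -
  have "(\<integral>\<^sup>+y. f y \<partial>count_space (insert x A))
      = (\<integral>\<^sup>+y. f y * indicator {x} y + f y * indicator A y \<partial>count_space UNIV)"
    using assms by (subst nn_integral_count_space_indicator) (auto intro!: nn_integral_cong simp: indicator_def)
  also have "\<dots> = (\<integral>\<^sup>+y. f y * indicator {x} y \<partial>count_space UNIV) + (\<integral>\<^sup>+y. f y * indicator A y \<partial>count_space UNIV)"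
    by (rule nn_integral_add) auto
  also have "(\<integral>\<^sup>+y. f y * indicator {x} y \<partial>count_space UNIV) = f x"
    by (subst nn_integral_indicator_singleton) auto
  also have "(\<integral>\<^sup>+y. f y * indicator A y \<partial>count_space UNIV) = (\<integral>\<^sup>+y. f y \<partial>count_space A)"
    by (subst (2) nn_integral_count_space_indicator) auto
  finally show ?thesis .
qed

section \<open>Independent samples of fixed and of Poisson size\<close>

text \<open>The points are collected into a set, so coinciding points merge. Only for a diffuse
  \<open>D\<close> does the sample have \<open>n\<close> points almost surely.\<close>

primrec iid_points :: "('a::euclidean_space) measure \<Rightarrow> nat \<Rightarrow> 'a set measure" where
  "iid_points D 0 = return Gamma_M {}"
| "iid_points D (Suc n) = distr (D \<Otimes>\<^sub>M iid_points D n) Gamma_M (\<lambda>(x, \<gamma>). insert x \<gamma>)"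

lemma sets_iid_points [simp, measurable_cong]: "sets (iid_points D n) = sets Gamma_M"
  by (cases n) auto

lemma space_iid_points [simp]: "space (iid_points D n) = Gamma"
  using sets_eq_imp_space_eq[OF sets_iid_points] by simp

lemma prob_space_iid_points:
  assumes "prob_space D" and [measurable_cong]: "sets D = sets borel"
  shows "prob_space (iid_points D n)"
proof (induction n)
  case 0 show ?case by (simp add: prob_space_return)
next
  case (Suc n)
  interpret D: prob_space D by fact
  interpret Q: prob_space "iid_points D n" by fact
  interpret pair_prob_space D "iid_points D n" ..
  show ?case unfolding iid_points.simps by (rule prob_space_distr) measurable
qed

lemma nn_integral_iid_points_Suc:
  assumes D: "prob_space D" and [measurable_cong]: "sets D = sets borel"
    and h[measurable]: "h \<in> borel_measurable Gamma_M"
  shows "(\<integral>\<^sup>+\<gamma>. h \<gamma> \<partial>iid_points D (Suc n)) = (\<integral>\<^sup>+x. \<integral>\<^sup>+\<gamma>. h (insert x \<gamma>) \<partial>iid_points D n \<partial>D)"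
proof -
  interpret D: prob_space D by fact
  interpret Q: prob_space "iid_points D n" by (rule prob_space_iid_points) fact+
  have "(\<integral>\<^sup>+\<gamma>. h \<gamma> \<partial>iid_points D (Suc n)) = (\<integral>\<^sup>+p. h (insert (fst p) (snd p)) \<partial>(D \<Otimes>\<^sub>M iid_points D n))"
    unfolding iid_points.simps by (subst nn_integral_distr) (auto simp: split_beta')
  also have "\<dots> = (\<integral>\<^sup>+x. \<integral>\<^sup>+\<gamma>. h (insert x \<gamma>) \<partial>iid_points D n \<partial>D)"
    by (subst Q.nn_integral_fst[symmetric]) (simp_all)
  finally show ?thesis .
qed

text \<open>By exchangeability every point of the sample contributes the same amount. The induction
  splits off the point \<open>y\<close> added last: its own term gives the integral once, and the
  induction hypothesis for \<open>f\<close> with \<open>y\<close> inserted gives it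
  \<open>Suc n\<close> more times, because insertions commute.\<close>

lemma iid_points_mecke:
  fixes D :: "'a::euclidean_space measure"
  assumes D: "prob_space D" and sD[measurable_cong]: "sets D = sets borel"
    and nul: "\<And>\<gamma>. \<gamma> \<in> Gamma \<Longrightarrow> AE x in D. x \<notin> \<gamma>"
    and f: "(\<lambda>(\<gamma>, x). f \<gamma> x) \<in> borel_measurable (Gamma_M \<Otimes>\<^sub>M borel)"
  shows "(\<integral>\<^sup>+\<gamma>. \<integral>\<^sup>+x. f \<gamma> x \<partial>count_space \<gamma> \<partial>iid_points D (Suc n)) =
    of_nat (Suc n) * (\<integral>\<^sup>+x. \<integral>\<^sup>+\<gamma>. f (insert x \<gamma>) x \<partial>iid_points D n \<partial>D)"
  using f
proof (induction n arbitrary: f)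
  case (0 f)
  note [measurable] = 0
  have "(\<integral>\<^sup>+\<gamma>. \<integral>\<^sup>+x. f \<gamma> x \<partial>count_space \<gamma> \<partial>iid_points D (Suc 0)) =
    (\<integral>\<^sup>+x. \<integral>\<^sup>+\<gamma>. \<integral>\<^sup>+y. f (insert x \<gamma>) y \<partial>count_space (insert x \<gamma>) \<partial>return Gamma_M {} \<partial>D)"
    by (subst nn_integral_iid_points_Suc[OF D sD]) auto
  also have "\<dots> = (\<integral>\<^sup>+x. f {x} x \<partial>D)"
    by (intro nn_integral_cong, subst nn_integral_return)
       (auto simp: nn_integral_count_space_insert)
  also have "\<dots> = (\<integral>\<^sup>+x. \<integral>\<^sup>+\<gamma>. f (insert x \<gamma>) x \<partial>return Gamma_M {} \<partial>D)"
    by (intro nn_integral_cong, subst nn_integral_return) auto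
  finally show ?case by simp
next
  case (Suc n f)
  note [measurable] = Suc.prems
  interpret D: prob_space D by fact
  interpret Q: prob_space "iid_points D (Suc n)" by (rule prob_space_iid_points) fact+
  interpret Q': prob_space "iid_points D n" by (rule prob_space_iid_points) fact+
  interpret DQ: pair_prob_space D "iid_points D (Suc n)" ..
  interpret DD: pair_prob_space D D ..
  let ?Q = "iid_points D (Suc n)"
  let ?I = "\<integral>\<^sup>+x. \<integral>\<^sup>+\<gamma>. f (insert x \<gamma>) x \<partial>?Q \<partial>D"
  have spD: "space D = UNIV" using sets_eq_imp_space_eq[OF sD] by simp
  have "(\<integral>\<^sup>+\<gamma>. \<integral>\<^sup>+x. f \<gamma> x \<partial>count_space \<gamma> \<partial>iid_points D (Suc (Suc n))) =
    (\<integral>\<^sup>+y. \<integral>\<^sup>+\<gamma>. \<integral>\<^sup>+x. f (insert y \<gamma>) x \<partial>count_space (insert y \<gamma>) \<partial>?Q \<partial>D)"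
    by (subst nn_integral_iid_points_Suc[OF D sD]) (auto simp del: iid_points.simps)
  \<comment> \<open>With \<open>y\<close> integrated innermost, \<open>nul\<close> applies to a
    fixed \<gamma>: the new point is almost surely not in \<gamma>, and the sum over
    \<open>insert y \<gamma>\<close> splits.\<close>
  also have "\<dots> = (\<integral>\<^sup>+\<gamma>. \<integral>\<^sup>+y. \<integral>\<^sup>+x. f (insert y \<gamma>) x \<partial>count_space (insert y \<gamma>) \<partial>D \<partial>?Q)"
    by (rule DQ.Fubini'[symmetric]) measurable
  also have "\<dots> = (\<integral>\<^sup>+\<gamma>. \<integral>\<^sup>+y. f (insert y \<gamma>) y + (\<integral>\<^sup>+x. f (insert y \<gamma>) x \<partial>count_space \<gamma>) \<partial>D \<partial>?Q)"
  proof (rule nn_integral_cong, rule nn_integral_cong_AE)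
    fix \<gamma> assume "\<gamma> \<in> space ?Q"
    then have "\<gamma> \<in> Gamma" by (simp del: iid_points.simps)
    from nul[OF this] show "AE y in D. (\<integral>\<^sup>+x. f (insert y \<gamma>) x \<partial>count_space (insert y \<gamma>)) =
        f (insert y \<gamma>) y + (\<integral>\<^sup>+x. f (insert y \<gamma>) x \<partial>count_space \<gamma>)"
      by eventually_elim (simp add: nn_integral_count_space_insert)
  qed
  also have "\<dots> = (\<integral>\<^sup>+y. \<integral>\<^sup>+\<gamma>. f (insert y \<gamma>) y + (\<integral>\<^sup>+x. f (insert y \<gamma>) x \<partial>count_space \<gamma>) \<partial>?Q \<partial>D)"
    by (rule DQ.Fubini') measurable
  also have "\<dots> = (\<integral>\<^sup>+y. (\<integral>\<^sup>+\<gamma>. f (insert y \<gamma>) y \<partial>?Q) +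
      (\<integral>\<^sup>+\<gamma>. \<integral>\<^sup>+x. f (insert y \<gamma>) x \<partial>count_space \<gamma> \<partial>?Q) \<partial>D)"
  proof (rule nn_integral_cong, rule nn_integral_add)
    fix y :: 'a
    have [measurable]: "(\<lambda>\<gamma>. (insert y \<gamma>, y)) \<in> Gamma_M \<rightarrow>\<^sub>M Gamma_M \<Otimes>\<^sub>M borel"
      by measurable
    show "(\<lambda>\<gamma>. f (insert y \<gamma>) y) \<in> borel_measurable ?Q"
      using measurable_compose[OF \<open>(\<lambda>\<gamma>. (insert y \<gamma>, y)) \<in> _\<close> Suc.prems] by (simp del: iid_points.simps cong: measurable_cong_sets)
    have "(\<lambda>(\<gamma>, x). f (insert y \<gamma>) x) \<in> borel_measurable (Gamma_M \<Otimes>\<^sub>M borel)"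
      by measurable
    then have "(\<lambda>\<gamma>. \<integral>\<^sup>+x. f (insert y \<gamma>) x \<partial>count_space \<gamma>) \<in> borel_measurable Gamma_M"
      by (rule nn_integral_count_space_Gamma_measurable) measurable
    then show "(\<lambda>\<gamma>. \<integral>\<^sup>+x. f (insert y \<gamma>) x \<partial>count_space \<gamma>) \<in> borel_measurable ?Q"
      by (simp del: iid_points.simps cong: measurable_cong_sets)
  qed
  also have "\<dots> = ?I + (\<integral>\<^sup>+y. \<integral>\<^sup>+\<gamma>. \<integral>\<^sup>+x. f (insert y \<gamma>) x \<partial>count_space \<gamma> \<partial>?Q \<partial>D)"
    by (rule nn_integral_add) measurable
  also have "(\<integral>\<^sup>+y. \<integral>\<^sup>+\<gamma>. \<integral>\<^sup>+x. f (insert y \<gamma>) x \<partial>count_space \<gamma> \<partial>?Q \<partial>D) =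
     (\<integral>\<^sup>+y. of_nat (Suc n) * (\<integral>\<^sup>+x. \<integral>\<^sup>+\<gamma>. f (insert y (insert x \<gamma>)) x \<partial>iid_points D n \<partial>D) \<partial>D)"
    by (intro nn_integral_cong Suc.IH) (measurable)
  also have "\<dots> = of_nat (Suc n) * (\<integral>\<^sup>+y. \<integral>\<^sup>+x. \<integral>\<^sup>+\<gamma>. f (insert y (insert x \<gamma>)) x \<partial>iid_points D n \<partial>D \<partial>D)"
    by (rule nn_integral_cmult) measurable
  also have "(\<integral>\<^sup>+y. \<integral>\<^sup>+x. \<integral>\<^sup>+\<gamma>. f (insert y (insert x \<gamma>)) x \<partial>iid_points D n \<partial>D \<partial>D) =
    (\<integral>\<^sup>+x. \<integral>\<^sup>+y. \<integral>\<^sup>+\<gamma>. f (insert y (insert x \<gamma>)) x \<partial>iid_points D n \<partial>D \<partial>D)"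
    by (rule DD.Fubini') measurable
  also have "\<dots> = ?I"
  proof (rule nn_integral_cong)
    fix x assume "x \<in> space D"
    show "(\<integral>\<^sup>+y. \<integral>\<^sup>+\<gamma>. f (insert y (insert x \<gamma>)) x \<partial>iid_points D n \<partial>D) = (\<integral>\<^sup>+\<gamma>. f (insert x \<gamma>) x \<partial>?Q)"
      by (subst nn_integral_iid_points_Suc[OF D sD]) (auto simp: insert_commute)
  qed
  also have "?I + of_nat (Suc n) * ?I = of_nat (Suc (Suc n)) * ?I"
    by (simp only: of_nat_Suc[of "Suc n"] distrib_right mult_1)
  finally show ?case .
qed

text \<open>The Poisson weights satisfy (n+1) p(n+1) = L p(n). The factor n+1 is the one produced by
  \<open>iid_points_mecke\<close>, and L undoes the normalization of the intensity to the
  probability density of one point.\<close>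

lemma mecke_exists_finite:
  fixes \<rho> :: "'a::euclidean_space \<Rightarrow> ennreal"
  assumes \<rho>[measurable]: "\<rho> \<in> borel_measurable borel" and fin: "(\<integral>\<^sup>+x. \<rho> x \<partial>lborel) < \<infinity>"
  shows "\<exists>M. mecke \<rho> M"
proof (cases "(\<integral>\<^sup>+x. \<rho> x \<partial>lborel) = 0")
  \<comment> \<open>Zero mass cannot be normalized; the process is then the empty
    configuration.\<close>
  case True
  then have ae: "AE x in lborel. \<rho> x = 0" by (subst (asm) nn_integral_0_iff_AE) auto
  have "mecke \<rho> (return Gamma_M {})"
    unfolding mecke_def
  proof (intro conjI allI impI)
    fix f :: "'a set \<Rightarrow> 'a \<Rightarrow> ennreal" assume [measurable]: "(\<lambda>(\<gamma>, x). f \<gamma> x) \<in> borel_measurable (Gamma_M \<Otimes>\<^sub>M borel)"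
    have "(\<integral>\<^sup>+\<gamma>. \<integral>\<^sup>+x. f \<gamma> x \<partial>count_space \<gamma> \<partial>return Gamma_M {}) = 0"
      by (subst nn_integral_return) auto
    moreover have "(\<integral>\<^sup>+x. \<rho> x * f (insert x \<gamma>) x \<partial>lborel) = 0" for \<gamma>
      by (subst nn_integral_cong_AE[where v="\<lambda>_. 0"]) (use ae in auto)
    ultimately show "(\<integral>\<^sup>+\<gamma>. \<integral>\<^sup>+x. f \<gamma> x \<partial>count_space \<gamma> \<partial>return Gamma_M {}) =
      (\<integral>\<^sup>+\<gamma>. \<integral>\<^sup>+x. \<rho> x * f (insert x \<gamma>) x \<partial>lborel \<partial>return Gamma_M {})" by simp
  qed (auto simp: prob_space_return)
  then show ?thesis ..
next
  case False
  obtain L where L: "(\<integral>\<^sup>+x. \<rho> x \<partial>lborel) = ennreal L" "L > 0"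
    using fin False by (cases "\<integral>\<^sup>+x. \<rho> x \<partial>lborel") (auto simp: less_le)
  define D where "D = density lborel (\<lambda>x. \<rho> x / ennreal L)"
  have sD[measurable_cong]: "sets D = sets borel" by (simp add: D_def)
  have LL: "ennreal L * (r / ennreal L) = r" for r :: ennreal
    using L(2) by (metis ennreal_eq_0_iff ennreal_neq_top ennreal_times_divide linorder_not_le
        mult.commute ennreal_mult_divide_eq)
  have D: "prob_space D"
  proof (rule prob_spaceI)
    have "emeasure D (space D) = (\<integral>\<^sup>+x. \<rho> x / ennreal L \<partial>lborel)"
      by (simp add: D_def emeasure_density)
    also have "\<dots> = 1" using L by (simp add: nn_integral_divide ennreal_divide_self)
    finally show "emeasure D (space D) = 1" .
  qed
  interpret D: prob_space D by fact
  have nul: "AE x in D. x \<notin> \<gamma>" if "\<gamma> \<in> Gamma" for \<gamma> :: "'a set"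
    unfolding D_def using AE_notin_Gamma[OF that] by (subst AE_density) auto
  define M where "M = measure_pmf (poisson_pmf L) \<bind> iid_points D"
  have K: "iid_points D \<in> measure_pmf (poisson_pmf L) \<rightarrow>\<^sub>M prob_algebra Gamma_M"
    by (auto simp: space_prob_algebra prob_space_iid_points[OF D sD])
  then have K': "iid_points D \<in> measure_pmf (poisson_pmf L) \<rightarrow>\<^sub>M subprob_algebra Gamma_M"
    by (rule measurable_prob_algebraD)
  have int: "(\<integral>\<^sup>+\<gamma>. h \<gamma> \<partial>M) = (\<Sum>n. ennreal (L ^ n / fact n * exp (- L)) * (\<integral>\<^sup>+\<gamma>. h \<gamma> \<partial>iid_points D n))"
    if "h \<in> borel_measurable Gamma_M" for h
    unfolding M_def using L(2)
    by (subst nn_integral_bind[OF that K'])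
       (simp add: nn_integral_measure_pmf nn_integral_count_space_nat)
  have "mecke \<rho> M"
    unfolding mecke_def
  proof (intro conjI allI impI)
    show "sets M = sets Gamma_M" unfolding M_def by (rule sets_bind[OF sets_kernel[OF K']]) auto
    show "prob_space M" unfolding M_def by (rule prob_space_bind'[OF _ K]) (simp add: space_prob_algebra prob_space_measure_pmf)
    fix f :: "'a set \<Rightarrow> 'a \<Rightarrow> ennreal" assume f[measurable]: "(\<lambda>(\<gamma>, x). f \<gamma> x) \<in> borel_measurable (Gamma_M \<Otimes>\<^sub>M borel)"
    define J where "J n = (\<integral>\<^sup>+\<gamma>. \<integral>\<^sup>+x. \<rho> x * f (insert x \<gamma>) x \<partial>lborel \<partial>iid_points D n)" for n
    have J: "(\<integral>\<^sup>+x. \<integral>\<^sup>+\<gamma>. f (insert x \<gamma>) x \<partial>iid_points D n \<partial>D) * ennreal L = J n" for n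
    proof -
      interpret Q: prob_space "iid_points D n" by (rule prob_space_iid_points) fact+
      interpret DQ: pair_sigma_finite D "iid_points D n" ..
      have "(\<integral>\<^sup>+x. \<integral>\<^sup>+\<gamma>. f (insert x \<gamma>) x \<partial>iid_points D n \<partial>D) = (\<integral>\<^sup>+\<gamma>. \<integral>\<^sup>+x. f (insert x \<gamma>) x \<partial>D \<partial>iid_points D n)"
        by (rule DQ.Fubini'[symmetric]) measurable
      also have "\<dots> * ennreal L = (\<integral>\<^sup>+\<gamma>. ennreal L * (\<integral>\<^sup>+x. f (insert x \<gamma>) x \<partial>D) \<partial>iid_points D n)"
        by (subst nn_integral_cmult) (simp_all add: mult.commute)
      also have "\<dots> = J n"
        unfolding J_def
      proof (rule nn_integral_cong)
        fix \<gamma> assume "\<gamma> \<in> space (iid_points D n)"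
        then have \<gamma>: "\<gamma> \<in> space Gamma_M" by simp
        have [measurable]: "(\<lambda>x. f (insert x \<gamma>) x) \<in> borel_measurable borel" using f \<gamma> by measurable
        have "ennreal L * (\<integral>\<^sup>+x. f (insert x \<gamma>) x \<partial>D) = ennreal L * (\<integral>\<^sup>+x. (\<rho> x / ennreal L) * f (insert x \<gamma>) x \<partial>lborel)"
          unfolding D_def by (subst nn_integral_density) auto
        also have "\<dots> = (\<integral>\<^sup>+x. ennreal L * ((\<rho> x / ennreal L) * f (insert x \<gamma>) x) \<partial>lborel)"
          by (rule nn_integral_cmult[symmetric]) measurable
        also have "\<dots> = (\<integral>\<^sup>+x. \<rho> x * f (insert x \<gamma>) x \<partial>lborel)"
          by (simp add: mult.assoc[symmetric] LL)
        finally show "ennreal L * (\<integral>\<^sup>+x. f (insert x \<gamma>) x \<partial>D) = (\<integral>\<^sup>+x. \<rho> x * f (insert x \<gamma>) x \<partial>lborel)" .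
      qed
      finally show ?thesis .
    qed
    let ?p = "\<lambda>n. ennreal (L ^ n / fact n * exp (- L))"
    let ?a = "\<lambda>n. ?p n * (\<integral>\<^sup>+\<gamma>. \<integral>\<^sup>+x. f \<gamma> x \<partial>count_space \<gamma> \<partial>iid_points D n)"
    have aS: "?a (Suc n) = ?p n * J n" for n
    proof -
      have e1: "?p (Suc n) * of_nat (Suc n) = ?p n * ennreal L"
      proof -
        have "?p (Suc n) * of_nat (Suc n) = ennreal (L ^ Suc n / fact (Suc n) * exp (- L) * real (Suc n))"
          using L(2) by (subst ennreal_mult) (auto simp: ennreal_of_nat_eq_real_of_nat)
        also have "L ^ Suc n / fact (Suc n) * exp (- L) * real (Suc n) = L ^ n / fact n * exp (- L) * L"
          by (simp add: field_simps del: of_nat_Suc)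
        also have "ennreal \<dots> = ?p n * ennreal L" using L(2) by (subst ennreal_mult) auto
        finally show ?thesis .
      qed
      have e2: "(\<integral>\<^sup>+\<gamma>. \<integral>\<^sup>+x. f \<gamma> x \<partial>count_space \<gamma> \<partial>iid_points D (Suc n)) =
          of_nat (Suc n) * (\<integral>\<^sup>+x. \<integral>\<^sup>+\<gamma>. f (insert x \<gamma>) x \<partial>iid_points D n \<partial>D)"
        by (rule iid_points_mecke[OF D sD nul f])
      show ?thesis unfolding J[symmetric] e2 mult.assoc[symmetric] e1 by (simp only: mult_ac)
    qed
    \<comment> \<open>The empty sample has no points to sum over, so the series can be shifted by
      one.\<close>
    have a0: "?a 0 = 0"
      by (simp, subst nn_integral_return) auto
    have "(\<lambda>n. ?a (Suc n)) sums (\<Sum>n. ?a (Suc n))" by (intro summable_sums) auto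
    from sums_Suc[OF this] have "(\<Sum>n. ?a n) = (\<Sum>n. ?a (Suc n))"
      unfolding a0 by (simp add: sums_iff del: iid_points.simps)
    also have "\<dots> = (\<integral>\<^sup>+\<gamma>. \<integral>\<^sup>+x. \<rho> x * f (insert x \<gamma>) x \<partial>lborel \<partial>M)"
      unfolding aS J_def by (subst int) auto
    finally show "(\<integral>\<^sup>+\<gamma>. \<integral>\<^sup>+x. f \<gamma> x \<partial>count_space \<gamma> \<partial>M) = (\<integral>\<^sup>+\<gamma>. \<integral>\<^sup>+x. \<rho> x * f (insert x \<gamma>) x \<partial>lborel \<partial>M)"
      by (subst int) auto
  qed
  then show ?thesis ..
qed

section \<open>Locally finite intensities by superposition\<close>

definition loc_fin :: "('a::euclidean_space \<Rightarrow> ennreal) \<Rightarrow> bool" where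
  "loc_fin \<rho> \<longleftrightarrow> \<rho> \<in> borel_measurable borel \<and> (\<forall>n::nat. (\<integral>\<^sup>+x\<in>ball 0 (real n). \<rho> x \<partial>lborel) < \<infinity>)"

lemma bounded_subset_nat_ball:
  fixes B :: "'a::euclidean_space set"
  assumes "bounded B"
  shows "\<exists>n::nat. B \<subseteq> ball 0 (real n)"
  using bounded_subset_ballD[OF assms, of 0]
  by (metis ball_subset_ball_iff dist_self less_imp_le add_0 order_trans real_arch_simple)

lemma loc_fin_bounded:
  assumes "loc_fin \<rho>" "bounded B"
  shows "(\<integral>\<^sup>+x\<in>B. \<rho> x \<partial>lborel) < \<infinity>"
proof -
  obtain n :: nat where n: "B \<subseteq> ball 0 (real n)"
    using bounded_subset_nat_ball[OF assms(2)] by blast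
  have "(\<integral>\<^sup>+x\<in>B. \<rho> x \<partial>lborel) \<le> (\<integral>\<^sup>+x\<in>ball 0 (real n). \<rho> x \<partial>lborel)"
    using n by (intro nn_integral_mono) (auto simp: indicator_def)
  also have "\<dots> < \<infinity>" using assms by (simp add: loc_fin_def)
  finally show ?thesis .
qed

text \<open>Each spherical shell has finite mass and receives its own process; the processes are
  taken independent and glued. The formula for the union is checked shell by shell: with all other
  coordinates frozen, it is the formula for \<open>M k\<close>.\<close>

lemma mecke_exists:
  fixes \<rho> :: "'a::euclidean_space \<Rightarrow> ennreal"
  assumes \<rho>: "loc_fin \<rho>"
  shows "\<exists>M. mecke \<rho> M"
proof -
  define \<Lambda> where "\<Lambda> k = {x::'a. real k \<le> norm x \<and> norm x < real (Suc k)}" for k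
  have [measurable]: "\<rho> \<in> borel_measurable borel" using \<rho> by (simp add: loc_fin_def)
  have [measurable]: "\<Lambda> k \<in> sets borel" for k unfolding \<Lambda>_def by measurable
  have b\<Lambda>: "bounded (\<Lambda> k)" for k
    unfolding \<Lambda>_def bounded_iff by (auto intro!: exI[of _ "real (Suc k)"])
  have disj: "disjoint_family \<Lambda>"
    unfolding disjoint_family_on_def
  proof (intro ballI impI)
    fix i j :: nat assume "i \<noteq> j"
    then consider "Suc i \<le> j" | "Suc j \<le> i" by linarith
    then show "\<Lambda> i \<inter> \<Lambda> j = {}" unfolding \<Lambda>_def by cases auto
  qed
  have un: "(\<Union>k. \<Lambda> k) = UNIV"
  proof -
    have "x \<in> \<Lambda> (nat \<lfloor>norm x\<rfloor>)" for x unfolding \<Lambda>_def by (auto; linarith)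
    then show ?thesis by blast
  qed
  have "\<exists>M. mecke (\<lambda>x. \<rho> x * indicator (\<Lambda> k) x) M" for k
    by (rule mecke_exists_finite) (use loc_fin_bounded[OF \<rho> b\<Lambda>] in measurable)
  then obtain M where M: "\<And>k. mecke (\<lambda>x. \<rho> x * indicator (\<Lambda> k) x) (M k)" by metis
  have sM[measurable_cong, simp]: "sets (M k) = sets Gamma_M" for k using meckeD(1)[OF M] .
  have spM: "space (M k) = Gamma" for k using sets_eq_imp_space_eq[OF sM] by simp
  define PP where "PP = PiM (UNIV::nat set) M"
  interpret M: product_prob_space M UNIV
    by (intro product_prob_spaceI) (rule meckeD(2)[OF M])
  interpret PP: prob_space PP unfolding PP_def by (rule M.P.prob_space_axioms)
  have comp[measurable]: "(\<lambda>X. X k) \<in> PP \<rightarrow>\<^sub>M Gamma_M" for k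
    using measurable_component_singleton[of k UNIV M] unfolding PP_def
    by (simp cong: measurable_cong_sets)
  \<comment> \<open>Cutting \<open>X k\<close> down to its shell makes the pieces disjoint for every
    \<open>X\<close>, not just almost surely.\<close>
  define U where "U X = (\<Union>k. X k \<inter> \<Lambda> k)" for X :: "nat \<Rightarrow> 'a set"
  have U_Int: "U X \<inter> B = (\<Union>k<N. X k \<inter> (\<Lambda> k \<inter> B))" if "B \<subseteq> ball 0 (real N)" for X B N
  proof -
    have "k < N" if "x \<in> \<Lambda> k" "x \<in> B" for x k
    proof -
      have "norm x < real N" using that \<open>B \<subseteq> _\<close> by auto
      then show ?thesis using that(1) unfolding \<Lambda>_def by auto
    qed
    then show ?thesis unfolding U_def by blast
  qed
  have spPP: "X \<in> space PP \<Longrightarrow> X k \<in> Gamma" for X k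
    using measurable_space[OF comp] by simp
  have U[measurable]: "U \<in> PP \<rightarrow>\<^sub>M Gamma_M"
  proof (rule measurable_GammaI)
    fix X assume X: "X \<in> space PP"
    show "U X \<in> Gamma"
      unfolding Gamma_def
    proof (intro CollectI allI impI)
      fix B :: "'a set" assume B: "bounded B"
      obtain N :: nat where N: "B \<subseteq> ball 0 (real N)" using bounded_subset_nat_ball[OF B] ..
      show "finite (U X \<inter> B)" unfolding U_Int[OF N]
        using finite_Gamma[OF spPP[OF X] bounded_subset[OF B]] by (auto intro: finite_UN_I)
    qed
  next
    fix B :: "'a set" assume B[measurable]: "B \<in> sets borel" and bB: "bounded B"
    obtain N :: nat where N: "B \<subseteq> ball 0 (real N)" using bounded_subset_nat_ball[OF bB] ..
    have [measurable]: "(\<lambda>X. card (X k \<inter> (\<Lambda> k \<inter> B))) \<in> PP \<rightarrow>\<^sub>M count_space UNIV" for k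
      by (rule measurable_compose[OF comp card_Gamma_measurable]) (auto intro: bounded_subset[OF bB])
    have "(\<lambda>X. \<Sum>k<N. card (X k \<inter> (\<Lambda> k \<inter> B))) \<in> PP \<rightarrow>\<^sub>M count_space UNIV" by measurable
    also have "?this \<longleftrightarrow> (\<lambda>X. card (U X \<inter> B)) \<in> PP \<rightarrow>\<^sub>M count_space UNIV"
    proof (rule measurable_cong)
      fix X assume X: "X \<in> space PP"
      have "finite (X k \<inter> (\<Lambda> k \<inter> B))" for k
        by (rule finite_Gamma[OF spPP[OF X]]) (auto intro: bounded_subset[OF bB])
      then show "(\<Sum>k<N. card (X k \<inter> (\<Lambda> k \<inter> B))) = card (U X \<inter> B)"
        unfolding U_Int[OF N] using disj
        by (subst card_UN_disjoint) (auto simp: disjoint_family_on_def)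
    qed
    finally show "(\<lambda>X. card (U X \<inter> B)) \<in> PP \<rightarrow>\<^sub>M count_space UNIV" .
  qed
  have upd[measurable]: "(\<lambda>\<omega>. (h \<omega>)(k := q \<omega>)) \<in> N \<rightarrow>\<^sub>M PP"
    if "h \<in> N \<rightarrow>\<^sub>M PP" "q \<in> N \<rightarrow>\<^sub>M Gamma_M" for h q k and N :: "'z measure"
    using that unfolding PP_def by (intro measurable_fun_upd[of UNIV UNIV]) (auto cong: measurable_cong_sets)
  \<comment> \<open>Replacing one coordinate by an independent copy preserves the product law. This
    isolates coordinate \<open>k\<close> as an inner integral, to which the formula for
    \<open>M k\<close> applies.\<close>
  have resample: "(\<integral>\<^sup>+X. h X \<partial>PP) = (\<integral>\<^sup>+X. \<integral>\<^sup>+\<gamma>. h (X(k := \<gamma>)) \<partial>M k \<partial>PP)"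
    if h[measurable]: "h \<in> borel_measurable PP" for h k
  proof -
    interpret pair_prob_space "M k" PP ..
    have "PP = distr (M k \<Otimes>\<^sub>M PP) PP (\<lambda>(\<gamma>, X). X(k := \<gamma>))"
      using distr_pair_PiM_eq_PiM[of UNIV M k] M.prob_space_axioms
      unfolding PP_def by (simp add: meckeD(2)[OF M] insert_absorb)
    then have "(\<integral>\<^sup>+X. h X \<partial>PP) = (\<integral>\<^sup>+X. h X \<partial>distr (M k \<Otimes>\<^sub>M PP) PP (\<lambda>(\<gamma>, X). X(k := \<gamma>)))" by simp
    also have "\<dots> = (\<integral>\<^sup>+p. h ((snd p)(k := fst p)) \<partial>(M k \<Otimes>\<^sub>M PP))"
      by (subst nn_integral_distr) (auto simp: split_beta')
    also have "\<dots> = (\<integral>\<^sup>+X. \<integral>\<^sup>+\<gamma>. h (X(k := \<gamma>)) \<partial>M k \<partial>PP)"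
      by (subst nn_integral_snd[symmetric]) simp_all
    finally show ?thesis .
  qed
  have "mecke \<rho> (distr PP Gamma_M U)"
    unfolding mecke_def
  proof (intro conjI allI impI)
    show "prob_space (distr PP Gamma_M U)" by (rule PP.prob_space_distr) fact
    fix f :: "'a set \<Rightarrow> 'a \<Rightarrow> ennreal" assume f[measurable]: "(\<lambda>(\<gamma>, x). f \<gamma> x) \<in> borel_measurable (Gamma_M \<Otimes>\<^sub>M borel)"
    define H where "H k X = (\<integral>\<^sup>+x. f (U X) x * indicator (\<Lambda> k) x \<partial>count_space (X k))" for k X
    define G where "G k X = (\<integral>\<^sup>+x. (\<rho> x * indicator (\<Lambda> k) x) * f (insert x (U X)) x \<partial>lborel)" for k X
    have H[measurable]: "H k \<in> borel_measurable PP" for k unfolding H_def by measurable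
    have G[measurable]: "G k \<in> borel_measurable PP" for k unfolding G_def by measurable
    have sumH: "(\<integral>\<^sup>+x. f (U X) x \<partial>count_space (U X)) = (\<Sum>k. H k X)" for X
    proof -
      have "disjoint_family (\<lambda>k. X k \<inter> \<Lambda> k)" using disj unfolding disjoint_family_on_def by blast
      then have "f (U X) x * indicator (U X) x = (\<Sum>k. f (U X) x * indicator (X k \<inter> \<Lambda> k) x)" for x
        unfolding U_def by (simp add: suminf_indicator)
      then have "(\<integral>\<^sup>+x. f (U X) x \<partial>count_space (U X)) = (\<integral>\<^sup>+x. (\<Sum>k. f (U X) x * indicator (X k \<inter> \<Lambda> k) x) \<partial>count_space UNIV)"
        by (subst nn_integral_count_space_indicator) auto
      also have "\<dots> = (\<Sum>k. \<integral>\<^sup>+x. f (U X) x * indicator (X k \<inter> \<Lambda> k) x \<partial>count_space UNIV)"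
        by (rule nn_integral_suminf) auto
      also have "(\<lambda>k. \<integral>\<^sup>+x. f (U X) x * indicator (X k \<inter> \<Lambda> k) x \<partial>count_space UNIV) = (\<lambda>k. H k X)"
        unfolding H_def by (rule ext, subst (2) nn_integral_count_space_indicator)
          (auto intro!: nn_integral_cong simp: indicator_def)
      finally show ?thesis .
    qed
    have HG: "(\<integral>\<^sup>+X. H k X \<partial>PP) = (\<integral>\<^sup>+X. G k X \<partial>PP)" for k
    proof -
      have "(\<integral>\<^sup>+X. H k X \<partial>PP) = (\<integral>\<^sup>+X. \<integral>\<^sup>+\<gamma>. H k (X(k := \<gamma>)) \<partial>M k \<partial>PP)"
        by (rule resample) measurable
      also have "\<dots> = (\<integral>\<^sup>+X. \<integral>\<^sup>+\<gamma>. G k (X(k := \<gamma>)) \<partial>M k \<partial>PP)"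
      proof (rule nn_integral_cong)
        fix X assume X[simp]: "X \<in> space PP"
        have [measurable]: "(\<lambda>\<gamma>. X(k := \<gamma>)) \<in> Gamma_M \<rightarrow>\<^sub>M PP" by (rule upd) auto
        have "(\<integral>\<^sup>+\<gamma>. H k (X(k := \<gamma>)) \<partial>M k) = (\<integral>\<^sup>+\<gamma>. \<integral>\<^sup>+x. f (U (X(k := \<gamma>))) x * indicator (\<Lambda> k) x \<partial>count_space \<gamma> \<partial>M k)"
          by (simp add: H_def)
        also have "\<dots> = (\<integral>\<^sup>+\<gamma>. \<integral>\<^sup>+x. (\<rho> x * indicator (\<Lambda> k) x) * (f (U (X(k := insert x \<gamma>))) x * indicator (\<Lambda> k) x) \<partial>lborel \<partial>M k)"
          by (rule meckeD(3)[OF M]) measurable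
        also have "\<dots> = (\<integral>\<^sup>+\<gamma>. G k (X(k := \<gamma>)) \<partial>M k)"
        proof -
          \<comment> \<open>A point put into coordinate \<open>k\<close> reaches the union only if
            it lies in shell \<open>k\<close>; the indicator in the intensity ensures this.\<close>
          have "U (X(k := insert x \<gamma>)) = insert x (U (X(k := \<gamma>)))" if "x \<in> \<Lambda> k" for x \<gamma>
            using that unfolding U_def by (auto split: if_splits)
          then show ?thesis unfolding G_def by (intro nn_integral_cong) (auto simp: indicator_def)
        qed
        finally show "(\<integral>\<^sup>+\<gamma>. H k (X(k := \<gamma>)) \<partial>M k) = (\<integral>\<^sup>+\<gamma>. G k (X(k := \<gamma>)) \<partial>M k)" .
      qed
      also have "\<dots> = (\<integral>\<^sup>+X. G k X \<partial>PP)" by (rule resample[symmetric]) measurable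
      finally show ?thesis .
    qed
    have sumG: "(\<Sum>k. G k X) = (\<integral>\<^sup>+x. \<rho> x * f (insert x (U X)) x \<partial>lborel)" if "X \<in> space PP" for X
    proof -
      have [measurable]: "U X \<in> space Gamma_M" using measurable_space[OF U that] .
      have eq: "(\<Sum>k. (\<rho> x * indicator (\<Lambda> k) x) * f (insert x (U X)) x) = \<rho> x * f (insert x (U X)) x" for x
        using suminf_indicator[OF disj, of x] by (simp add: un mult.assoc mult.commute[of "indicator _ _"])
      have "(\<Sum>k. G k X) = (\<integral>\<^sup>+x. (\<Sum>k. (\<rho> x * indicator (\<Lambda> k) x) * f (insert x (U X)) x) \<partial>lborel)"
        unfolding G_def by (rule nn_integral_suminf[symmetric]) measurable
      also have "\<dots> = (\<integral>\<^sup>+x. \<rho> x * f (insert x (U X)) x \<partial>lborel)" by (simp only: eq)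
      finally show ?thesis .
    qed
    have "(\<integral>\<^sup>+\<gamma>. \<integral>\<^sup>+x. f \<gamma> x \<partial>count_space \<gamma> \<partial>distr PP Gamma_M U) = (\<integral>\<^sup>+X. (\<Sum>k. H k X) \<partial>PP)"
      by (subst nn_integral_distr) (auto simp: sumH)
    also have "\<dots> = (\<Sum>k. \<integral>\<^sup>+X. H k X \<partial>PP)" by (rule nn_integral_suminf) measurable
    also have "\<dots> = (\<Sum>k. \<integral>\<^sup>+X. G k X \<partial>PP)" by (simp only: HG)
    also have "\<dots> = (\<integral>\<^sup>+X. (\<Sum>k. G k X) \<partial>PP)" by (rule nn_integral_suminf[symmetric]) measurable
    also have "\<dots> = (\<integral>\<^sup>+X. \<integral>\<^sup>+x. \<rho> x * f (insert x (U X)) x \<partial>lborel \<partial>PP)"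
      by (intro nn_integral_cong sumG)
    also have "\<dots> = (\<integral>\<^sup>+\<gamma>. \<integral>\<^sup>+x. \<rho> x * f (insert x \<gamma>) x \<partial>lborel \<partial>distr PP Gamma_M U)"
      by (subst nn_integral_distr) auto
    finally show "(\<integral>\<^sup>+\<gamma>. \<integral>\<^sup>+x. f \<gamma> x \<partial>count_space \<gamma> \<partial>distr PP Gamma_M U) =
        (\<integral>\<^sup>+\<gamma>. \<integral>\<^sup>+x. \<rho> x * f (insert x \<gamma>) x \<partial>lborel \<partial>distr PP Gamma_M U)" .
  qed simp
  then show ?thesis ..
qed

section \<open>Count distributions forced by the Mecke formula\<close>

text \<open>This recursion determines the law of \<open>card (\<gamma> \<inter> B)\<close> and its independence of \<open>E\<close> at the same time.\<close>

lemma mecke_count_step: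
  fixes \<rho> :: "'a::euclidean_space \<Rightarrow> ennreal"
  assumes M: "mecke \<rho> M" and [measurable]: "\<rho> \<in> borel_measurable borel"
    and B[measurable]: "B \<in> sets borel" and bB: "bounded B"
    and E[measurable]: "E \<in> sets Gamma_M"
    and inv: "\<And>x \<gamma>. x \<in> B \<Longrightarrow> \<gamma> \<in> Gamma \<Longrightarrow> insert x \<gamma> \<in> E \<longleftrightarrow> \<gamma> \<in> E"
  shows "of_nat (Suc n) * emeasure M {\<gamma>\<in>E. card (\<gamma> \<inter> B) = Suc n} =
    (\<integral>\<^sup>+x\<in>B. \<rho> x \<partial>lborel) * emeasure M {\<gamma>\<in>E. card (\<gamma> \<inter> B) = n}"
proof -
  note sM[measurable_cong] = meckeD(1)[OF M]
  have spM: "space M = Gamma" using sets_eq_imp_space_eq[OF sM] by simp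
  define A where "A n = {\<gamma>\<in>E. card (\<gamma> \<inter> B) = n}" for n
  have Am[measurable]: "A n \<in> sets Gamma_M" for n
    unfolding A_def by (rule sets_card_slice[OF E B bB])
  have "of_nat (Suc n) * emeasure M (A (Suc n)) = (\<integral>\<^sup>+\<gamma>. of_nat (Suc n) * indicator (A (Suc n)) \<gamma> \<partial>M)"
    by (rule nn_integral_cmult_indicator[symmetric]) simp
  \<comment> \<open>On \<open>A (Suc n)\<close> the factor n+1 is the number of points of \<gamma>
    in \<open>B\<close>, so the left side is a sum over the points of \<gamma>.\<close>
  also have "\<dots> = (\<integral>\<^sup>+\<gamma>. \<integral>\<^sup>+x. indicator B x * indicator (A (Suc n)) \<gamma> \<partial>count_space \<gamma> \<partial>M)"
  proof (rule nn_integral_cong)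
    fix \<gamma> assume "\<gamma> \<in> space M"
    then have fin: "finite (\<gamma> \<inter> B)" using bB by (auto simp: spM intro: finite_Gamma)
    have "(\<integral>\<^sup>+x. indicator B x * indicator (A (Suc n)) \<gamma> \<partial>count_space \<gamma>)
       = (\<integral>\<^sup>+x. indicator (A (Suc n)) \<gamma> * indicator (\<gamma> \<inter> B) x \<partial>count_space \<gamma>)"
      by (intro nn_integral_cong) (auto simp: indicator_def)
    also have "\<dots> = indicator (A (Suc n)) \<gamma> * emeasure (count_space \<gamma>) (\<gamma> \<inter> B)"
      by (rule nn_integral_cmult_indicator) simp
    also have "\<dots> = of_nat (Suc n) * indicator (A (Suc n)) \<gamma>"
      using fin by (subst emeasure_count_space_finite) (auto simp: A_def indicator_def)
    finally show "of_nat (Suc n) * indicator (A (Suc n)) \<gamma> = (\<integral>\<^sup>+x. indicator B x * indicator (A (Suc n)) \<gamma> \<partial>count_space \<gamma>)"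
      by simp
  qed
  also have "\<dots> = (\<integral>\<^sup>+\<gamma>. \<integral>\<^sup>+x. \<rho> x * (indicator B x * indicator (A (Suc n)) (insert x \<gamma>)) \<partial>lborel \<partial>M)"
    by (rule meckeD(3)[OF M]) measurable
  also have "\<dots> = (\<integral>\<^sup>+\<gamma>. (\<integral>\<^sup>+x\<in>B. \<rho> x \<partial>lborel) * indicator (A n) \<gamma> \<partial>M)"
  proof (rule nn_integral_cong)
    fix \<gamma> assume "\<gamma> \<in> space M"
    then have \<gamma>: "\<gamma> \<in> Gamma" by (simp add: spM)
    have fin: "finite (\<gamma> \<inter> B)" using \<gamma> bB by (rule finite_Gamma)
    have "(\<integral>\<^sup>+x. \<rho> x * (indicator B x * indicator (A (Suc n)) (insert x \<gamma>)) \<partial>lborel) =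
       (\<integral>\<^sup>+x. \<rho> x * indicator B x * indicator (A n) \<gamma> \<partial>lborel)"
    proof (rule nn_integral_cong_AE)
      show "AE x in lborel. \<rho> x * (indicator B x * indicator (A (Suc n)) (insert x \<gamma>)) = \<rho> x * indicator B x * indicator (A n) \<gamma>"
        using AE_notin_Gamma[OF \<gamma>]
      proof eventually_elim
        fix x assume x: "x \<notin> \<gamma>"
        show "\<rho> x * (indicator B x * indicator (A (Suc n)) (insert x \<gamma>)) = \<rho> x * indicator B x * indicator (A n) \<gamma>"
        proof (cases "x \<in> B")
          case True
          have "card (insert x \<gamma> \<inter> B) = Suc (card (\<gamma> \<inter> B))" using True x fin by simp
          then have "insert x \<gamma> \<in> A (Suc n) \<longleftrightarrow> \<gamma> \<in> A n" using inv[OF True \<gamma>] by (simp add: A_def)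
          then show ?thesis using True by (simp add: indicator_def)
        qed simp
      qed
    qed
    also have "\<dots> = (\<integral>\<^sup>+x\<in>B. \<rho> x \<partial>lborel) * indicator (A n) \<gamma>"
      by (rule nn_integral_multc) simp
    finally show "(\<integral>\<^sup>+x. \<rho> x * (indicator B x * indicator (A (Suc n)) (insert x \<gamma>)) \<partial>lborel) = (\<integral>\<^sup>+x\<in>B. \<rho> x \<partial>lborel) * indicator (A n) \<gamma>" .
  qed
  also have "\<dots> = (\<integral>\<^sup>+x\<in>B. \<rho> x \<partial>lborel) * emeasure M (A n)"
    by (rule nn_integral_cmult_indicator) simp
  finally show ?thesis unfolding A_def .
qed

text \<open>The recursion determines the probabilities up to the value at n = 0, and this value is
  fixed by their sum, the probability of \<open>E\<close>.\<close>

lemma mecke_count: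
  fixes \<rho> :: "'a::euclidean_space \<Rightarrow> ennreal"
  assumes M: "mecke \<rho> M" and [measurable]: "\<rho> \<in> borel_measurable borel"
    and B[measurable]: "B \<in> sets borel" and bB: "bounded B"
    and L: "(\<integral>\<^sup>+x\<in>B. \<rho> x \<partial>lborel) = ennreal L" "0 \<le> L"
    and E[measurable]: "E \<in> sets Gamma_M"
    and inv: "\<And>x \<gamma>. x \<in> B \<Longrightarrow> \<gamma> \<in> Gamma \<Longrightarrow> insert x \<gamma> \<in> E \<longleftrightarrow> \<gamma> \<in> E"
  shows "measure M {\<gamma>\<in>E. card (\<gamma> \<inter> B) = n} = exp (- L) * L ^ n / fact n * measure M E"
proof -
  note sM[measurable_cong] = meckeD(1)[OF M]
  interpret prob_space M using meckeD(2)[OF M] .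
  define p where "p n = measure M {\<gamma>\<in>E. card (\<gamma> \<inter> B) = n}" for n
  have Am: "{\<gamma>\<in>E. card (\<gamma> \<inter> B) = n} \<in> sets M" for n
    unfolding sM by (rule sets_card_slice[OF E B bB])
  have step: "real (Suc n) * p (Suc n) = L * p n" for n
  proof -
    have "ennreal (real (Suc n)) * ennreal (p (Suc n)) = ennreal L * ennreal (p n)"
      using mecke_count_step[OF M _ B bB E inv, of n]
      unfolding emeasure_eq_measure L(1) p_def by (simp add: ennreal_of_nat_eq_real_of_nat del: of_nat_Suc)
    then show ?thesis using L(2)
      by (subst (asm) (1 2) ennreal_mult[symmetric]) (auto simp: p_def measure_nonneg simp del: of_nat_Suc)
  qed
  have p: "p n = L ^ n / fact n * p 0" for n
  proof (induction n)
    case (Suc n)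
    have "p (Suc n) = L * p n / real (Suc n)" using step[of n] by (simp add: field_simps del: of_nat_Suc)
    also have "\<dots> = L ^ Suc n / fact (Suc n) * p 0" by (simp add: Suc field_simps del: of_nat_Suc)
    finally show ?case .
  qed simp
  have "(\<lambda>n. measure M {\<gamma>\<in>E. card (\<gamma> \<inter> B) = n}) sums measure M (\<Union>n. {\<gamma>\<in>E. card (\<gamma> \<inter> B) = n})"
    by (rule finite_measure_UNION) (use Am in \<open>auto simp: disjoint_family_on_def\<close>)
  also have "(\<Union>n. {\<gamma>\<in>E. card (\<gamma> \<inter> B) = n}) = E" by auto
  finally have "p sums measure M E" unfolding p_def .
  moreover have "p sums (exp L * p 0)"
  proof -
    have "L ^ n /\<^sub>R fact n * p 0 = p n" for n by (subst p[of n]) (simp add: divide_inverse)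
    then show ?thesis using sums_mult2[OF exp_converges[of L], of "p 0"] by simp
  qed
  ultimately have "measure M E = exp L * p 0" by (rule sums_unique2)
  then have "p 0 = exp (- L) * measure M E" by (simp add: exp_minus field_simps)
  then show ?thesis using p[of n] by (simp add: p_def)
qed

text \<open>\<open>mecke_count\<close> yields the same Poisson weights for \<open>E\<close> as for
  all of \<open>Gamma\<close>: conditioning on an event that ignores points of \<open>B\<close> does
  not change the law of the count in \<open>B\<close>.\<close>

lemma mecke_count_indep:
  fixes \<rho> :: "'a::euclidean_space \<Rightarrow> ennreal"
  assumes M: "mecke \<rho> M" and \<rho>: "loc_fin \<rho>"
    and B[measurable]: "B \<in> sets borel" and bB: "bounded B"
    and E[measurable]: "E \<in> sets Gamma_M"
    and inv: "\<And>x \<gamma>. x \<in> B \<Longrightarrow> \<gamma> \<in> Gamma \<Longrightarrow> insert x \<gamma> \<in> E \<longleftrightarrow> \<gamma> \<in> E"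
  shows "measure M {\<gamma>\<in>E. card (\<gamma> \<inter> B) \<in> S} = measure M {\<gamma>\<in>Gamma. card (\<gamma> \<inter> B) \<in> S} * measure M E"
proof -
  note sM[measurable_cong] = meckeD(1)[OF M]
  have spM: "space M = Gamma" using sets_eq_imp_space_eq[OF sM] by simp
  interpret prob_space M using meckeD(2)[OF M] .
  have \<rho>m: "\<rho> \<in> borel_measurable borel" using \<rho> by (simp add: loc_fin_def)
  obtain L where L: "(\<integral>\<^sup>+x\<in>B. \<rho> x \<partial>lborel) = ennreal L" "0 \<le> L"
    using loc_fin_bounded[OF \<rho> bB] by (cases "\<integral>\<^sup>+x\<in>B. \<rho> x \<partial>lborel") auto
  define q where "q n = (if n \<in> S then exp (- L) * L ^ n / fact n else 0)" for n
  have *: "(\<lambda>n. q n * measure M E) sums measure M {\<gamma>\<in>E. card (\<gamma> \<inter> B) \<in> S}"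
    if E: "E \<in> sets Gamma_M" and inv: "\<And>x \<gamma>. x \<in> B \<Longrightarrow> \<gamma> \<in> Gamma \<Longrightarrow> insert x \<gamma> \<in> E \<longleftrightarrow> \<gamma> \<in> E" for E
  proof -
    define A where "A n = (if n \<in> S then {\<gamma>\<in>E. card (\<gamma> \<inter> B) = n} else {})" for n
    have "{\<gamma>\<in>E. card (\<gamma> \<inter> B) = n} \<in> sets M" for n
      unfolding sM by (rule sets_card_slice[OF E B bB])
    then have "(\<lambda>n. measure M (A n)) sums measure M (\<Union>n. A n)"
      by (intro finite_measure_UNION) (auto simp: disjoint_family_on_def A_def)
    also have "(\<Union>n. A n) = {\<gamma>\<in>E. card (\<gamma> \<inter> B) \<in> S}" by (auto simp: A_def)
    also have "(\<lambda>n. measure M (A n)) = (\<lambda>n. q n * measure M E)"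
      using mecke_count[OF M \<rho>m B bB L E inv] by (auto simp: A_def q_def)
    finally show ?thesis .
  qed
  have 1: "(\<lambda>n. q n * measure M Gamma) sums measure M {\<gamma>\<in>Gamma. card (\<gamma> \<inter> B) \<in> S}"
    by (rule *) (use sets.top[of "Gamma_M :: 'a set measure"] in auto)
  have "measure M Gamma = 1" using prob_space spM by simp
  with 1 have "q sums measure M {\<gamma>\<in>Gamma. card (\<gamma> \<inter> B) \<in> S}" by simp
  from sums_mult2[OF this] *[OF E inv] show ?thesis by (rule sums_unique2[symmetric])
qed

lemma sets_Gamma_card [measurable]:
  fixes B :: "nat \<Rightarrow> 'a::euclidean_space set"
  assumes "finite J" "\<And>j. j \<in> J \<Longrightarrow> B j \<in> sets borel" "\<And>j. j \<in> J \<Longrightarrow> bounded (B j)"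
  shows "{\<gamma>\<in>Gamma. \<forall>j\<in>J. card (\<gamma> \<inter> B j) \<in> S j} \<in> sets Gamma_M"
proof -
  have "{\<gamma>\<in>space Gamma_M. \<forall>j\<in>J. card (\<gamma> \<inter> B j) \<in> S j} \<in> sets Gamma_M"
  proof (rule sets.sets_Collect_finite_All[OF _ assms(1)])
    fix j assume j: "j \<in> J"
    have "(\<lambda>\<gamma>. card (\<gamma> \<inter> B j)) -` S j \<inter> space Gamma_M \<in> sets Gamma_M"
      by (rule measurable_sets[OF card_Gamma_measurable]) (use assms j in auto)
    also have "(\<lambda>\<gamma>. card (\<gamma> \<inter> B j)) -` S j \<inter> space Gamma_M = {\<gamma>\<in>space Gamma_M. card (\<gamma> \<inter> B j) \<in> S j}" by auto
    finally show "{\<gamma>\<in>space Gamma_M. card (\<gamma> \<inter> B j) \<in> S j} \<in> sets Gamma_M" .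
  qed
  then show ?thesis by simp
qed

text \<open>Counts in the other members of a disjoint family ignore points added in
  \<open>B i\<close>, which is the invariance that \<open>mecke_count_indep\<close> asks
  for.\<close>

lemma mecke_count_prod:
  fixes \<rho> :: "'a::euclidean_space \<Rightarrow> ennreal" and B :: "nat \<Rightarrow> 'a set"
  assumes M: "mecke \<rho> M" and \<rho>: "loc_fin \<rho>"
    and J: "finite J" "\<And>j. j \<in> J \<Longrightarrow> B j \<in> sets borel" "\<And>j. j \<in> J \<Longrightarrow> bounded (B j)"
    and disj: "disjoint_family_on B J"
  shows "measure M {\<gamma>\<in>Gamma. \<forall>j\<in>J. card (\<gamma> \<inter> B j) \<in> S j} = (\<Prod>j\<in>J. measure M {\<gamma>\<in>Gamma. card (\<gamma> \<inter> B j) \<in> S j})"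
  using J disj
proof (induction J)
  case empty
  interpret prob_space M using meckeD(2)[OF M] .
  show ?case using prob_space sets_eq_imp_space_eq[OF meckeD(1)[OF M]] by simp
next
  case (insert i J)
  define E where "E = {\<gamma>\<in>Gamma. \<forall>j\<in>J. card (\<gamma> \<inter> B j) \<in> S j}"
  have E: "E \<in> sets Gamma_M" unfolding E_def using insert.hyps insert.prems by (intro sets_Gamma_card) auto
  have inv: "insert x \<gamma> \<in> E \<longleftrightarrow> \<gamma> \<in> E" if x: "x \<in> B i" "\<gamma> \<in> Gamma" for x \<gamma>
  proof -
    have "insert x \<gamma> \<inter> B j = \<gamma> \<inter> B j" if "j \<in> J" for j
      using that x insert.prems(3) insert.hyps(2) unfolding disjoint_family_on_def
      by (metis Int_iff Int_insert_left empty_iff insertCI)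
    then show ?thesis using x by (simp add: E_def)
  qed
  have "{\<gamma>\<in>Gamma. \<forall>j\<in>insert i J. card (\<gamma> \<inter> B j) \<in> S j} = {\<gamma>\<in>E. card (\<gamma> \<inter> B i) \<in> S i}"
    by (auto simp: E_def)
  then have "measure M {\<gamma>\<in>Gamma. \<forall>j\<in>insert i J. card (\<gamma> \<inter> B j) \<in> S j} =
     measure M {\<gamma>\<in>Gamma. card (\<gamma> \<inter> B i) \<in> S i} * measure M E"
    using mecke_count_indep[OF M \<rho> _ _ E inv] insert.prems by simp
  also have "measure M E = (\<Prod>j\<in>J. measure M {\<gamma>\<in>Gamma. card (\<gamma> \<inter> B j) \<in> S j})"
    unfolding E_def using insert.prems by (intro insert.IH) (auto simp: disjoint_family_on_def)
  finally show ?case using insert.hyps by simp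
qed

lemma mecke_imp_poisson_pp:
  fixes \<rho> :: "'a::euclidean_space \<Rightarrow> real"
  assumes M: "mecke (\<lambda>x. ennreal (\<rho> x)) M" and \<rho>: "loc_fin (\<lambda>x. ennreal (\<rho> x))"
  shows "poisson_pp \<rho> M"
  unfolding poisson_pp_def
proof (intro conjI allI impI)
  interpret prob_space M using meckeD(2)[OF M] .
  show sM: "sets M = sets Gamma_M" "prob_space M" using meckeD(1,2)[OF M] .
  have spM: "space M = Gamma" using sets_eq_imp_space_eq[OF sM(1)] by simp
  have \<rho>m: "(\<lambda>x. ennreal (\<rho> x)) \<in> borel_measurable borel" using \<rho> by (simp add: loc_fin_def)
  {
    fix B :: "'a set" and n assume B: "B \<in> sets borel \<and> bounded B"
    show fin: "(\<integral>\<^sup>+x\<in>B. ennreal (\<rho> x) \<partial>lborel) < \<infinity>" using loc_fin_bounded[OF \<rho>] B by blast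
    define L where "L = enn2real (\<integral>\<^sup>+x\<in>B. ennreal (\<rho> x) \<partial>lborel)"
    have L: "(\<integral>\<^sup>+x\<in>B. ennreal (\<rho> x) \<partial>lborel) = ennreal L" "0 \<le> L"
      using fin unfolding L_def by auto
    have "measure M {\<gamma>\<in>Gamma. card (\<gamma> \<inter> B) = n} = exp (- L) * L ^ n / fact n * measure M Gamma"
      using B sets.top[of "Gamma_M :: 'a set measure"] by (intro mecke_count[OF M \<rho>m _ _ L]) auto
    also have "measure M Gamma = 1" using prob_space spM by simp
    finally have "emeasure M {\<gamma>\<in>space M. card (\<gamma> \<inter> B) = n} = ennreal (exp (- L) * L ^ n / fact n)"
      unfolding spM emeasure_eq_measure by simp
    then show "let L = enn2real (\<integral>\<^sup>+x\<in>B. ennreal (\<rho> x) \<partial>lborel) in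
       emeasure M {\<gamma>\<in>space M. card (\<gamma> \<inter> B) = n} = ennreal (exp (- L) * L ^ n / fact n)"
      by (simp add: L_def Let_def)
  }
  fix Bs :: "'a set list"
  assume Bs: "(\<forall>B\<in>set Bs. B \<in> sets borel \<and> bounded B) \<and>
        (\<forall>i<length Bs. \<forall>j<length Bs. i \<noteq> j \<longrightarrow> Bs ! i \<inter> Bs ! j = {})"
  have Bi: "Bs ! i \<in> sets borel" "bounded (Bs ! i)" if "i < length Bs" for i
    using Bs that by auto
  have cm: "(\<lambda>\<gamma>. card (\<gamma> \<inter> Bs ! i)) \<in> M \<rightarrow>\<^sub>M count_space UNIV" if "i < length Bs" for i
    using card_Gamma_measurable[OF Bi[OF that]] sM by (simp cong: measurable_cong_sets)
  show "indep_vars (\<lambda>_. count_space UNIV) (\<lambda>i \<gamma>. card (\<gamma> \<inter> Bs ! i)) {..<length Bs}"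
    unfolding indep_vars_def2
  proof (intro conjI ballI indep_setsI)
    fix i assume i: "i \<in> {..<length Bs}"
    then show "random_variable (count_space UNIV) (\<lambda>\<gamma>. card (\<gamma> \<inter> Bs ! i))" using cm by simp
    show "{(\<lambda>\<gamma>. card (\<gamma> \<inter> Bs ! i)) -` A \<inter> space M |A. A \<in> sets (count_space UNIV)} \<subseteq> events"
      using measurable_sets[OF cm[of i]] i by auto
  next
    fix A J assume J: "J \<noteq> {}" "J \<subseteq> {..<length Bs}" "finite J"
      and A: "\<forall>j\<in>J. A j \<in> {(\<lambda>\<gamma>. card (\<gamma> \<inter> Bs ! j)) -` A \<inter> space M |A. A \<in> sets (count_space UNIV)}"
    obtain S where S: "\<And>j. j \<in> J \<Longrightarrow> A j = {\<gamma>\<in>Gamma. card (\<gamma> \<inter> Bs ! j) \<in> S j}"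
    proof -
      have "\<forall>j\<in>J. \<exists>S. A j = {\<gamma>\<in>Gamma. card (\<gamma> \<inter> Bs ! j) \<in> S}"
      proof
        fix j assume "j \<in> J"
        then obtain S where "A j = (\<lambda>\<gamma>. card (\<gamma> \<inter> Bs ! j)) -` S \<inter> space M" using A by auto
        then show "\<exists>S. A j = {\<gamma>\<in>Gamma. card (\<gamma> \<inter> Bs ! j) \<in> S}"
          by (intro exI[of _ S]) (auto simp: spM)
      qed
      from bchoice[OF this] show ?thesis using that by blast
    qed
    have "(\<Inter>j\<in>J. A j) = {\<gamma>\<in>Gamma. \<forall>j\<in>J. card (\<gamma> \<inter> Bs ! j) \<in> S j}" using S J(1) by auto
    then have "prob (\<Inter>j\<in>J. A j) = (\<Prod>j\<in>J. prob {\<gamma>\<in>Gamma. card (\<gamma> \<inter> Bs ! j) \<in> S j})"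
      using mecke_count_prod[OF M \<rho> J(3), of "\<lambda>j. Bs ! j" S] Bi J(2) Bs
      by (auto simp: disjoint_family_on_def subset_iff)
    also have "\<dots> = (\<Prod>j\<in>J. prob (A j))" by (rule prod.cong) (simp_all add: S)
    finally show "prob (\<Inter>j\<in>J. A j) = (\<Prod>j\<in>J. prob (A j))" .
  qed
qed

section \<open>Uniqueness of the Poisson law and measurability in the intensity\<close>

text \<open>Independence of Poisson counts concerns disjoint sets only, so counts in overlapping
  sets must first be expressed through atoms. Adding a set \<open>B\<close> splits every old atom by
  \<open>B\<close> and turns the uncovered rest of \<open>B\<close> into a new atom.\<close>

lemma finite_family_atoms:
  fixes \<B> :: "'a::euclidean_space set set"
  assumes "finite \<B>" "\<And>B. B \<in> \<B> \<Longrightarrow> B \<in> sets borel \<and> bounded B"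
  shows "\<exists>\<A>. finite \<A> \<and> disjoint \<A> \<and> (\<forall>A\<in>\<A>. A \<in> sets borel \<and> bounded A) \<and> (\<forall>B\<in>\<B>. \<exists>\<C>\<subseteq>\<A>. B = \<Union>\<C>)"
  using assms
proof (induction \<B>)
  case empty
  show ?case by (intro exI[of _ "{}"]) auto
next
  case (insert B \<B>)
  obtain \<A> where A0: "finite \<A> \<and> disjoint \<A> \<and> (\<forall>A\<in>\<A>. A \<in> sets borel \<and> bounded A) \<and> (\<forall>B\<in>\<B>. \<exists>\<C>\<subseteq>\<A>. B = \<Union>\<C>)"
    using insert.IH[OF insert.prems[OF insertI2]] by (rule exE)
  have A: "finite \<A>" "disjoint \<A>" "\<And>A. A \<in> \<A> \<Longrightarrow> A \<in> sets borel \<and> bounded A"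
    "\<And>B. B \<in> \<B> \<Longrightarrow> \<exists>\<C>\<subseteq>\<A>. B = \<Union>\<C>"
    using A0 by (auto simp only:)
  have B: "B \<in> sets borel" "bounded B" using insert.prems by auto
  define \<A>' where "\<A>' = (\<lambda>A. A \<inter> B) ` \<A> \<union> (\<lambda>A. A - B) ` \<A> \<union> {B - \<Union>\<A>}"
  show ?case
  proof (rule exI[of _ \<A>'], intro conjI ballI)
    show "finite \<A>'" using A(1) by (simp add: \<A>'_def)
    show "disjoint \<A>'"
    proof (rule disjointI)
      fix a b assume ab: "a \<in> \<A>'" "b \<in> \<A>'" "a \<noteq> b"
      have d: "A1 \<inter> A2 = {}" if "A1 \<in> \<A>" "A2 \<in> \<A>" "A1 \<noteq> A2" for A1 A2
        using A(2) that by (rule disjointD)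
      show "a \<inter> b = {}"
      proof (rule ccontr)
        assume "a \<inter> b \<noteq> {}"
        then obtain x where x: "x \<in> a" "x \<in> b" by auto
        \<comment> \<open>A common point \<open>x\<close> determines the old atom that contains it,
          if any, and whether it lies in \<open>B\<close>; two new atoms sharing \<open>x\<close>
          are therefore the same piece.\<close>
        have u: "A1 = A2" if "A1 \<in> \<A>" "A2 \<in> \<A>" "x \<in> A1" "x \<in> A2" for A1 A2
          using d[OF that(1,2)] that(3,4) by blast
        consider A1 where "A1 \<in> \<A>" "a = A1 \<inter> B" | A1 where "A1 \<in> \<A>" "a = A1 - B" | "a = B - \<Union>\<A>"
          using ab(1) unfolding \<A>'_def by blast
        note a_cases = this
        consider A2 where "A2 \<in> \<A>" "b = A2 \<inter> B" | A2 where "A2 \<in> \<A>" "b = A2 - B" | "b = B - \<Union>\<A>"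
          using ab(2) unfolding \<A>'_def by blast
        note b_cases = this
        have "a = b"
          by (cases rule: a_cases; cases rule: b_cases) (use x u in blast)+
        then show False using ab by simp
      qed
    qed
    fix A assume "A \<in> \<A>'"
    moreover have "\<Union>\<A> \<in> sets borel" using A(1,3) by (intro sets.finite_Union) auto
    ultimately show "A \<in> sets borel" "bounded A"
      using A(3) B unfolding \<A>'_def by (auto intro: bounded_subset)
  next
    fix C assume "C \<in> insert B \<B>"
    then consider "C = B" | "C \<in> \<B>" by auto
    then show "\<exists>\<C>\<subseteq>\<A>'. C = \<Union>\<C>"
    proof cases
      case 1
      show ?thesis by (rule exI[of _ "(\<lambda>A. A \<inter> B) ` \<A> \<union> {B - \<Union>\<A>}"]) (auto simp: 1 \<A>'_def)
    next
      case 2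
      then obtain \<C> where C: "\<C> \<subseteq> \<A>" "C = \<Union>\<C>" using A(4) by blast
      show ?thesis by (rule exI[of _ "(\<lambda>A. A \<inter> B) ` \<C> \<union> (\<lambda>A. A - B) ` \<C>"]) (use C in \<open>auto simp: \<A>'_def\<close>)
    qed
  qed
qed

text \<open>Finite intersections of the generating events of \<open>Gamma_M\<close>; in contrast to
  the generators they form a pi-system.\<close>

definition count_event :: "('a::euclidean_space set \<times> nat) set \<Rightarrow> 'a set set" where
  "count_event ps = {\<gamma>\<in>Gamma. \<forall>p\<in>ps. card (\<gamma> \<inter> fst p) = snd p}"

definition bdd_borel_pairs :: "('a::euclidean_space set \<times> nat) set \<Rightarrow> bool" where
  "bdd_borel_pairs ps \<longleftrightarrow> finite ps \<and> (\<forall>p\<in>ps. fst p \<in> sets borel \<and> bounded (fst p))"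

lemma sets_count_event:
  assumes "bdd_borel_pairs ps"
  shows "count_event ps \<in> sets Gamma_M"
proof -
  have "{\<gamma>\<in>space Gamma_M. \<forall>p\<in>ps. card (\<gamma> \<inter> fst p) = snd p} \<in> sets Gamma_M"
  proof (rule sets.sets_Collect_finite_All)
    fix p assume p: "p \<in> ps"
    have "(\<lambda>\<gamma>. card (\<gamma> \<inter> fst p)) -` {snd p} \<inter> space Gamma_M \<in> sets Gamma_M"
      by (rule measurable_sets[OF card_Gamma_measurable]) (use assms p in \<open>auto simp: bdd_borel_pairs_def\<close>)
    also have "(\<lambda>\<gamma>. card (\<gamma> \<inter> fst p)) -` {snd p} \<inter> space Gamma_M = {\<gamma>\<in>space Gamma_M. card (\<gamma> \<inter> fst p) = snd p}" by auto
    finally show "{\<gamma>\<in>space Gamma_M. card (\<gamma> \<inter> fst p) = snd p} \<in> sets Gamma_M" .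
  qed (use assms in \<open>auto simp: bdd_borel_pairs_def\<close>)
  then show ?thesis by (simp add: count_event_def)
qed

lemma Int_stable_count_event: "Int_stable {count_event ps |ps. bdd_borel_pairs ps}"
proof (rule Int_stableI, clarify)
  fix ps qs :: "('a set \<times> nat) set" assume "bdd_borel_pairs ps" "bdd_borel_pairs qs"
  then show "\<exists>rs. count_event ps \<inter> count_event qs = count_event rs \<and> bdd_borel_pairs rs"
    by (intro exI[of _ "ps \<union> qs"]) (auto simp: count_event_def bdd_borel_pairs_def)
qed

lemma sets_Gamma_M_generator:
  "sets (Gamma_M :: 'a::euclidean_space set measure) = sigma_sets Gamma {count_event ps |ps. bdd_borel_pairs ps}"
  (is "_ = sigma_sets _ ?G")
proof (rule antisym)
  show "sets Gamma_M \<subseteq> sigma_sets Gamma ?G"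
    unfolding Gamma_M_def
  proof (subst sets_measure_of, blast, rule sigma_sets_mono, rule subsetI)
    fix a :: "'a set set"
    assume "a \<in> {{\<gamma> \<in> Gamma. card (\<gamma> \<inter> B) = n} |B n. B \<in> sets borel \<and> bounded B}"
    then obtain B n where "a = {\<gamma> \<in> Gamma. card (\<gamma> \<inter> B) = n}" "B \<in> sets borel" "bounded B" by auto
    then have "a = count_event {(B, n)}" "bdd_borel_pairs {(B, n)}"
      by (auto simp: count_event_def bdd_borel_pairs_def)
    then show "a \<in> sigma_sets Gamma ?G" by (intro sigma_sets.Basic) auto
  qed
  show "sigma_sets Gamma ?G \<subseteq> sets Gamma_M"
    by (rule sets.sigma_sets_subset[of _ Gamma_M, simplified]) (auto intro: sets_count_event)
qed

text \<open>\<open>V\<close> consists of the count vectors on the atoms that are compatible with the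
  prescribed counts. There are countably many, with disjoint events, so the probability becomes a
  countable sum of products.\<close>

lemma count_event_decomp:
  fixes ps :: "('a::euclidean_space set \<times> nat) set"
  assumes ps: "bdd_borel_pairs ps"
  shows "\<exists>As (V :: (nat \<Rightarrow> nat) set). countable V \<and>
    (\<forall>B\<in>set As. B \<in> sets borel \<and> bounded B) \<and>
    (\<forall>i<length As. \<forall>j<length As. i \<noteq> j \<longrightarrow> As ! i \<inter> As ! j = {}) \<and>
    count_event ps = (\<Union>v\<in>V. {\<gamma>\<in>Gamma. \<forall>i\<in>{..<length As}. card (\<gamma> \<inter> As ! i) = v i}) \<and>
    disjoint_family_on (\<lambda>v. {\<gamma>\<in>Gamma. \<forall>i\<in>{..<length As}. card (\<gamma> \<inter> As ! i) = v i}) V"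
proof -
  have fps: "finite ps" using ps by (simp add: bdd_borel_pairs_def)
  have bp: "\<And>B. B \<in> fst ` ps \<Longrightarrow> B \<in> sets borel \<and> bounded B" using ps by (auto simp: bdd_borel_pairs_def)
  obtain \<A> where A0: "finite \<A> \<and> disjoint \<A> \<and> (\<forall>A\<in>\<A>. A \<in> sets borel \<and> bounded A) \<and> (\<forall>B\<in>fst ` ps. \<exists>\<C>\<subseteq>\<A>. B = \<Union>\<C>)"
    using finite_family_atoms[OF finite_imageI[OF fps] bp] by (rule exE)
  have \<A>: "finite \<A>" "disjoint \<A>" "\<forall>A\<in>\<A>. A \<in> sets borel \<and> bounded A"
    "\<forall>B\<in>fst ` ps. \<exists>\<C>\<subseteq>\<A>. B = \<Union>\<C>"
    using A0 by (auto simp only:)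
  obtain As where As: "set As = \<A>" "distinct As" using finite_distinct_list[OF \<A>(1)] by auto
  define m where "m = length As"
  have dA: "As ! i \<inter> As ! j = {}" if "i < m" "j < m" "i \<noteq> j" for i j
    using that As \<A>(2) unfolding m_def by (metis disjointD nth_eq_iff_index_eq nth_mem)
  have "\<forall>p\<in>ps. \<exists>I. I \<subseteq> {..<m} \<and> fst p = (\<Union>i\<in>I. As ! i)"
  proof
    fix p assume "p \<in> ps"
    then obtain \<C> where C: "\<C> \<subseteq> \<A>" "fst p = \<Union>\<C>" using \<A>(4) by auto
    have "\<C> = (\<lambda>i. As ! i) ` {i\<in>{..<m}. As ! i \<in> \<C>}"
    proof (intro set_eqI iffI)
      fix C assume c: "C \<in> \<C>"
      then have "C \<in> set As" using C(1) As(1) by auto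
      then obtain i where "i < m" "As ! i = C" unfolding m_def in_set_conv_nth by blast
      then show "C \<in> (\<lambda>i. As ! i) ` {i\<in>{..<m}. As ! i \<in> \<C>}" using c by auto
    qed auto
    then show "\<exists>I. I \<subseteq> {..<m} \<and> fst p = (\<Union>i\<in>I. As ! i)"
      unfolding C(2) by (intro exI[of _ "{i\<in>{..<m}. As ! i \<in> \<C>}"]) auto
  qed
  then obtain I where I: "\<And>p. p \<in> ps \<Longrightarrow> I p \<subseteq> {..<m}" "\<And>p. p \<in> ps \<Longrightarrow> fst p = (\<Union>i\<in>I p. As ! i)"
    by metis
  \<comment> \<open>The vectors are extensional, so two different ones differ at some atom and
    describe disjoint events.\<close>
  define V where "V = {v \<in> {..<m} \<rightarrow>\<^sub>E (UNIV :: nat set). \<forall>p\<in>ps. (\<Sum>i\<in>I p. v i) = snd p}"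
  define F where "F v = {\<gamma>\<in>Gamma. \<forall>i\<in>{..<m}. card (\<gamma> \<inter> As ! i) = v i}" for v
  have card: "card (\<gamma> \<inter> fst p) = (\<Sum>i\<in>I p. card (\<gamma> \<inter> As ! i))" if "\<gamma> \<in> Gamma" "p \<in> ps" for \<gamma> p
  proof -
    have "\<gamma> \<inter> fst p = (\<Union>i\<in>I p. \<gamma> \<inter> As ! i)" using I(2)[OF that(2)] by auto
    moreover have "finite (\<gamma> \<inter> As ! i)" if "i \<in> I p" for i
    proof -
      have "As ! i \<in> \<A>" using that I(1)[OF \<open>p \<in> ps\<close>] As(1) by (auto simp: m_def)
      then show ?thesis using \<A>(3) by (intro finite_Gamma[OF \<open>\<gamma> \<in> Gamma\<close>]) auto
    qed
    moreover have "finite (I p)" using finite_subset[OF I(1)[OF that(2)]] by simp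
    moreover have "\<forall>i\<in>I p. \<forall>j\<in>I p. i \<noteq> j \<longrightarrow> (\<gamma> \<inter> As ! i) \<inter> (\<gamma> \<inter> As ! j) = {}"
      using dA I(1)[OF that(2)] by blast
    ultimately show ?thesis by (simp only:) (rule card_UN_disjoint; blast)
  qed
  have "count_event ps = (\<Union>v\<in>V. F v)"
  proof (intro set_eqI iffI)
    fix \<gamma> assume \<gamma>: "\<gamma> \<in> count_event ps"
    then have G: "\<gamma> \<in> Gamma" by (simp add: count_event_def)
    define v where "v = (\<lambda>i\<in>{..<m}. card (\<gamma> \<inter> As ! i))"
    have "(\<Sum>i\<in>I p. v i) = snd p" if "p \<in> ps" for p
    proof -
      have "(\<Sum>i\<in>I p. v i) = (\<Sum>i\<in>I p. card (\<gamma> \<inter> As ! i))"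
        using I(1)[OF that] by (intro sum.cong) (auto simp: v_def)
      then show ?thesis using card[OF G that] \<gamma> that by (simp add: count_event_def)
    qed
    then have "v \<in> V" by (auto simp: V_def v_def)
    moreover have "\<gamma> \<in> F v" using G by (simp add: F_def v_def)
    ultimately show "\<gamma> \<in> (\<Union>v\<in>V. F v)" by blast
  next
    fix \<gamma> assume "\<gamma> \<in> (\<Union>v\<in>V. F v)"
    then obtain v where v: "v \<in> V" "\<gamma> \<in> F v" by auto
    then have G: "\<gamma> \<in> Gamma" by (simp add: F_def)
    have "card (\<gamma> \<inter> fst p) = snd p" if "p \<in> ps" for p
    proof -
      have "(\<Sum>i\<in>I p. card (\<gamma> \<inter> As ! i)) = (\<Sum>i\<in>I p. v i)"
        using I(1)[OF that] v(2) by (intro sum.cong) (auto simp: F_def)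
      then show ?thesis using v(1) that card[OF G that] by (simp add: V_def)
    qed
    then show "\<gamma> \<in> count_event ps" using G by (simp add: count_event_def)
  qed
  moreover have "disjoint_family_on F V"
    unfolding disjoint_family_on_def
  proof (intro ballI impI)
    fix v w assume vw: "v \<in> V" "w \<in> V" "v \<noteq> w"
    then have "v \<in> {..<m} \<rightarrow>\<^sub>E UNIV" "w \<in> {..<m} \<rightarrow>\<^sub>E UNIV" by (auto simp: V_def)
    then have "\<exists>i\<in>{..<m}. v i \<noteq> w i" using PiE_ext[of v "{..<m}" "\<lambda>_. UNIV" w] vw(3) by auto
    then show "F v \<inter> F w = {}" unfolding F_def by auto
  qed
  moreover have "countable V" unfolding V_def
    by (rule countable_subset[of _ "{..<m} \<rightarrow>\<^sub>E UNIV"]) (auto intro: countable_PiE)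
  ultimately show ?thesis
    using \<A>(3) As(1) dA unfolding F_def m_def by (intro exI[of _ As] exI[of _ V]) auto
qed

text \<open>The explicit right side depends on the process only through its intensity. It gives
  uniqueness of the law, and measurability of the probability when the intensity depends on a
  parameter.\<close>

lemma poisson_pp_count_event:
  fixes \<rho> :: "'a::euclidean_space \<Rightarrow> real"
  assumes M: "poisson_pp \<rho> M"
    and As: "\<forall>B\<in>set As. B \<in> sets borel \<and> bounded B"
      "\<forall>i<length As. \<forall>j<length As. i \<noteq> j \<longrightarrow> As ! i \<inter> As ! j = {}"
    and V: "countable V"
      "count_event ps = (\<Union>v\<in>V. {\<gamma>\<in>Gamma. \<forall>i\<in>{..<length As}. card (\<gamma> \<inter> As ! i) = v i})"
      "disjoint_family_on (\<lambda>v. {\<gamma>\<in>Gamma. \<forall>i\<in>{..<length As}. card (\<gamma> \<inter> As ! i) = v i}) V"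
  shows "emeasure M (count_event ps) = (\<integral>\<^sup>+v. (\<Prod>i<length As.
     ennreal (exp (- enn2real (\<integral>\<^sup>+x\<in>As ! i. ennreal (\<rho> x) \<partial>lborel)) *
       enn2real (\<integral>\<^sup>+x\<in>As ! i. ennreal (\<rho> x) \<partial>lborel) ^ v i / fact (v i))) \<partial>count_space V)"
proof -
  have sM: "sets M = sets Gamma_M" and "prob_space M" using M by (auto simp: poisson_pp_def)
  interpret prob_space M by fact
  have spM: "space M = Gamma" using sets_eq_imp_space_eq[OF sM] by simp
  let ?m = "length As"
  define F where "F v = {\<gamma>\<in>Gamma. \<forall>i\<in>{..<?m}. card (\<gamma> \<inter> As ! i) = v i}" for v
  have Ai: "As ! i \<in> sets borel" "bounded (As ! i)" if "i < ?m" for i using As(1) that by auto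
  have FM: "F v \<in> sets M" for v
    unfolding F_def sM using sets_Gamma_card[of "{..<?m}" "\<lambda>i. As ! i" "\<lambda>i. {v i}"] Ai by simp
  have "emeasure M (F v) = (\<Prod>i<?m.
     ennreal (exp (- enn2real (\<integral>\<^sup>+x\<in>As ! i. ennreal (\<rho> x) \<partial>lborel)) *
       enn2real (\<integral>\<^sup>+x\<in>As ! i. ennreal (\<rho> x) \<partial>lborel) ^ v i / fact (v i)))" for v
  proof -
    have "prob (F v) = (\<Prod>i<?m. prob {\<gamma>\<in>Gamma. card (\<gamma> \<inter> As ! i) = v i})"
    proof (cases "?m = 0")
      \<comment> \<open>Without atoms there is no nonempty index set for the product rule of
        independence; the event is then the whole space.\<close>
      case True
      then show ?thesis using prob_space spM by (simp add: F_def)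
    next
      case False
      have ind: "indep_vars (\<lambda>_. count_space UNIV) (\<lambda>i \<gamma>. card (\<gamma> \<inter> As ! i)) {..<?m}"
        using M As unfolding poisson_pp_def by blast
      have "prob (\<Inter>i\<in>{..<?m}. (\<lambda>\<gamma>. card (\<gamma> \<inter> As ! i)) -` {v i} \<inter> space M) =
        (\<Prod>i\<in>{..<?m}. prob ((\<lambda>\<gamma>. card (\<gamma> \<inter> As ! i)) -` {v i} \<inter> space M))"
        by (rule indep_varsD[OF ind]) (use False in auto)
      also have "(\<Inter>i\<in>{..<?m}. (\<lambda>\<gamma>. card (\<gamma> \<inter> As ! i)) -` {v i} \<inter> space M) = F v"
        using False by (auto simp: F_def spM)
      also have "(\<lambda>i. (\<lambda>\<gamma>. card (\<gamma> \<inter> As ! i)) -` {v i} \<inter> space M) = (\<lambda>i. {\<gamma>\<in>Gamma. card (\<gamma> \<inter> As ! i) = v i})"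
        by (auto simp: spM)
      finally show ?thesis .
    qed
    then have "emeasure M (F v) = (\<Prod>i<?m. emeasure M {\<gamma>\<in>Gamma. card (\<gamma> \<inter> As ! i) = v i})"
      unfolding emeasure_eq_measure by (simp add: prod_ennreal)
    also have "\<dots> = (\<Prod>i<?m.
     ennreal (exp (- enn2real (\<integral>\<^sup>+x\<in>As ! i. ennreal (\<rho> x) \<partial>lborel)) *
       enn2real (\<integral>\<^sup>+x\<in>As ! i. ennreal (\<rho> x) \<partial>lborel) ^ v i / fact (v i)))"
    proof (rule prod.cong)
      fix i assume "i \<in> {..<?m}"
      then show "emeasure M {\<gamma>\<in>Gamma. card (\<gamma> \<inter> As ! i) = v i} = ennreal (exp (- enn2real (\<integral>\<^sup>+x\<in>As ! i. ennreal (\<rho> x) \<partial>lborel)) *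
       enn2real (\<integral>\<^sup>+x\<in>As ! i. ennreal (\<rho> x) \<partial>lborel) ^ v i / fact (v i))"
        using M Ai[of i] unfolding poisson_pp_def spM by (simp add: Let_def)
    qed simp
    finally show ?thesis .
  qed
  moreover have "emeasure M (count_event ps) = (\<integral>\<^sup>+v. emeasure M (F v) \<partial>count_space V)"
    unfolding V(2) F_def[symmetric] using V(3) FM by (intro emeasure_UN_countable V(1)) (auto simp: F_def)
  ultimately show ?thesis by simp
qed

lemma poisson_pp_unique:
  fixes \<rho> :: "'a::euclidean_space \<Rightarrow> real"
  assumes M: "poisson_pp \<rho> M" and N: "poisson_pp \<rho> N"
  shows "M = N"
proof (rule measure_eqI_generator_eq[where A="\<lambda>_. Gamma"])
  show "Int_stable {count_event ps |ps. bdd_borel_pairs ps}" by (rule Int_stable_count_event)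
  show "{count_event ps |ps. bdd_borel_pairs ps} \<subseteq> Pow Gamma" by (auto simp: count_event_def)
  show "emeasure M X = emeasure N X" if X: "X \<in> {count_event ps |ps. bdd_borel_pairs ps}" for X
  proof -
    obtain ps where ps: "X = count_event ps" "bdd_borel_pairs ps" using X by auto
  obtain As :: "'a set list" and V :: "(nat \<Rightarrow> nat) set" where
    As: "\<forall>B\<in>set As. B \<in> sets borel \<and> bounded B"
      "\<forall>i<length As. \<forall>j<length As. i \<noteq> j \<longrightarrow> As ! i \<inter> As ! j = {}"
    and V: "countable V"
      "count_event ps = (\<Union>v\<in>V. {\<gamma>\<in>Gamma. \<forall>i\<in>{..<length As}. card (\<gamma> \<inter> As ! i) = v i})"
      "disjoint_family_on (\<lambda>v. {\<gamma>\<in>Gamma. \<forall>i\<in>{..<length As}. card (\<gamma> \<inter> As ! i) = v i}) V"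
    using count_event_decomp[OF ps(2)] by blast
    show ?thesis unfolding ps(1) poisson_pp_count_event[OF M As V] poisson_pp_count_event[OF N As V] ..
  qed
  show "sets M = sigma_sets Gamma {count_event ps |ps. bdd_borel_pairs ps}"
    "sets N = sigma_sets Gamma {count_event ps |ps. bdd_borel_pairs ps}"
    using M N unfolding sets_Gamma_M_generator[symmetric] by (auto simp: poisson_pp_def)
  have "Gamma = count_event {}" "bdd_borel_pairs {}" by (auto simp: count_event_def bdd_borel_pairs_def)
  then show "range (\<lambda>_. Gamma) \<subseteq> {count_event ps |ps. bdd_borel_pairs ps}" by blast
  interpret prob_space M using M by (simp add: poisson_pp_def)
  show "\<And>i. emeasure M Gamma \<noteq> \<infinity>" by simp
qed simp

lemma pi_pp_eqI: "poisson_pp \<rho> M \<Longrightarrow> pi_pp \<rho> = M"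
  unfolding pi_pp_def by (rule the_equality) (auto intro: poisson_pp_unique)

text \<open>A process satisfying the Mecke formula exists and has the Poisson property, and that
  property has only one solution. Hence the description in \<open>pi_pp\<close> denotes this
  process, which brings the Mecke formula with it.\<close>

lemma pi_pp:
  assumes "loc_fin (\<lambda>x. ennreal (\<rho> x))"
  shows pi_pp_mecke: "mecke (\<lambda>x. ennreal (\<rho> x)) (pi_pp \<rho>)"
    and pi_pp_poisson: "poisson_pp \<rho> (pi_pp \<rho>)"
proof -
  obtain M where M: "mecke (\<lambda>x. ennreal (\<rho> x)) M" using mecke_exists[OF assms] ..
  have "poisson_pp \<rho> M" using mecke_imp_poisson_pp[OF M assms] .
  with pi_pp_eqI[OF this] M show "mecke (\<lambda>x. ennreal (\<rho> x)) (pi_pp \<rho>)" "poisson_pp \<rho> (pi_pp \<rho>)" by simp_all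
qed

text \<open>Mixing over \<omega> requires a probability kernel. On the pi-system of count events the
  probability is a countable sum of continuous functions of the masses of finitely many sets, and
  these masses are measurable in \<omega>.\<close>

lemma pi_pp_measurable:
  fixes g :: "'w \<Rightarrow> 'a::euclidean_space \<Rightarrow> real"
  assumes g[measurable]: "(\<lambda>(\<omega>, x). g \<omega> x) \<in> borel_measurable (P \<Otimes>\<^sub>M borel)"
    and lf: "\<And>\<omega>. \<omega> \<in> space P \<Longrightarrow> loc_fin (\<lambda>x. ennreal (g \<omega> x))"
  shows "(\<lambda>\<omega>. pi_pp (g \<omega>)) \<in> P \<rightarrow>\<^sub>M prob_algebra Gamma_M"
proof (rule measurable_prob_algebra_generated[OF sets_Gamma_M_generator Int_stable_count_event])
  show "{count_event ps |ps. bdd_borel_pairs ps} \<subseteq> Pow Gamma" by (auto simp: count_event_def)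
  show "prob_space (pi_pp (g \<omega>))" "sets (pi_pp (g \<omega>)) = sets Gamma_M" if "\<omega> \<in> space P" for \<omega>
    using pi_pp_poisson[OF lf[OF that]] by (auto simp: poisson_pp_def)
  fix A :: "'a set set" assume "A \<in> {count_event ps |ps. bdd_borel_pairs ps}"
  then obtain ps where ps: "A = count_event ps" "bdd_borel_pairs ps" by auto
  obtain As :: "'a set list" and V :: "(nat \<Rightarrow> nat) set" where
    As: "\<forall>B\<in>set As. B \<in> sets borel \<and> bounded B"
      "\<forall>i<length As. \<forall>j<length As. i \<noteq> j \<longrightarrow> As ! i \<inter> As ! j = {}"
    and V: "countable V"
      "count_event ps = (\<Union>v\<in>V. {\<gamma>\<in>Gamma. \<forall>i\<in>{..<length As}. card (\<gamma> \<inter> As ! i) = v i})"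
      "disjoint_family_on (\<lambda>v. {\<gamma>\<in>Gamma. \<forall>i\<in>{..<length As}. card (\<gamma> \<inter> As ! i) = v i}) V"
    using count_event_decomp[OF ps(2)] by blast
  define L where "L i \<omega> = enn2real (\<integral>\<^sup>+x\<in>As ! i. ennreal (g \<omega> x) \<partial>lborel)" for i \<omega>
  have L: "L i \<in> borel_measurable P" if "i < length As" for i
  proof -
    have [measurable]: "As ! i \<in> sets borel" using As(1) that by auto
    show ?thesis unfolding L_def by measurable
  qed
  interpret V: sigma_finite_measure "count_space V" by (rule sigma_finite_measure_count_space_countable) fact
  have "(\<lambda>(v, \<omega>). \<Prod>i<length As. ennreal (exp (- L i \<omega>) * L i \<omega> ^ v i / fact (v i))) \<in> borel_measurable (count_space V \<Otimes>\<^sub>M P)"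
  proof (rule measurable_pair_measure_countable1[OF V(1)])
    fix v assume "v \<in> V"
    have "(\<lambda>\<omega>. \<Prod>i<length As. ennreal (exp (- L i \<omega>) * L i \<omega> ^ v i / fact (v i))) \<in> borel_measurable P"
    proof (rule borel_measurable_prod_ennreal)
      fix i assume "i \<in> {..<length As}"
      then have [measurable]: "L i \<in> borel_measurable P" using L by simp
      show "(\<lambda>\<omega>. ennreal (exp (- L i \<omega>) * L i \<omega> ^ v i / fact (v i))) \<in> borel_measurable P" by measurable
    qed
    then show "(\<lambda>y. case (v, y) of (v, \<omega>) \<Rightarrow> \<Prod>i<length As. ennreal (exp (- L i \<omega>) * L i \<omega> ^ v i / fact (v i))) \<in> borel_measurable P"
      by simp
  qed
  from measurable_pair_swap[OF this]
  have "(\<lambda>\<omega>. \<integral>\<^sup>+v. (\<Prod>i<length As. ennreal (exp (- L i \<omega>) * L i \<omega> ^ v i / fact (v i))) \<partial>count_space V) \<in> borel_measurable P"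
    by (intro V.borel_measurable_nn_integral) (simp add: split_beta')
  also have "?this \<longleftrightarrow> (\<lambda>\<omega>. emeasure (pi_pp (g \<omega>)) A) \<in> borel_measurable P"
    unfolding ps(1) L_def
    by (intro measurable_cong) (simp add: poisson_pp_count_event[OF pi_pp_poisson[OF lf] As V])
  finally show "(\<lambda>\<omega>. emeasure (pi_pp (g \<omega>)) A) \<in> borel_measurable P" .
qed

section \<open>The limit for a fixed configuration\<close>

lemma nn_integral_lborel_translate:
  fixes f :: "'a::euclidean_space \<Rightarrow> ennreal"
  assumes [measurable]: "f \<in> borel_measurable borel"
  shows "(\<integral>\<^sup>+x. f (x + h) \<partial>lborel) = (\<integral>\<^sup>+x. f x \<partial>lborel)"
proof -
  have "(\<integral>\<^sup>+x. f x \<partial>lborel) = (\<integral>\<^sup>+x. f x \<partial>distr lborel borel ((+) h))"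
    by (simp only: lborel_distr_plus)
  also have "\<dots> = (\<integral>\<^sup>+x. f (x + h) \<partial>lborel)"
    by (subst nn_integral_distr) (auto simp: add.commute)
  finally show ?thesis by simp
qed

lemma integral_lborel_translate:
  fixes f :: "'a::euclidean_space \<Rightarrow> real"
  assumes [measurable]: "f \<in> borel_measurable borel"
  shows "(\<integral>x. f (x + h) \<partial>lborel) = (\<integral>x. f x \<partial>lborel)"
proof -
  have "(\<integral>x. f x \<partial>lborel) = (\<integral>x. f x \<partial>distr lborel borel ((+) h))"
    by (simp only: lborel_distr_plus)
  also have "\<dots> = (\<integral>x. f (x + h) \<partial>lborel)"
    by (subst integral_distr) (auto simp: add.commute)
  finally show ?thesis by simp
qed

lemma integrable_lborel_translate:
  fixes f :: "'a::euclidean_space \<Rightarrow> real"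
  assumes "integrable lborel f"
  shows "integrable lborel (\<lambda>x. f (x + h))"
proof -
  have [measurable]: "f \<in> borel_measurable borel" using assms by auto
  have "integrable (distr lborel borel ((+) h)) f" using assms by (simp only: lborel_distr_plus)
  then show ?thesis by (subst (asm) integrable_distr_eq) (auto simp: add.commute)
qed

text \<open>A set and its translate have equal measure, so the symmetric difference is twice the
  one-sided one. On this side openness gives pointwise convergence: a point of \<open>U\<close>
  stays in \<open>U\<close> under small shifts.\<close>

lemma translation_continuity_open:
  fixes U :: "'a::euclidean_space set"
  assumes U: "open U" "emeasure lborel U < \<infinity>" and h: "h \<longlonglongrightarrow> 0"
  shows "(\<lambda>n. \<integral>x. \<bar>indicat_real U (x + h n) - indicat_real U x\<bar> \<partial>lborel) \<longlonglongrightarrow> 0"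
proof -
  have [measurable]: "U \<in> sets borel" using U by simp
  have iU: "integrable lborel (indicat_real U)" using U by (subst integrable_indicator_iff) auto
  have iT: "integrable lborel (\<lambda>x. indicat_real U (x + y))" for y
    by (rule integrable_lborel_translate[OF iU])
  have iD: "integrable lborel (\<lambda>x. indicat_real U x * (1 - indicat_real U (x + y)))" for y
    by (rule Bochner_Integration.integrable_bound[OF iU]) (auto simp: indicator_def)
  have eq: "(\<integral>x. \<bar>indicat_real U (x + y) - indicat_real U x\<bar> \<partial>lborel) =
      2 * (\<integral>x. indicat_real U x * (1 - indicat_real U (x + y)) \<partial>lborel)" for y
  proof -
    have "(\<integral>x. \<bar>indicat_real U (x + y) - indicat_real U x\<bar> \<partial>lborel) =
      (\<integral>x. (indicat_real U (x + y) - indicat_real U x) + 2 * (indicat_real U x * (1 - indicat_real U (x + y))) \<partial>lborel)"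
      by (intro Bochner_Integration.integral_cong) (auto simp: indicator_def)
    also have "\<dots> = ((\<integral>x. indicat_real U (x + y) \<partial>lborel) - (\<integral>x. indicat_real U x \<partial>lborel))
       + 2 * (\<integral>x. indicat_real U x * (1 - indicat_real U (x + y)) \<partial>lborel)"
      using iU iT[of y] iD[of y] by simp
    also have "(\<integral>x. indicat_real U (x + y) \<partial>lborel) = (\<integral>x. indicat_real U x \<partial>lborel)"
      by (rule integral_lborel_translate) simp
    finally show ?thesis by simp
  qed
  have "(\<lambda>n. \<integral>x. indicat_real U x * (1 - indicat_real U (x + h n)) \<partial>lborel) \<longlonglongrightarrow> (\<integral>x. 0 \<partial>(lborel :: 'a measure))"
  proof (rule integral_dominated_convergence[OF _ _ iU])
    show "AE x in lborel. (\<lambda>n. indicat_real U x * (1 - indicat_real U (x + h n))) \<longlonglongrightarrow> 0"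
    proof (rule AE_I2)
      fix x
      show "(\<lambda>n. indicat_real U x * (1 - indicat_real U (x + h n))) \<longlonglongrightarrow> 0"
      proof (cases "x \<in> U")
        case True
        have "(\<lambda>n. x + h n) \<longlonglongrightarrow> x + 0" by (intro tendsto_intros h)
        then have "\<forall>\<^sub>F n in sequentially. x + h n \<in> U" using U(1) True by (simp add: topological_tendstoD)
        then show ?thesis using True by (intro tendsto_eventually) (erule eventually_mono, simp)
      qed simp
    qed
  qed (auto simp: indicator_def)
  then show ?thesis unfolding eq by (auto intro: tendsto_eq_intros)
qed

text \<open>Outer regularity approximates a measurable set by an open superset; sums and dominated
  limits then carry the claim to all integrable functions.\<close>

lemma translation_continuity_L1:
  fixes f :: "'a::euclidean_space \<Rightarrow> real"
  assumes f: "integrable lborel f" and h: "h \<longlonglongrightarrow> 0"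
  shows "(\<lambda>n. \<integral>x. \<bar>f (x + h n) - f x\<bar> \<partial>lborel) \<longlonglongrightarrow> 0"
  using f
proof (induction rule: integrable_induct)
  case (base A c)
  have A[measurable]: "A \<in> sets borel" using base by simp
  show ?case
  proof (rule LIMSEQ_I)
    fix e :: real assume e: "0 < e"
    \<comment> \<open>The error is at most \<bar>c\<bar> * 3d: one \<open>d\<close> for the open
      set, one for \<open>U - A\<close> and one for its translate. The summand 1 covers c =
      0.\<close>
    define d where "d = e / (4 * (\<bar>c\<bar> + 1))"
    have d: "d > 0" using e by (simp add: d_def add_nonneg_pos)
    obtain U where U: "open U" "A \<subseteq> U" "emeasure lborel (U - A) < d" using outer_regular_lborel[OF A d] .
    have [measurable]: "U \<in> sets borel" using U by simp
    have fU: "emeasure lborel U < \<infinity>"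
    proof -
      have "emeasure lborel U \<le> emeasure lborel A + emeasure lborel (U - A)"
        using U(2) by (subst plus_emeasure) (auto simp: Un_absorb1)
      also have "\<dots> < \<infinity>" using base(2) U(3) by (auto simp: less_top[symmetric] top_unique)
      finally show ?thesis .
    qed
    define g where "g = indicat_real (U - A)"
    have [measurable]: "g \<in> borel_measurable borel" unfolding g_def by measurable
    have ig: "integrable lborel g" using U(3) unfolding g_def by (subst integrable_indicator_iff) (auto intro: order.strict_trans)
    have ig': "integrable lborel (\<lambda>x. g (x + y))" for y by (rule integrable_lborel_translate[OF ig])
    have gd: "(\<integral>x. g x \<partial>lborel) \<le> d"
    proof -
      have "(\<integral>x. g x \<partial>lborel) = measure lborel (U - A)" by (simp add: g_def)
      also have "\<dots> \<le> d" using U(3) d unfolding measure_def by (intro enn2real_leI) auto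
      finally show ?thesis .
    qed
    have iU: "integrable lborel (indicat_real U)" using fU by (subst integrable_indicator_iff) auto
    have iU': "integrable lborel (\<lambda>x. indicat_real U (x + y))" for y by (rule integrable_lborel_translate[OF iU])
    have le: "(\<integral>x. \<bar>indicator A (x + y) *\<^sub>R c - indicator A x *\<^sub>R c\<bar> \<partial>lborel) \<le>
        \<bar>c\<bar> * ((\<integral>x. \<bar>indicat_real U (x + y) - indicat_real U x\<bar> \<partial>lborel) + 2 * d)" for y
    proof -
      have "(\<integral>x. \<bar>indicator A (x + y) *\<^sub>R c - indicator A x *\<^sub>R c\<bar> \<partial>lborel) \<le>
        (\<integral>x. \<bar>c\<bar> * (\<bar>indicat_real U (x + y) - indicat_real U x\<bar> + (g (x + y) + g x)) \<partial>lborel)"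
      proof (rule integral_mono')
        show "integrable lborel (\<lambda>x. \<bar>c\<bar> * (\<bar>indicat_real U (x + y) - indicat_real U x\<bar> + (g (x + y) + g x)))"
          using iU iU'[of y] ig ig'[of y] by auto
        fix x
        have "\<bar>indicator A (x + y) *\<^sub>R c - indicator A x *\<^sub>R c\<bar> = \<bar>c\<bar> * \<bar>indicat_real A (x + y) - indicat_real A x\<bar>"
          by (simp add: abs_mult[symmetric] algebra_simps)
        also have "\<bar>indicat_real A (x + y) - indicat_real A x\<bar> \<le> \<bar>indicat_real U (x + y) - indicat_real U x\<bar> + (g (x + y) + g x)"
          using U(2) by (auto simp: g_def indicator_def)
        finally show "\<bar>indicator A (x + y) *\<^sub>R c - indicator A x *\<^sub>R c\<bar> \<le> \<bar>c\<bar> * (\<bar>indicat_real U (x + y) - indicat_real U x\<bar> + (g (x + y) + g x))"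
          by (simp add: mult_left_mono)
      qed (auto simp: g_def)
      also have "\<dots> = \<bar>c\<bar> * ((\<integral>x. \<bar>indicat_real U (x + y) - indicat_real U x\<bar> \<partial>lborel) + ((\<integral>x. g (x + y) \<partial>lborel) + (\<integral>x. g x \<partial>lborel)))"
        using iU iU'[of y] ig ig'[of y] by simp
      also have "(\<integral>x. g (x + y) \<partial>lborel) = (\<integral>x. g x \<partial>lborel)" by (rule integral_lborel_translate) simp
      finally show ?thesis using gd by (smt (verit) mult_left_mono abs_ge_zero)
    qed
    have "(\<lambda>n. \<integral>x. \<bar>indicat_real U (x + h n) - indicat_real U x\<bar> \<partial>lborel) \<longlonglongrightarrow> 0"
      by (rule translation_continuity_open[OF U(1) fU h])
    then obtain N where N: "\<And>n. n \<ge> N \<Longrightarrow> \<bar>\<integral>x. \<bar>indicat_real U (x + h n) - indicat_real U x\<bar> \<partial>lborel\<bar> < d"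
      using LIMSEQ_D[OF _ d] by fastforce
    show "\<exists>N. \<forall>n\<ge>N. norm ((\<integral>x. \<bar>indicator A (x + h n) *\<^sub>R c - indicator A x *\<^sub>R c\<bar> \<partial>lborel) - 0) < e"
    proof (intro exI allI impI)
      fix n assume "N \<le> n"
      have "(\<integral>x. \<bar>indicator A (x + h n) *\<^sub>R c - indicator A x *\<^sub>R c\<bar> \<partial>lborel) \<le> \<bar>c\<bar> * (3 * d)"
        using le[of "h n"] N[OF \<open>N \<le> n\<close>] by (smt (verit) mult_left_mono abs_ge_zero)
      also have "\<dots> < e"
      proof -
        have "\<bar>c\<bar> * (3 * d) \<le> (\<bar>c\<bar> + 1) * (3 * d)" using d by (intro mult_right_mono) auto
        also have "\<dots> = 3 / 4 * e" unfolding d_def by (simp add: field_simps)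
        also have "\<dots> < e" using e by simp
        finally show ?thesis .
      qed
      finally show "norm ((\<integral>x. \<bar>indicator A (x + h n) *\<^sub>R c - indicator A x *\<^sub>R c\<bar> \<partial>lborel) - 0) < e" by simp
    qed
  qed
next
  case (add f g)
  have [measurable]: "f \<in> borel_measurable borel" "g \<in> borel_measurable borel" using add(1,2) by auto
  note i = add(1,2) integrable_lborel_translate[OF add(1)] integrable_lborel_translate[OF add(2)]
  have lim: "(\<lambda>n. (\<integral>x. \<bar>f (x + h n) - f x\<bar> \<partial>lborel) + (\<integral>x. \<bar>g (x + h n) - g x\<bar> \<partial>lborel)) \<longlonglongrightarrow> 0"
    using tendsto_add[OF add(3,4)] by simp
  show ?case
  proof (rule tendsto_sandwich[OF _ _ tendsto_const lim]; rule always_eventually; rule allI)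
    fix n
    show "0 \<le> (\<integral>x. \<bar>f (x + h n) + g (x + h n) - (f x + g x)\<bar> \<partial>lborel)" by simp
    have "(\<integral>x. \<bar>f (x + h n) + g (x + h n) - (f x + g x)\<bar> \<partial>lborel) \<le>
       (\<integral>x. \<bar>f (x + h n) - f x\<bar> + \<bar>g (x + h n) - g x\<bar> \<partial>lborel)"
      using i by (intro integral_mono) auto
    also have "\<dots> = (\<integral>x. \<bar>f (x + h n) - f x\<bar> \<partial>lborel) + (\<integral>x. \<bar>g (x + h n) - g x\<bar> \<partial>lborel)"
      using i by simp
    finally show "(\<integral>x. \<bar>f (x + h n) + g (x + h n) - (f x + g x)\<bar> \<partial>lborel) \<le> \<dots>" .
  qed
next
  case (lim f s)
  have [measurable]: "f \<in> borel_measurable borel" "s i \<in> borel_measurable borel" for i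
    using lim(1,4) by auto
  have conv: "(\<lambda>i. \<integral>x. \<bar>s i x - f x\<bar> \<partial>lborel) \<longlonglongrightarrow> (\<integral>x. 0 \<partial>(lborel :: 'a measure))"
  proof (rule integral_dominated_convergence[where w="\<lambda>x. 3 * \<bar>f x\<bar>"])
    show "AE x in lborel. (\<lambda>i. \<bar>s i x - f x\<bar>) \<longlonglongrightarrow> 0"
      using lim(2) by (auto intro!: tendsto_rabs_zero simp: LIM_zero_iff)
    show "AE x in lborel. norm \<bar>s i x - f x\<bar> \<le> 3 * \<bar>f x\<bar>" for i
    proof (rule AE_I2)
      fix x :: 'a
      have "\<bar>s i x\<bar> \<le> 2 * \<bar>f x\<bar>" using lim(3)[of x i] by simp
      then show "norm \<bar>s i x - f x\<bar> \<le> 3 * \<bar>f x\<bar>" by simp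
    qed
  qed (use lim(4) in auto)
  show ?case
  proof (rule LIMSEQ_I)
    fix e :: real assume e: "0 < e"
    have "\<exists>i. \<bar>\<integral>x. \<bar>s i x - f x\<bar> \<partial>lborel\<bar> < e / 3"
      using LIMSEQ_D[OF conv, of "e / 3"] e by fastforce
    then obtain i where i: "(\<integral>x. \<bar>s i x - f x\<bar> \<partial>lborel) < e / 3" by auto
    obtain N where N: "\<And>n. n \<ge> N \<Longrightarrow> \<bar>\<integral>x. \<bar>s i (x + h n) - s i x\<bar> \<partial>lborel\<bar> < e / 3"
      using LIMSEQ_D[OF lim(5)[of i], of "e / 3"] e by fastforce
    show "\<exists>N. \<forall>n\<ge>N. norm ((\<integral>x. \<bar>f (x + h n) - f x\<bar> \<partial>lborel) - 0) < e"
    proof (intro exI allI impI)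
      fix n assume n: "N \<le> n"
      note ii = lim(1)[of i] lim(4) integrable_lborel_translate[OF lim(1)[of i], of "h n"] integrable_lborel_translate[OF lim(4), of "h n"]
      have "(\<integral>x. \<bar>f (x + h n) - f x\<bar> \<partial>lborel) \<le>
        (\<integral>x. \<bar>s i (x + h n) - f (x + h n)\<bar> + \<bar>s i (x + h n) - s i x\<bar> + \<bar>s i x - f x\<bar> \<partial>lborel)"
        using ii by (intro integral_mono) auto
      also have "\<dots> = (\<integral>x. \<bar>s i (x + h n) - f (x + h n)\<bar> \<partial>lborel) + (\<integral>x. \<bar>s i (x + h n) - s i x\<bar> \<partial>lborel) + (\<integral>x. \<bar>s i x - f x\<bar> \<partial>lborel)"
        using ii by simp
      also have "(\<integral>x. \<bar>s i (x + h n) - f (x + h n)\<bar> \<partial>lborel) = (\<integral>x. \<bar>s i x - f x\<bar> \<partial>lborel)"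
        by (rule integral_lborel_translate) simp
      finally show "norm ((\<integral>x. \<bar>f (x + h n) - f x\<bar> \<partial>lborel) - 0) < e" using i N[OF n] by simp
    qed
  qed
qed

section \<open>Second moments of radial functions\<close>

text \<open>Permuting coordinates permutes the side lengths of a box, and boxes determine Lebesgue
  measure. Swaps and reflections of coordinates are all the isometries needed for radial second
  moments.\<close>

lemma distr_lborel_swap:
  fixes i j :: "'a::euclidean_space"
  assumes ij: "i \<in> Basis" "j \<in> Basis"
  defines "T \<equiv> (\<lambda>x::'a. \<Sum>b\<in>Basis. (x \<bullet> Transposition.transpose i j b) *\<^sub>R b)"
  shows "distr lborel borel T = lborel"
proof (rule lborel_eqI[symmetric])
  let ?\<pi> = "Transposition.transpose i j"
  have \<pi>: "?\<pi> b \<in> Basis \<longleftrightarrow> b \<in> Basis" for b using ij by (auto simp: Transposition.transpose_def)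
  have bij: "bij_betw ?\<pi> Basis Basis"
    by (rule bij_betwI[where g="?\<pi>"]) (auto simp: \<pi>)
  have T: "T x \<bullet> b = x \<bullet> ?\<pi> b" if "b \<in> Basis" for x b using that by (simp add: T_def)
  have [measurable]: "T \<in> borel_measurable borel" unfolding T_def by measurable
  show "sets (distr lborel borel T) = sets borel" by simp
  fix l u :: 'a assume lu: "\<And>b. b \<in> Basis \<Longrightarrow> l \<bullet> b \<le> u \<bullet> b"
  have "T -` box l u \<inter> space lborel = box (T l) (T u)"
  proof (intro set_eqI)
    fix x
    have "(\<forall>b\<in>Basis. l \<bullet> b < x \<bullet> ?\<pi> b \<and> x \<bullet> ?\<pi> b < u \<bullet> b) \<longleftrightarrow> (\<forall>b\<in>Basis. l \<bullet> ?\<pi> b < x \<bullet> b \<and> x \<bullet> b < u \<bullet> ?\<pi> b)"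
      by (metis \<pi> transpose_involutory)
    then show "x \<in> T -` box l u \<inter> space lborel \<longleftrightarrow> x \<in> box (T l) (T u)" by (simp add: mem_box T)
  qed
  then have "emeasure (distr lborel borel T) (box l u) = emeasure lborel (box (T l) (T u))"
    by (subst emeasure_distr) auto
  also have "\<dots> = (\<Prod>b\<in>Basis. (T u - T l) \<bullet> b)"
    using lu by (intro emeasure_lborel_box) (auto simp: T \<pi>)
  also have "(\<Prod>b\<in>Basis. (T u - T l) \<bullet> b) = (\<Prod>b\<in>Basis. (u - l) \<bullet> ?\<pi> b)"
    by (intro prod.cong) (auto simp: T inner_diff_left)
  also have "\<dots> = (\<Prod>b\<in>Basis. (u - l) \<bullet> b)"
    using prod.reindex_bij_betw[OF bij, of "\<lambda>b. (u - l) \<bullet> b"] .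
  finally show "emeasure (distr lborel borel T) (box l u) = ennreal (\<Prod>b\<in>Basis. (u - l) \<bullet> b)" .
qed

lemma distr_lborel_reflect:
  fixes i :: "'a::euclidean_space"
  assumes i: "i \<in> Basis"
  defines "T \<equiv> (\<lambda>x::'a. \<Sum>b\<in>Basis. ((if b = i then - 1 else 1) * (x \<bullet> b)) *\<^sub>R b)"
  shows "distr lborel borel T = lborel"
  using lborel_affine_euclidean[where c="\<lambda>b. if b = i then - 1 else 1" and t="0 :: 'a"]
  by (simp add: T_def density_1 if_distrib[of abs] cong: if_cong)

text \<open>Reflecting one coordinate changes the sign of every mixed moment containing it once, so
  mixed moments vanish; swapping two coordinates shows that all pure second moments agree.\<close>

lemma radial_second_moment:
  fixes a :: "'a::euclidean_space \<Rightarrow> real"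
  assumes [measurable]: "a \<in> borel_measurable borel"
    and rad: "\<And>x y. norm x = norm y \<Longrightarrow> a x = a y"
    and i2: "\<And>u v. integrable lborel (\<lambda>h. a h * (h \<bullet> u) * (h \<bullet> v))"
    and e: "e \<in> Basis"
  shows "(\<integral>h. a h * (h \<bullet> u) * (h \<bullet> v) \<partial>lborel) = (\<integral>h. a h * (h \<bullet> e)\<^sup>2 \<partial>lborel) * (u \<bullet> v)"
proof -
  have norm_eqI: "norm x = norm y" if "(\<Sum>b\<in>Basis. (x \<bullet> b)\<^sup>2) = (\<Sum>b\<in>Basis. (y \<bullet> b)\<^sup>2)" for x y :: 'a
    using that by (simp add: norm_eq_sqrt_inner euclidean_inner[of x x] euclidean_inner[of y y] power2_eq_square)
  have off: "(\<integral>h. a h * (h \<bullet> i) * (h \<bullet> j) \<partial>lborel) = 0" if ij: "i \<in> Basis" "j \<in> Basis" "i \<noteq> j" for i j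
  proof -
    define T where "T = (\<lambda>x::'a. \<Sum>b\<in>Basis. ((if b = i then - 1 else 1) * (x \<bullet> b)) *\<^sub>R b)"
    have T: "T x \<bullet> b = (if b = i then - 1 else 1) * (x \<bullet> b)" if "b \<in> Basis" for x b using that by (simp add: T_def)
    have [measurable]: "T \<in> borel_measurable borel" unfolding T_def by measurable
    have n: "norm (T x) = norm x" for x by (rule norm_eqI) (auto intro!: sum.cong simp: T)
    have "(\<integral>h. a h * (h \<bullet> i) * (h \<bullet> j) \<partial>lborel) = (\<integral>h. a h * (h \<bullet> i) * (h \<bullet> j) \<partial>distr lborel borel T)"
      using distr_lborel_reflect[OF ij(1)] by (simp add: T_def)
    also have "\<dots> = (\<integral>h. a (T h) * (T h \<bullet> i) * (T h \<bullet> j) \<partial>lborel)" by (rule integral_distr) auto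
    also have "\<dots> = (\<integral>h. - (a h * (h \<bullet> i) * (h \<bullet> j)) \<partial>lborel)"
      using ij by (intro Bochner_Integration.integral_cong) (auto simp: T rad[OF n])
    also have "\<dots> = - (\<integral>h. a h * (h \<bullet> i) * (h \<bullet> j) \<partial>lborel)" by simp
    finally show ?thesis by simp
  qed
  have diag: "(\<integral>h. a h * (h \<bullet> i) * (h \<bullet> i) \<partial>lborel) = (\<integral>h. a h * (h \<bullet> e)\<^sup>2 \<partial>lborel)" if i: "i \<in> Basis" for i
  proof -
    define T where "T = (\<lambda>x::'a. \<Sum>b\<in>Basis. (x \<bullet> Transposition.transpose i e b) *\<^sub>R b)"
    have T: "T x \<bullet> b = x \<bullet> Transposition.transpose i e b" if "b \<in> Basis" for x b using that by (simp add: T_def)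
    have [measurable]: "T \<in> borel_measurable borel" unfolding T_def by measurable
    have bij: "bij_betw (Transposition.transpose i e) Basis Basis"
      by (rule bij_betwI[where g="Transposition.transpose i e"]) (use i e in \<open>auto simp: Transposition.transpose_def\<close>)
    have n: "norm (T x) = norm x" for x
      by (rule norm_eqI) (simp add: T sum.reindex_bij_betw[OF bij, of "\<lambda>b. (x \<bullet> b)\<^sup>2"])
    have "(\<integral>h. a h * (h \<bullet> i) * (h \<bullet> i) \<partial>lborel) = (\<integral>h. a h * (h \<bullet> i) * (h \<bullet> i) \<partial>distr lborel borel T)"
      using distr_lborel_swap[OF i e] by (simp add: T_def)
    also have "\<dots> = (\<integral>h. a (T h) * (T h \<bullet> i) * (T h \<bullet> i) \<partial>lborel)" by (rule integral_distr) auto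
    also have "\<dots> = (\<integral>h. a h * (h \<bullet> e)\<^sup>2 \<partial>lborel)"
      using i by (intro Bochner_Integration.integral_cong) (auto simp: T rad[OF n] power2_eq_square)
    finally show ?thesis .
  qed
  have "(\<integral>h. a h * (h \<bullet> u) * (h \<bullet> v) \<partial>lborel) =
     (\<integral>h. (\<Sum>i\<in>Basis. \<Sum>j\<in>Basis. (u \<bullet> i) * (v \<bullet> j) * (a h * (h \<bullet> i) * (h \<bullet> j))) \<partial>lborel)"
    by (intro Bochner_Integration.integral_cong refl, subst (1 2) euclidean_inner)
       (simp add: sum_product sum_distrib_left mult_ac)
  also have "\<dots> = (\<Sum>i\<in>Basis. \<Sum>j\<in>Basis. (u \<bullet> i) * (v \<bullet> j) * (\<integral>h. a h * (h \<bullet> i) * (h \<bullet> j) \<partial>lborel))"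
    using i2 by (simp add: Bochner_Integration.integral_sum)
  also have "\<dots> = (\<Sum>i\<in>Basis. (u \<bullet> i) * (v \<bullet> i) * (\<integral>h. a h * (h \<bullet> e)\<^sup>2 \<partial>lborel))"
  proof (rule sum.cong[OF refl])
    fix i :: 'a assume i: "i \<in> Basis"
    have "(\<Sum>j\<in>Basis. (u \<bullet> i) * (v \<bullet> j) * (\<integral>h. a h * (h \<bullet> i) * (h \<bullet> j) \<partial>lborel)) =
      (\<Sum>j\<in>Basis. if j = i then (u \<bullet> i) * (v \<bullet> i) * (\<integral>h. a h * (h \<bullet> e)\<^sup>2 \<partial>lborel) else 0)"
      using off diag i by (intro sum.cong) auto
    also have "\<dots> = (u \<bullet> i) * (v \<bullet> i) * (\<integral>h. a h * (h \<bullet> e)\<^sup>2 \<partial>lborel)" using i by simp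
    finally show "(\<Sum>j\<in>Basis. (u \<bullet> i) * (v \<bullet> j) * (\<integral>h. a h * (h \<bullet> i) * (h \<bullet> j) \<partial>lborel)) = \<dots>" .
  qed
  also have "\<dots> = (\<integral>h. a h * (h \<bullet> e)\<^sup>2 \<partial>lborel) * (u \<bullet> v)"
    by (subst euclidean_inner[of u v]) (simp add: sum_distrib_left sum_distrib_right mult_ac)
  finally show ?thesis .
qed

section \<open>Gradients as limits of difference quotients\<close>

lemma pred_cball [measurable (raw)]:
  fixes f :: "'b \<Rightarrow> 'a::euclidean_space"
  shows "f \<in> borel_measurable M \<Longrightarrow> Measurable.pred M (\<lambda>x. f x \<in> cball c r)"
  unfolding mem_cball by measurable

lemma pred_ball [measurable (raw)]:
  fixes f :: "'b \<Rightarrow> 'a::euclidean_space"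
  shows "f \<in> borel_measurable M \<Longrightarrow> Measurable.pred M (\<lambda>x. f x \<in> ball c r)"
  unfolding mem_ball by measurable

lemma frechet_derivative_eq_grad:
  fixes u :: "'a::euclidean_space \<Rightarrow> real"
  assumes "u differentiable (at x)"
  shows "frechet_derivative u (at x) h = grad u x \<bullet> h"
proof -
  let ?D = "frechet_derivative u (at x)"
  have D: "(u has_derivative ?D) (at x)" using assms frechet_derivative_works by blast
  interpret D: linear ?D using D by (rule has_derivative_linear)
  show ?thesis
  proof -
    have "?D h = ?D (\<Sum>b\<in>Basis. (h \<bullet> b) *\<^sub>R b)" by (simp add: euclidean_representation)
    also have "\<dots> = (\<Sum>b\<in>Basis. (h \<bullet> b) * ?D b)" by (simp add: D.sum D.scaleR)
    also have "\<dots> = grad u x \<bullet> h" unfolding grad_def inner_sum_left inner_scaleR_left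
      by (intro sum.cong refl) (simp add: inner_commute mult.commute)
    finally show ?thesis .
  qed
qed

lemma difference_quotient_tendsto_grad:
  fixes u :: "'a::euclidean_space \<Rightarrow> real"
  assumes u: "u differentiable (at x)" and t: "t \<longlonglongrightarrow> 0" "\<And>n. 0 < t n"
  shows "(\<lambda>n. (u (x + t n *\<^sub>R h) - u x) / t n) \<longlonglongrightarrow> grad u x \<bullet> h"
proof -
  let ?D = "frechet_derivative u (at x)"
  have D: "(u has_derivative ?D) (at x)" using u frechet_derivative_works by blast
  interpret D: linear ?D using D by (rule has_derivative_linear)
  have "((\<lambda>s. u (x + s *\<^sub>R h)) has_derivative (\<lambda>s. ?D (s *\<^sub>R h))) (at 0)"
    by (rule has_derivative_compose[where g=u and f="\<lambda>s. x + s *\<^sub>R h"])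
       (auto intro!: derivative_eq_intros simp: D)
  moreover have "(\<lambda>s. ?D (s *\<^sub>R h)) = (*) (?D h)" by (rule ext) (simp add: D.scaleR)
  ultimately have "((\<lambda>s. u (x + s *\<^sub>R h)) has_field_derivative ?D h) (at 0)"
    by (simp add: has_field_derivative_def)
  then have "((\<lambda>s. (u (x + s *\<^sub>R h) - u x) / s) \<longlongrightarrow> ?D h) (at 0)"
    by (simp add: has_field_derivative_iff)
  moreover have "filterlim t (at 0) sequentially"
    using t by (auto simp: filterlim_at intro!: always_eventually) (metis less_irrefl)
  ultimately show ?thesis unfolding frechet_derivative_eq_grad[OF u] by (rule filterlim_compose)
qed

lemma integrable_indicator_cball: "integrable lborel (indicat_real (cball (0::'a::euclidean_space) R))"
  using emeasure_bounded_finite[OF bounded_cball, of "0::'a" R] by (subst integrable_indicator_iff) auto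

lemma differentiable_imp_borel_measurable:
  fixes f :: "'a::euclidean_space \<Rightarrow> real"
  assumes "\<And>x. f differentiable (at x)"
  shows "f \<in> borel_measurable borel"
  using assms by (intro borel_measurable_continuous_onI differentiable_imp_continuous_on)
    (auto simp: differentiable_on_def intro: differentiable_at_withinI)

section \<open>The rescaled form of a fixed configuration\<close>

text \<open>For one configuration \<gamma>: \<rho> is the positive part of r(.,\<gamma>), and
  \<open>f\<close>, \<open>g\<close> are smooth versions of the maps x to F(\<gamma> with x) and
  G(\<gamma> with x). Far out \<open>f\<close> is constant but not zero, since \<gamma> itself
  contributes; only increments vanish there. The ball of radius S + 2R + 2 contains both ends of
  every jump starting within S + R.\<close>

locale nonlocal_form =
  fixes a :: "'a::euclidean_space \<Rightarrow> real" and \<rho> f g :: "'a \<Rightarrow> real"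
    and A R K S :: real
  assumes a_meas[measurable]: "a \<in> borel_measurable borel"
    and a_bound: "\<And>x. 0 \<le> a x" "\<And>x. a x \<le> A" "\<And>x. R < norm x \<Longrightarrow> a x = 0"
    and a_radial: "\<And>x y. norm x = norm y \<Longrightarrow> a x = a y"
    and \<rho>_meas[measurable]: "\<rho> \<in> borel_measurable borel"
    and \<rho>_nonneg: "\<And>x. 0 \<le> \<rho> x"
    and \<rho>_int: "integrable lborel (\<lambda>x. indicator (ball 0 (S + 2 * R + 2)) x * \<rho> x)"
    and f_diff: "\<And>x. f differentiable (at x)" and g_diff: "\<And>x. g differentiable (at x)"
    and f_lip: "\<And>x y. \<bar>f x - f y\<bar> \<le> K * norm (x - y)"
    and g_lip: "\<And>x y. \<bar>g x - g y\<bar> \<le> K * norm (x - y)"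
    and f_supp: "\<And>x y. S \<le> norm x \<Longrightarrow> S \<le> norm y \<Longrightarrow> f x = f y"
    and R: "0 < R" and K: "0 \<le> K" and S: "0 \<le> S"
begin

abbreviation "lborel2 \<equiv> (lborel :: 'a measure) \<Otimes>\<^sub>M (lborel :: 'a measure)"

text \<open>A jump of length at most \<open>R\<close> that changes \<open>f\<close> starts in the ball of radius \<open>S + R\<close>, so only
  the truncation \<open>\<sigma>\<close> of \<open>\<rho>\<close> enters.\<close>

definition "\<sigma> x = indicator (ball 0 (S + 2 * R + 2)) x * \<rho> x"
text \<open>\<open>A\<close> bounds the kernel, and K R bounds a difference quotient along a
  direction of length at most R; two quotients are multiplied.\<close>

definition "C0 = A * K\<^sup>2 * R\<^sup>2"
definition "incr t x h = ((f (x + t *\<^sub>R h) - f x) / t) * ((g (x + t *\<^sub>R h) - g x) / t)"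
text \<open>The integrand of the form after y = x + t h. In \<open>\<Phi>1\<close> the intensity is
  frozen at \<open>x\<close>, and \<open>\<Psi>\<close> is the pointwise limit of
  \<open>\<Phi>1\<close>. The jump comes first in the pair because estimates are made in
  \<open>x\<close> for a fixed jump.\<close>

definition "\<Phi> t = (\<lambda>(h, x). a h * (sqrt (\<rho> x) * sqrt (\<rho> (x + t *\<^sub>R h))) * incr t x h)"
definition "\<Phi>1 t = (\<lambda>(h, x). a h * \<rho> x * incr t x h)"
definition "\<Psi> = (\<lambda>(h, x). a h * \<rho> x * ((grad f x \<bullet> h) * (grad g x \<bullet> h)))"

lemma f_meas[measurable]: "f \<in> borel_measurable borel"
  by (rule differentiable_imp_borel_measurable[OF f_diff])

lemma g_meas[measurable]: "g \<in> borel_measurable borel"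
  by (rule differentiable_imp_borel_measurable[OF g_diff])

lemma A_nonneg: "0 \<le> A" using a_bound(1,2) order_trans by blast

lemma C0_nonneg: "0 \<le> C0" unfolding C0_def using A_nonneg by simp

lemma \<sigma>_nonneg: "0 \<le> \<sigma> x" unfolding \<sigma>_def using \<rho>_nonneg by simp

lemma \<sigma>_int: "integrable lborel \<sigma>" unfolding \<sigma>_def using \<rho>_int .

lemma \<sigma>_meas[measurable]: "\<sigma> \<in> borel_measurable borel" using \<sigma>_int by auto

lemma incr_measurable[measurable]: "(\<lambda>(h, x). incr t x h) \<in> borel_measurable lborel2"
  unfolding incr_def by measurable

lemma \<Phi>_measurable[measurable]: "\<Phi> t \<in> borel_measurable lborel2"
  unfolding \<Phi>_def incr_def by measurable

lemma \<Phi>1_measurable[measurable]: "\<Phi>1 t \<in> borel_measurable lborel2"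
  unfolding \<Phi>1_def incr_def by measurable

lemma incr_bound:
  assumes "norm h \<le> R" "0 < t"
  shows "\<bar>incr t x h\<bar> \<le> K\<^sup>2 * R\<^sup>2"
proof -
  have *: "\<bar>(u (x + t *\<^sub>R h) - u x) / t\<bar> \<le> K * R" if "\<And>x y. \<bar>u x - u y\<bar> \<le> K * norm (x - y)" for u :: "'a \<Rightarrow> real"
  proof -
    have "\<bar>u (x + t *\<^sub>R h) - u x\<bar> \<le> K * norm (x + t *\<^sub>R h - x)" by (rule that)
    also have "\<dots> = t * (K * norm h)" using assms by simp
    also have "\<dots> \<le> t * (K * R)" using assms K by (intro mult_left_mono) auto
    finally show ?thesis using assms by (simp add: abs_divide divide_le_eq mult.commute)
  qed
  have "\<bar>incr t x h\<bar> = \<bar>(f (x + t *\<^sub>R h) - f x) / t\<bar> * \<bar>(g (x + t *\<^sub>R h) - g x) / t\<bar>"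
    unfolding incr_def abs_mult ..
  also have "\<dots> \<le> (K * R) * (K * R)"
    using *[of f, OF f_lip] *[of g, OF g_lip] by (intro mult_mono) (use K R in auto)
  finally show ?thesis by (simp add: power2_eq_square mult_ac)
qed

text \<open>Both ends of such a jump have norm at least S, where \<open>f\<close> is constant. One
  vanishing factor is enough, which is why constancy is asked of \<open>f\<close> alone.\<close>

lemma incr_zero:
  assumes "norm h \<le> R" "0 < t" "t \<le> 1" "S + R \<le> norm x"
  shows "incr t x h = 0"
proof -
  have "norm (t *\<^sub>R h) \<le> R"
  proof -
    have "norm (t *\<^sub>R h) = t * norm h" using assms by simp
    also have "\<dots> \<le> 1 * R" using assms R by (intro mult_mono) auto
    finally show ?thesis by simp
  qed
  moreover have "norm x \<le> norm (x + t *\<^sub>R h) + norm (t *\<^sub>R h)"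
    using norm_triangle_ineq4[of "x + t *\<^sub>R h" "t *\<^sub>R h"] by simp
  ultimately have "f (x + t *\<^sub>R h) = f x" using assms R by (intro f_supp) auto
  then show ?thesis by (simp add: incr_def)
qed

lemma \<sigma>_eq:
  assumes "norm h \<le> R" "0 < t" "t \<le> 1" "norm x < S + R"
  shows "\<sigma> x = \<rho> x" "\<sigma> (x + t *\<^sub>R h) = \<rho> (x + t *\<^sub>R h)"
proof -
  have "norm (x + t *\<^sub>R h) \<le> norm x + norm (t *\<^sub>R h)" by (rule norm_triangle_ineq)
  also have "norm (t *\<^sub>R h) \<le> R"
  proof -
    have "norm (t *\<^sub>R h) = t * norm h" using assms by simp
    also have "\<dots> \<le> 1 * R" using assms R by (intro mult_mono) auto
    finally show ?thesis by simp
  qed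
  finally have "norm (x + t *\<^sub>R h) < S + 2 * R + 2" using assms by simp
  moreover have "norm x < S + 2 * R + 2" using assms R by simp
  ultimately show "\<sigma> x = \<rho> x" "\<sigma> (x + t *\<^sub>R h) = \<rho> (x + t *\<^sub>R h)" by (simp_all add: \<sigma>_def)
qed

lemma a_incr_bound: "0 < t \<Longrightarrow> \<bar>a h * incr t x h\<bar> \<le> C0 * indicator (cball 0 R) h"
proof (cases "norm h \<le> R")
  case True
  assume t: "0 < t"
  have "\<bar>a h * incr t x h\<bar> \<le> A * (K\<^sup>2 * R\<^sup>2)"
    unfolding abs_mult using a_bound(1,2)[of h] incr_bound[OF True t] A_nonneg by (intro mult_mono) auto
  then show ?thesis using True by (simp add: C0_def mult_ac)
next
  case False
  then show ?thesis using a_bound(3)[of h] C0_nonneg by simp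
qed

text \<open>The arithmetic mean replaces the geometric one. Its integral in \<open>x\<close> equals
  that of \<sigma> for every shift, which makes the resulting bound uniform in
  \<open>t\<close>.\<close>

definition "W t = (\<lambda>(h, x). C0 * (indicator (cball 0 R) h * ((\<sigma> x + \<sigma> (x + t *\<^sub>R h)) / 2)))"

text \<open>The jumps range over a ball of finite measure, so an L1 bound on the sections that is
  uniform in the jump suffices.\<close>

lemma integrable_cball_prod:
  fixes q :: "'a \<Rightarrow> 'a \<Rightarrow> real"
  assumes [measurable]: "(\<lambda>(h, x). q h x) \<in> borel_measurable lborel2"
    and q: "\<And>h. integrable lborel (q h)" "\<And>h. (\<integral>x. \<bar>q h x\<bar> \<partial>lborel) \<le> B"
  shows "integrable lborel2 (\<lambda>(h, x). indicator (cball (0::'a) R) h * q h x)"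
proof (rule lborel_pair.Fubini_integrable)
  show "(\<lambda>(h, x). indicator (cball (0::'a) R) h * q h x) \<in> borel_measurable lborel2"
    by measurable
  show "integrable lborel (\<lambda>h. \<integral>x. norm (case (h, x) of (h, x) \<Rightarrow> indicator (cball (0::'a) R) h * q h x) \<partial>lborel)"
  proof (rule Bochner_Integration.integrable_bound)
    show "integrable lborel (\<lambda>h. B * indicator (cball (0::'a) R) h)"
      by (intro integrable_mult_right integrable_indicator_cball)
    show "(\<lambda>h. \<integral>x. norm (case (h, x) of (h, x) \<Rightarrow> indicator (cball (0::'a) R) h * q h x) \<partial>lborel) \<in> borel_measurable lborel"
      by measurable
    show "AE h in lborel. norm (\<integral>x. norm (case (h, x) of (h, x) \<Rightarrow> indicator (cball (0::'a) R) h * q h x) \<partial>lborel)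
        \<le> norm (B * indicator (cball (0::'a) R) h)"
    proof (rule AE_I2)
      fix h :: 'a
      have "0 \<le> (\<integral>x. \<bar>q h x\<bar> \<partial>lborel)" by simp
      then have "0 \<le> B" using q(2)[of h] by linarith
      then show "norm (\<integral>x. norm (case (h, x) of (h, x) \<Rightarrow> indicator (cball (0::'a) R) h * q h x) \<partial>lborel)
        \<le> norm (B * indicator (cball (0::'a) R) h)"
        using q(2)[of h] by (simp add: abs_mult indicator_def)
    qed
  qed
  show "AE h in lborel. integrable lborel (\<lambda>x. case (h, x) of (h, x) \<Rightarrow> indicator (cball (0::'a) R) h * q h x)"
    using q(1) by simp
qed

lemma \<sigma>_avg:
  "integrable lborel (\<lambda>x. (\<sigma> x + \<sigma> (x + y)) / 2)"
  "(\<integral>x. \<bar>(\<sigma> x + \<sigma> (x + y)) / 2\<bar> \<partial>lborel) = (\<integral>x. \<sigma> x \<partial>lborel)"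
  "(\<integral>x. (\<sigma> x + \<sigma> (x + y)) / 2 \<partial>lborel) = (\<integral>x. \<sigma> x \<partial>lborel)"
proof -
  note i = \<sigma>_int integrable_lborel_translate[OF \<sigma>_int, of y]
  show "integrable lborel (\<lambda>x. (\<sigma> x + \<sigma> (x + y)) / 2)" using i by simp
  have "(\<integral>x. (\<sigma> x + \<sigma> (x + y)) / 2 \<partial>lborel) = ((\<integral>x. \<sigma> x \<partial>lborel) + (\<integral>x. \<sigma> (x + y) \<partial>lborel)) / 2"
    using i by simp
  also have "(\<integral>x. \<sigma> (x + y) \<partial>lborel) = (\<integral>x. \<sigma> x \<partial>lborel)" by (rule integral_lborel_translate) simp
  finally show 1: "(\<integral>x. (\<sigma> x + \<sigma> (x + y)) / 2 \<partial>lborel) = (\<integral>x. \<sigma> x \<partial>lborel)" by simp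
  then show "(\<integral>x. \<bar>(\<sigma> x + \<sigma> (x + y)) / 2\<bar> \<partial>lborel) = (\<integral>x. \<sigma> x \<partial>lborel)"
    using \<sigma>_nonneg by (simp add: abs_of_nonneg)
qed

lemma W_int: "integrable lborel2 (W t)"
proof -
  have "integrable lborel2 (\<lambda>(h, x). indicator (cball (0::'a) R) h * ((\<sigma> x + \<sigma> (x + t *\<^sub>R h)) / 2))"
    by (rule integrable_cball_prod[where B="\<integral>x. \<sigma> x \<partial>lborel"]) (use \<sigma>_avg in simp_all)
  from integrable_mult_right[OF this, of C0] show ?thesis by (simp add: W_def split_beta')
qed

lemma W_integral: "integral\<^sup>L lborel2 (W t) = C0 * measure lborel (cball (0::'a) R) * (\<integral>x. \<sigma> x \<partial>lborel)"
proof -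
  have "integral\<^sup>L lborel2 (W t) = (\<integral>h. \<integral>x. W t (h, x) \<partial>lborel \<partial>lborel)"
    by (rule lborel_pair.integral_fst'[OF W_int, symmetric])
  also have "\<dots> = (\<integral>h. C0 * (\<integral>x. \<sigma> x \<partial>lborel) * indicator (cball (0::'a) R) h \<partial>lborel)"
    unfolding W_def prod.case integral_mult_right_zero \<sigma>_avg(3) by (simp add: mult_ac)
  also have "\<dots> = C0 * measure lborel (cball (0::'a) R) * (\<integral>x. \<sigma> x \<partial>lborel)" by simp
  finally show ?thesis .
qed

lemma \<Phi>_bound:
  assumes t: "0 < t" "t \<le> 1"
  shows "\<bar>\<Phi> t p\<bar> \<le> W t p"
proof -
  obtain h x where p: "p = (h, x)" by (cases p)
  show ?thesis
  proof (cases "norm h \<le> R \<and> norm x < S + R")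
    case True
    have "\<bar>\<Phi> t p\<bar> = \<bar>a h * incr t x h\<bar> * (sqrt (\<sigma> x) * sqrt (\<sigma> (x + t *\<^sub>R h)))"
      using \<sigma>_eq[OF _ t, of h x] True \<rho>_nonneg by (simp add: p \<Phi>_def abs_mult)
    also have "\<dots> \<le> (C0 * indicator (cball 0 R) h) * ((\<sigma> x + \<sigma> (x + t *\<^sub>R h)) / 2)"
      using a_incr_bound[OF t(1)] \<sigma>_nonneg C0_nonneg arith_geo_mean_sqrt[of "\<sigma> x" "\<sigma> (x + t *\<^sub>R h)"]
      by (intro mult_mono) (auto simp: real_sqrt_mult)
    finally show ?thesis by (simp add: W_def p)
  next
    case False
    then have "a h = 0 \<or> incr t x h = 0" using a_bound(3)[of h] incr_zero[OF _ t, of h x] by force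
    then have "\<Phi> t p = 0" by (auto simp: \<Phi>_def p)
    then show ?thesis using C0_nonneg \<sigma>_nonneg by (simp add: W_def p)
  qed
qed

lemma \<Phi>_int: "0 < t \<Longrightarrow> t \<le> 1 \<Longrightarrow> integrable lborel2 (\<Phi> t)"
  by (rule Bochner_Integration.integrable_bound[OF W_int[of t]])
     (use \<Phi>_bound[of t] in \<open>auto intro!: AE_I2 intro: order_trans[OF _ abs_ge_self]\<close>)

lemma \<Phi>_integral_bound:
  assumes t: "0 < t" "t \<le> 1"
  shows "\<bar>integral\<^sup>L lborel2 (\<Phi> t)\<bar> \<le> C0 * measure lborel (cball (0::'a) R) * (\<integral>x. \<sigma> x \<partial>lborel)"
proof -
  have "\<bar>integral\<^sup>L lborel2 (\<Phi> t)\<bar> \<le> (\<integral>p. \<bar>\<Phi> t p\<bar> \<partial>lborel2)"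
    using integral_norm_bound[of "lborel2" "\<Phi> t"] by simp
  also have "\<dots> \<le> integral\<^sup>L lborel2 (W t)"
    by (rule integral_mono) (use \<Phi>_int[OF t] W_int \<Phi>_bound[OF t] in auto)
  finally show ?thesis unfolding W_integral .
qed

lemma incr_tendsto:
  assumes t: "t \<longlonglongrightarrow> 0" "\<And>n. 0 < t n"
  shows "(\<lambda>n. incr (t n) x h) \<longlonglongrightarrow> (grad f x \<bullet> h) * (grad g x \<bullet> h)"
proof -
  show ?thesis unfolding incr_def by (intro tendsto_mult difference_quotient_tendsto_grad f_diff g_diff t)
qed

text \<open>With the intensity frozen at \<open>x\<close>, the integrands have a common dominating
  function, C0 times \<sigma>(x) on the ball of jumps. Integrability of the limit comes from the
  same domination.\<close>

lemma \<Phi>1_tendsto: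
  assumes t: "t \<longlonglongrightarrow> 0" "\<And>n. 0 < t n" "\<And>n. t n \<le> 1"
  shows "(\<lambda>n. integral\<^sup>L lborel2 (\<Phi>1 (t n))) \<longlonglongrightarrow> integral\<^sup>L lborel2 \<Psi>"
    and \<Psi>_int: "integrable lborel2 \<Psi>"
    and \<Phi>1_int: "\<And>n. integrable lborel2 (\<Phi>1 (t n))"
proof -
  have lim: "(\<lambda>n. \<Phi>1 (t n) p) \<longlonglongrightarrow> \<Psi> p" for p
    unfolding \<Phi>1_def \<Psi>_def split_beta' by (intro tendsto_mult tendsto_const incr_tendsto t)
  have \<Psi>m: "\<Psi> \<in> borel_measurable lborel2"
    by (rule borel_measurable_LIMSEQ_real[OF lim]) measurable
  have w: "integrable lborel2 (\<lambda>(h, x). C0 * (indicator (cball (0::'a) R) h * \<sigma> x))"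
  proof -
    have "integrable lborel2 (\<lambda>(h, x). indicator (cball (0::'a) R) h * \<sigma> x)"
      by (rule integrable_cball_prod[where B="\<integral>x. \<bar>\<sigma> x\<bar> \<partial>lborel"]) (use \<sigma>_int in simp_all)
    from integrable_mult_right[OF this, of C0] show ?thesis by (simp add: split_beta')
  qed
  have b: "norm (\<Phi>1 (t n) p) \<le> (case p of (h, x) \<Rightarrow> C0 * (indicator (cball (0::'a) R) h * \<sigma> x))" for n p
  proof -
    obtain h x where p: "p = (h, x)" by (cases p)
    show ?thesis
    proof (cases "norm h \<le> R \<and> norm x < S + R")
      case True
      have "\<bar>\<Phi>1 (t n) p\<bar> = \<bar>a h * incr (t n) x h\<bar> * \<sigma> x"
        using \<sigma>_eq[OF _ t(2,3), of h x] True \<rho>_nonneg by (simp add: p \<Phi>1_def abs_mult)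
      also have "\<dots> \<le> (C0 * indicator (cball 0 R) h) * \<sigma> x"
        using a_incr_bound[OF t(2)] \<sigma>_nonneg by (intro mult_right_mono) auto
      finally show ?thesis by (simp add: p)
    next
      case False
      then have "a h = 0 \<or> incr (t n) x h = 0" using a_bound(3)[of h] incr_zero[OF _ t(2,3), of h x] by force
      then have "\<Phi>1 (t n) p = 0" by (auto simp: \<Phi>1_def p)
      then show ?thesis using C0_nonneg \<sigma>_nonneg by (simp add: p)
    qed
  qed
  show "(\<lambda>n. integral\<^sup>L lborel2 (\<Phi>1 (t n))) \<longlonglongrightarrow> integral\<^sup>L lborel2 \<Psi>"
    by (rule integral_dominated_convergence[OF \<Psi>m _ w]) (use lim b in auto)
  show "integrable lborel2 \<Psi>"
    by (rule integrable_dominated_convergence[OF \<Psi>m _ w, of "\<lambda>n. \<Phi>1 (t n)"]) (use lim b in auto)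
  show "integrable lborel2 (\<Phi>1 (t n))" for n
    by (rule integrable_dominated_convergence2[OF \<Psi>m _ w, of "\<lambda>n. \<Phi>1 (t n)"]) (use lim b in auto)
qed

text \<open>Up to constants and the free parameter, the price of freezing the intensity, that is, of
  passing from \<open>\<Phi>\<close> to \<open>\<Phi>1\<close>.\<close>

definition "shift_err t = (\<integral>h. indicator (cball 0 R) h * (\<integral>x. \<bar>\<sigma> (x + t *\<^sub>R h) - \<sigma> x\<bar> \<partial>lborel) \<partial>lborel)"

lemma shift_int: "integrable lborel (\<lambda>x. \<bar>\<sigma> (x + y) - \<sigma> x\<bar>)" "(\<integral>x. \<bar>\<bar>\<sigma> (x + y) - \<sigma> x\<bar>\<bar> \<partial>lborel) \<le> 2 * (\<integral>x. \<sigma> x \<partial>lborel)"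
proof -
  note i = \<sigma>_int integrable_lborel_translate[OF \<sigma>_int, of y]
  show "integrable lborel (\<lambda>x. \<bar>\<sigma> (x + y) - \<sigma> x\<bar>)" using i by simp
  have "(\<integral>x. \<bar>\<bar>\<sigma> (x + y) - \<sigma> x\<bar>\<bar> \<partial>lborel) \<le> (\<integral>x. 2 * ((\<sigma> x + \<sigma> (x + y)) / 2) \<partial>lborel)"
  proof (rule integral_mono)
    show "\<bar>\<bar>\<sigma> (x + y) - \<sigma> x\<bar>\<bar> \<le> 2 * ((\<sigma> x + \<sigma> (x + y)) / 2)" for x
    proof -
      have "\<bar>\<sigma> (x + y) - \<sigma> x\<bar> \<le> \<sigma> x + \<sigma> (x + y)"
        using \<sigma>_nonneg[of x] \<sigma>_nonneg[of "x + y"] by linarith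
      then show ?thesis by simp
    qed
  qed (use i in auto)
  also have "\<dots> = 2 * (\<integral>x. \<sigma> x \<partial>lborel)" by (subst integral_mult_right_zero) (simp only: \<sigma>_avg(3))
  finally show "(\<integral>x. \<bar>\<bar>\<sigma> (x + y) - \<sigma> x\<bar>\<bar> \<partial>lborel) \<le> 2 * (\<integral>x. \<sigma> x \<partial>lborel)" .
qed

lemma shift_err_tendsto:
  assumes t: "t \<longlonglongrightarrow> 0"
  shows "(\<lambda>n. shift_err (t n)) \<longlonglongrightarrow> 0"
proof -
  have "(\<lambda>n. shift_err (t n)) \<longlonglongrightarrow> (\<integral>h. 0 \<partial>(lborel :: 'a measure))"
    unfolding shift_err_def
  proof (rule integral_dominated_convergence[where w="\<lambda>h. 2 * (\<integral>x. \<sigma> x \<partial>lborel) * indicator (cball 0 R) h"])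
    show "integrable lborel (\<lambda>h::'a. 2 * (\<integral>x. \<sigma> x \<partial>lborel) * indicator (cball 0 R) h)"
      by (intro integrable_mult_right integrable_indicator_cball)
    show "AE h in lborel. (\<lambda>n. indicator (cball 0 R) h * (\<integral>x. \<bar>\<sigma> (x + t n *\<^sub>R h) - \<sigma> x\<bar> \<partial>lborel)) \<longlonglongrightarrow> 0"
    proof (rule AE_I2)
      fix h :: 'a
      have "(\<lambda>n. t n *\<^sub>R h) \<longlonglongrightarrow> 0 *\<^sub>R h" by (intro tendsto_intros t)
      then have "(\<lambda>n. \<integral>x. \<bar>\<sigma> (x + t n *\<^sub>R h) - \<sigma> x\<bar> \<partial>lborel) \<longlonglongrightarrow> 0"
        by (intro translation_continuity_L1[OF \<sigma>_int]) simp
      from tendsto_mult_left[OF this, of "indicator (cball 0 R) h"]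
      show "(\<lambda>n. indicator (cball 0 R) h * (\<integral>x. \<bar>\<sigma> (x + t n *\<^sub>R h) - \<sigma> x\<bar> \<partial>lborel)) \<longlonglongrightarrow> 0" by simp
    qed
    show "AE h in lborel. norm (indicator (cball 0 R) h * (\<integral>x. \<bar>\<sigma> (x + t n *\<^sub>R h) - \<sigma> x\<bar> \<partial>lborel))
       \<le> 2 * (\<integral>x. \<sigma> x \<partial>lborel) * indicator (cball 0 R) h" for n
      using shift_int(2) by (auto intro!: AE_I2 simp: indicator_def)
    show "(\<lambda>h. indicator (cball 0 R) h * (\<integral>x. \<bar>\<sigma> (x + t n *\<^sub>R h) - \<sigma> x\<bar> \<partial>lborel)) \<in> borel_measurable lborel" for n
      by measurable
  qed simp
  then show ?thesis by simp
qed

text \<open>With p, q the roots of x, y the left side is p \<bar>q - p\<bar>. Young's inequality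
  with weight d splits this product, and the square of q - p is at most \<bar>y - x\<bar>.
  L1-closeness of intensities is thus transferred to the geometric mean without dividing by
  x.\<close>

lemma sqrt_diff_le:
  fixes x y d :: real
  assumes "0 \<le> x" "0 \<le> y" "0 < d"
  shows "\<bar>sqrt x * sqrt y - x\<bar> \<le> d * x / 2 + \<bar>y - x\<bar> / (2 * d)"
proof -
  define p q where "p = sqrt x" and "q = sqrt y"
  have pq: "x = p\<^sup>2" "y = q\<^sup>2" "0 \<le> p" "0 \<le> q" using assms by (auto simp: p_def q_def)
  have "\<bar>p * q - p\<^sup>2\<bar> = p * \<bar>q - p\<bar>" using pq by (simp add: power2_eq_square abs_mult flip: right_diff_distrib)
  also have "\<dots> \<le> d * p\<^sup>2 / 2 + (q - p)\<^sup>2 / (2 * d)"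
  proof -
    have "0 \<le> (d * p - \<bar>q - p\<bar>)\<^sup>2" by simp
    then have "2 * d * (p * \<bar>q - p\<bar>) \<le> d\<^sup>2 * p\<^sup>2 + (q - p)\<^sup>2"
      by (simp add: power2_diff power_mult_distrib mult_ac)
    then have "p * \<bar>q - p\<bar> \<le> (d\<^sup>2 * p\<^sup>2 + (q - p)\<^sup>2) / (2 * d)"
      using assms(3) by (simp add: le_divide_eq mult_ac)
    also have "\<dots> = d * p\<^sup>2 / 2 + (q - p)\<^sup>2 / (2 * d)" using assms(3) by (simp add: field_simps power2_eq_square)
    finally show ?thesis .
  qed
  finally have 1: "\<bar>p * q - p\<^sup>2\<bar> \<le> d * p\<^sup>2 / 2 + (q - p)\<^sup>2 / (2 * d)" .
  have 2: "(q - p)\<^sup>2 / (2 * d) \<le> \<bar>q\<^sup>2 - p\<^sup>2\<bar> / (2 * d)"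
  proof (intro divide_right_mono)
    have "(q - p)\<^sup>2 = \<bar>q - p\<bar> * \<bar>q - p\<bar>" by (simp add: power2_eq_square)
    also have "\<dots> \<le> \<bar>q - p\<bar> * (q + p)" using pq by (intro mult_left_mono) auto
    also have "\<dots> = \<bar>(q - p) * (q + p)\<bar>" using pq by (simp add: abs_mult)
    also have "(q - p) * (q + p) = q\<^sup>2 - p\<^sup>2" by (simp add: power2_eq_square algebra_simps)
    finally show "(q - p)\<^sup>2 \<le> \<bar>q\<^sup>2 - p\<^sup>2\<bar>" .
  qed (use assms in simp)
  have "\<bar>p * q - p\<^sup>2\<bar> \<le> d * p\<^sup>2 / 2 + \<bar>q\<^sup>2 - p\<^sup>2\<bar> / (2 * d)" using 1 2 by linarith
  then show ?thesis using assms(1,2) unfolding p_def q_def by simp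
qed

text \<open>The free parameter \<open>d\<close> replaces the Cauchy--Schwarz inequality; it is later sent to 0 more slowly
  than the square root of the shift error.\<close>

lemma \<Phi>_diff_bound:
  assumes t: "0 < t" "t \<le> 1" and d: "0 < d" and i1: "integrable lborel2 (\<Phi>1 t)"
  shows "\<bar>integral\<^sup>L lborel2 (\<Phi> t) - integral\<^sup>L lborel2 (\<Phi>1 t)\<bar> \<le>
     C0 * (d / 2 * (measure lborel (cball (0::'a) R) * (\<integral>x. \<sigma> x \<partial>lborel)) + shift_err t / (2 * d))"
proof -
  let ?V = "\<lambda>(h, x). C0 * (d / 2 * (indicator (cball (0::'a) R) h * \<sigma> x) +
       (indicator (cball (0::'a) R) h * \<bar>\<sigma> (x + t *\<^sub>R h) - \<sigma> x\<bar>) / (2 * d))"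
  have v1: "integrable lborel2 (\<lambda>(h, x). indicator (cball (0::'a) R) h * \<sigma> x)"
    by (rule integrable_cball_prod[where B="\<integral>x. \<bar>\<sigma> x\<bar> \<partial>lborel"]) (use \<sigma>_int in simp_all)
  have v2: "integrable lborel2 (\<lambda>(h, x). indicator (cball (0::'a) R) h * \<bar>\<sigma> (x + t *\<^sub>R h) - \<sigma> x\<bar>)"
    by (rule integrable_cball_prod[where B="2 * (\<integral>x. \<sigma> x \<partial>lborel)"]) (use shift_int in simp_all)
  have V: "integrable lborel2 ?V"
    using integrable_mult_right[OF Bochner_Integration.integrable_add[OF integrable_mult_right[OF v1, of "d / 2"]
        integrable_divide[OF v2, of "2 * d"]], of C0]
    by (simp only: split_beta')
  have b: "\<bar>\<Phi> t p - \<Phi>1 t p\<bar> \<le> ?V p" for p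
  proof -
    obtain h x where p: "p = (h, x)" by (cases p)
    show ?thesis
    proof (cases "norm h \<le> R \<and> norm x < S + R")
      case True
      have e: "\<sigma> x = \<rho> x" "\<sigma> (x + t *\<^sub>R h) = \<rho> (x + t *\<^sub>R h)" using \<sigma>_eq[OF _ t, of h x] True by auto
      have "\<Phi> t p - \<Phi>1 t p = (a h * incr t x h) * (sqrt (\<sigma> x) * sqrt (\<sigma> (x + t *\<^sub>R h)) - \<sigma> x)"
        unfolding p \<Phi>_def \<Phi>1_def e by (simp add: algebra_simps)
      then have "\<bar>\<Phi> t p - \<Phi>1 t p\<bar> = \<bar>a h * incr t x h\<bar> * \<bar>sqrt (\<sigma> x) * sqrt (\<sigma> (x + t *\<^sub>R h)) - \<sigma> x\<bar>"
        by (simp add: abs_mult)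
      also have "\<dots> \<le> (C0 * indicator (cball 0 R) h) * (d * \<sigma> x / 2 + \<bar>\<sigma> (x + t *\<^sub>R h) - \<sigma> x\<bar> / (2 * d))"
        using a_incr_bound[OF t(1)] C0_nonneg by (intro mult_mono sqrt_diff_le \<sigma>_nonneg d) auto
      finally show ?thesis using True by (simp add: p algebra_simps)
    next
      case False
      then have "a h = 0 \<or> incr t x h = 0" using a_bound(3)[of h] incr_zero[OF _ t, of h x] by force
      then have "\<Phi> t p - \<Phi>1 t p = 0" by (auto simp: \<Phi>_def \<Phi>1_def p)
      moreover have "0 \<le> ?V p" using C0_nonneg \<sigma>_nonneg d by (auto simp: p intro!: mult_nonneg_nonneg add_nonneg_nonneg)
      ultimately show ?thesis by simp
    qed
  qed
  have "\<bar>integral\<^sup>L lborel2 (\<Phi> t) - integral\<^sup>L lborel2 (\<Phi>1 t)\<bar> =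
     \<bar>\<integral>p. \<Phi> t p - \<Phi>1 t p \<partial>lborel2\<bar>"
    using \<Phi>_int[OF t] i1 by simp
  also have "\<dots> \<le> (\<integral>p. \<bar>\<Phi> t p - \<Phi>1 t p\<bar> \<partial>lborel2)"
    using integral_norm_bound[of "lborel2" "\<lambda>p. \<Phi> t p - \<Phi>1 t p"] by simp
  also have "\<dots> \<le> integral\<^sup>L lborel2 ?V"
    by (rule integral_mono) (use \<Phi>_int[OF t] i1 V b in auto)
  also have "\<dots> = C0 * (d / 2 * integral\<^sup>L lborel2 (\<lambda>(h, x). indicator (cball (0::'a) R) h * \<sigma> x) +
      integral\<^sup>L lborel2 (\<lambda>(h, x). indicator (cball (0::'a) R) h * \<bar>\<sigma> (x + t *\<^sub>R h) - \<sigma> x\<bar>) / (2 * d))"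
    using v1 v2 unfolding split_beta' by simp
  also have "integral\<^sup>L lborel2 (\<lambda>(h, x). indicator (cball (0::'a) R) h * \<sigma> x) = measure lborel (cball (0::'a) R) * (\<integral>x. \<sigma> x \<partial>lborel)"
    by (subst lborel_pair.integral_fst'[OF v1, symmetric]) simp
  also have "integral\<^sup>L lborel2 (\<lambda>(h, x). indicator (cball (0::'a) R) h * \<bar>\<sigma> (x + t *\<^sub>R h) - \<sigma> x\<bar>) = shift_err t"
    unfolding shift_err_def by (subst lborel_pair.integral_fst'[OF v2, symmetric]) simp
  finally show ?thesis .
qed

lemma \<Phi>_tendsto:
  assumes t: "t \<longlonglongrightarrow> 0" "\<And>n. 0 < t n" "\<And>n. t n \<le> 1"
  shows "(\<lambda>n. integral\<^sup>L lborel2 (\<Phi> (t n))) \<longlonglongrightarrow> integral\<^sup>L lborel2 \<Psi>"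
proof -
  define m where "m n = shift_err (t n)" for n
  \<comment> \<open>At least the root of the shift error, so that m / d is at most that root; the
    extra term keeps d positive where the shift error vanishes.\<close>
  define d where "d n = sqrt (m n) + 1 / (real n + 1)" for n
  define B where "B = measure lborel (cball (0::'a) R) * (\<integral>x. \<sigma> x \<partial>lborel)"
  have m0: "0 \<le> m n" for n unfolding m_def shift_err_def by (intro Bochner_Integration.integral_nonneg) (auto simp: indicator_def)
  have m: "m \<longlonglongrightarrow> 0" unfolding m_def by (rule shift_err_tendsto[OF t(1)])
  have "d \<longlonglongrightarrow> sqrt 0 + 0"
    unfolding d_def by (intro tendsto_add tendsto_real_sqrt m) (use lim_inverse_n' LIMSEQ_inverse_real_of_nat in \<open>simp add: inverse_eq_divide add.commute\<close>)
  then have dl: "d \<longlonglongrightarrow> 0" by simp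
  have d0: "0 < d n" for n unfolding d_def using m0[of n] by (intro add_nonneg_pos) auto
  have md: "m n / (2 * d n) \<le> sqrt (m n) / 2" for n
  proof -
    have "m n = sqrt (m n) * sqrt (m n)" using m0[of n] by simp
    also have "\<dots> \<le> sqrt (m n) * d n" using m0[of n] by (intro mult_left_mono) (auto simp: d_def)
    finally show ?thesis using d0[of n] by (simp add: divide_le_eq mult_ac)
  qed
  have diff: "\<bar>integral\<^sup>L lborel2 (\<Phi> (t n)) - integral\<^sup>L lborel2 (\<Phi>1 (t n))\<bar> \<le> C0 * (d n / 2 * B + sqrt (m n) / 2)" for n
  proof -
    have "\<bar>integral\<^sup>L lborel2 (\<Phi> (t n)) - integral\<^sup>L lborel2 (\<Phi>1 (t n))\<bar> \<le> C0 * (d n / 2 * B + m n / (2 * d n))"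
      unfolding B_def m_def by (rule \<Phi>_diff_bound[OF t(2,3) d0 \<Phi>1_int[OF t]])
    also have "\<dots> \<le> C0 * (d n / 2 * B + sqrt (m n) / 2)"
      using md[of n] C0_nonneg by (intro mult_left_mono add_left_mono)
    finally show ?thesis .
  qed
  have "(\<lambda>n. C0 * (d n / 2 * B + sqrt (m n) / 2)) \<longlonglongrightarrow> C0 * (0 / 2 * B + sqrt 0 / 2)"
    by (intro tendsto_intros dl tendsto_real_sqrt m) auto
  then have "(\<lambda>n. C0 * (d n / 2 * B + sqrt (m n) / 2)) \<longlonglongrightarrow> 0" by simp
  then have "(\<lambda>n. integral\<^sup>L lborel2 (\<Phi> (t n)) - integral\<^sup>L lborel2 (\<Phi>1 (t n))) \<longlonglongrightarrow> 0"
  proof (rule Lim_null_comparison[rotated], intro always_eventually allI)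
    fix n
    show "norm (integral\<^sup>L lborel2 (\<Phi> (t n)) - integral\<^sup>L lborel2 (\<Phi>1 (t n))) \<le> C0 * (d n / 2 * B + sqrt (m n) / 2)"
      unfolding real_norm_def by (rule diff)
  qed
  from tendsto_add[OF this \<Phi>1_tendsto(1)[OF t]] show ?thesis by simp
qed

lemma a_moment_int: "integrable lborel (\<lambda>h. a h * (h \<bullet> u) * (h \<bullet> v))"
proof (rule Bochner_Integration.integrable_bound)
  show "integrable lborel (\<lambda>h. (A * (R * norm u) * (R * norm v)) * indicator (cball (0::'a) R) h)"
    by (intro integrable_mult_right integrable_indicator_cball)
  show "AE h in lborel. norm (a h * (h \<bullet> u) * (h \<bullet> v)) \<le> norm ((A * (R * norm u) * (R * norm v)) * indicator (cball (0::'a) R) h)"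
  proof (rule AE_I2)
    fix h :: 'a
    show "norm (a h * (h \<bullet> u) * (h \<bullet> v)) \<le> norm ((A * (R * norm u) * (R * norm v)) * indicator (cball (0::'a) R) h)"
    proof (cases "norm h \<le> R")
      case True
      have *: "\<bar>h \<bullet> w\<bar> \<le> R * norm w" for w
        using Cauchy_Schwarz_ineq2[of h w] True by (meson mult_right_mono norm_ge_zero order_trans)
      have "\<bar>a h\<bar> * \<bar>h \<bullet> u\<bar> * \<bar>h \<bullet> v\<bar> \<le> A * (R * norm u) * (R * norm v)"
        using a_bound(1,2)[of h] A_nonneg R by (intro mult_mono * mult_nonneg_nonneg) auto
      then show ?thesis using True A_nonneg R by (simp add: abs_mult)
    next
      case False
      then show ?thesis using a_bound(3)[of h] by simp
    qed
  qed
qed measurable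

lemma \<Psi>_integral:
  assumes e: "e \<in> Basis"
  shows "integral\<^sup>L lborel2 \<Psi> = (\<integral>h. a h * (h \<bullet> e)\<^sup>2 \<partial>lborel) * (\<integral>x. \<rho> x * (grad f x \<bullet> grad g x) \<partial>lborel)"
proof -
  \<comment> \<open>An arbitrary admissible sequence of scales, used only to obtain integrability of
    \<open>\<Psi>\<close> for Fubini.\<close>
  have t: "(\<lambda>n. 1 / real (Suc n)) \<longlonglongrightarrow> 0" "\<And>n. 0 < 1 / real (Suc n)" "\<And>n. 1 / real (Suc n) \<le> 1"
    using LIMSEQ_inverse_real_of_nat by (simp_all add: inverse_eq_divide)
  have i: "integrable lborel2 (\<lambda>(h, x). \<Psi> (h, x))" using \<Psi>_int[OF t] by simp
  have "integral\<^sup>L lborel2 \<Psi> = (\<integral>x. \<integral>h. \<Psi> (h, x) \<partial>lborel \<partial>lborel)"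
    using lborel_pair.integral_snd[OF i] by simp
  also have "\<dots> = (\<integral>x. (\<integral>h. a h * (h \<bullet> e)\<^sup>2 \<partial>lborel) * (\<rho> x * (grad f x \<bullet> grad g x)) \<partial>lborel)"
  proof (intro Bochner_Integration.integral_cong refl)
    fix x
    have "(\<integral>h. \<Psi> (h, x) \<partial>lborel) = (\<integral>h. \<rho> x * (a h * (h \<bullet> grad f x) * (h \<bullet> grad g x)) \<partial>lborel)"
      by (simp add: \<Psi>_def mult_ac inner_commute)
    also have "\<dots> = \<rho> x * ((\<integral>h. a h * (h \<bullet> e)\<^sup>2 \<partial>lborel) * (grad f x \<bullet> grad g x))"
      using radial_second_moment[OF a_meas a_radial a_moment_int e] by simp
    finally show "(\<integral>h. \<Psi> (h, x) \<partial>lborel) = (\<integral>h. a h * (h \<bullet> e)\<^sup>2 \<partial>lborel) * (\<rho> x * (grad f x \<bullet> grad g x))" by simp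
  qed
  finally show ?thesis by simp
qed

text \<open>Of the d + 2 inverse powers of t in \<open>a_eps\<close>, the Jacobian cancels d, and
  the other two turn the increments into difference quotients. Radiality removes the sign of the
  jump.\<close>

lemma form_eq_\<Phi>_inner:
  assumes t: "0 < t" "t \<le> 1"
  shows "(\<integral>y. a_eps a t (x - y) * (sqrt (\<rho> x) * sqrt (\<rho> y)) * ((f y - f x) * (g y - g x)) \<partial>lborel) = (\<integral>h. \<Phi> t (h, x) \<partial>lborel)" (is "?L = ?R")
proof -
  have [measurable]: "(\<lambda>y. a_eps a t (x - y)) \<in> borel_measurable borel"
    unfolding a_eps_def by measurable
  have "?L = (\<integral>y. a_eps a t (x - y) * (sqrt (\<rho> x) * sqrt (\<rho> y)) * ((f y - f x) * (g y - g x))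
      \<partial>density (distr lborel borel (\<lambda>h. x + t *\<^sub>R h)) (\<lambda>_. ennreal (\<bar>t\<bar> ^ DIM('a))))"
    using t by (subst lborel_affine[of t x, symmetric]) auto
  also have "\<dots> = (\<integral>h. \<bar>t\<bar> ^ DIM('a) * (a_eps a t (x - (x + t *\<^sub>R h)) * (sqrt (\<rho> x) * sqrt (\<rho> (x + t *\<^sub>R h))) *
      ((f (x + t *\<^sub>R h) - f x) * (g (x + t *\<^sub>R h) - g x))) \<partial>lborel)"
    by (subst integral_density) (auto simp: integral_distr)
  also have "\<dots> = ?R"
  proof (intro Bochner_Integration.integral_cong refl)
    fix h
    have "a_eps a t (x - (x + t *\<^sub>R h)) = inverse (t ^ (DIM('a) + 2)) * a (- h)"
      using t by (simp add: a_eps_def)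
    also have "a (- h) = a h" by (rule a_radial) simp
    finally have e: "a_eps a t (x - (x + t *\<^sub>R h)) = inverse (t ^ (DIM('a) + 2)) * a h" .
    show "\<bar>t\<bar> ^ DIM('a) * (a_eps a t (x - (x + t *\<^sub>R h)) * (sqrt (\<rho> x) * sqrt (\<rho> (x + t *\<^sub>R h))) *
      ((f (x + t *\<^sub>R h) - f x) * (g (x + t *\<^sub>R h) - g x))) = \<Phi> t (h, x)"
      unfolding e \<Phi>_def incr_def prod.case using t by (simp add: power_add power2_eq_square field_simps)
  qed
  finally show ?thesis .
qed

lemma form_eq_\<Phi>:
  assumes t: "0 < t" "t \<le> 1"
  shows "(\<integral>x. \<integral>y. a_eps a t (x - y) * (sqrt (\<rho> x) * sqrt (\<rho> y)) * ((f y - f x) * (g y - g x)) \<partial>lborel \<partial>lborel)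
     = integral\<^sup>L lborel2 (\<Phi> t)"
proof -
  have i: "integrable lborel2 (\<lambda>(h, x). \<Phi> t (h, x))" using \<Phi>_int[OF t] by simp
  then show ?thesis unfolding form_eq_\<Phi>_inner[OF t] using lborel_pair.integral_snd[OF i] by simp
qed

text \<open>This bound on the absolute value of the inner integral supplies the absolute
  integrability under which the Mecke formula may be used for a signed function of
  \<open>x\<close>.\<close>

lemma form_nn_bound:
  assumes t: "0 < t" "t \<le> 1"
  shows "(\<integral>\<^sup>+x. ennreal \<bar>\<integral>y. a_eps a t (x - y) * (sqrt (\<rho> x) * sqrt (\<rho> y)) * ((f y - f x) * (g y - g x)) \<partial>lborel\<bar> \<partial>lborel)
     \<le> ennreal (C0 * measure lborel (cball (0::'a) R) * (\<integral>x. indicator (ball 0 (S + 2 * R + 2)) x * \<rho> x \<partial>lborel))"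
proof -
  have i: "integrable lborel2 (\<lambda>(h, x). \<bar>\<Phi> t (h, x)\<bar>)" using integrable_abs[OF \<Phi>_int[OF t]] by (simp add: split_beta')
  have "(\<integral>\<^sup>+x. ennreal \<bar>\<integral>h. \<Phi> t (h, x) \<partial>lborel\<bar> \<partial>lborel) \<le> (\<integral>\<^sup>+x. ennreal (\<integral>h. \<bar>\<Phi> t (h, x)\<bar> \<partial>lborel) \<partial>lborel)"
    by (intro nn_integral_mono ennreal_leI, subst (1 2) real_norm_def[symmetric]) (rule integral_norm_bound)
  also have "\<dots> = ennreal (\<integral>x. \<integral>h. \<bar>\<Phi> t (h, x)\<bar> \<partial>lborel \<partial>lborel)"
    by (rule nn_integral_eq_integral[OF lborel_pair.integrable_snd[OF i]]) simp
  also have "(\<integral>x. \<integral>h. \<bar>\<Phi> t (h, x)\<bar> \<partial>lborel \<partial>lborel) = (\<integral>p. \<bar>\<Phi> t p\<bar> \<partial>lborel2)"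
    using lborel_pair.integral_snd[OF i] by (simp add: split_beta')
  also have "ennreal (\<integral>p. \<bar>\<Phi> t p\<bar> \<partial>lborel2) \<le> ennreal (integral\<^sup>L lborel2 (W t))"
    by (intro ennreal_leI integral_mono) (use \<Phi>_int[OF t] W_int \<Phi>_bound[OF t] in auto)
  finally show ?thesis unfolding W_integral form_eq_\<Phi>_inner[OF t] by (simp add: \<sigma>_def[abs_def])
qed

lemma form_bound:
  assumes t: "0 < t" "t \<le> 1"
  shows "\<bar>\<integral>x. \<integral>y. a_eps a t (x - y) * (sqrt (\<rho> x) * sqrt (\<rho> y)) * ((f y - f x) * (g y - g x)) \<partial>lborel \<partial>lborel\<bar>
     \<le> C0 * measure lborel (cball (0::'a) R) * (\<integral>x. indicator (ball 0 (S + 2 * R + 2)) x * \<rho> x \<partial>lborel)"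
  unfolding form_eq_\<Phi>[OF t] using \<Phi>_integral_bound[OF t] by (simp add: \<sigma>_def)

lemma form_tendsto:
  assumes t: "t \<longlonglongrightarrow> 0" "\<And>n. 0 < t n" "\<And>n. t n \<le> 1" and e: "e \<in> Basis"
  shows "(\<lambda>n. \<integral>x. \<integral>y. a_eps a (t n) (x - y) * (sqrt (\<rho> x) * sqrt (\<rho> y)) * ((f y - f x) * (g y - g x)) \<partial>lborel \<partial>lborel)
     \<longlonglongrightarrow> (\<integral>h. a h * (h \<bullet> e)\<^sup>2 \<partial>lborel) * (\<integral>x. \<rho> x * (grad f x \<bullet> grad g x) \<partial>lborel)"
  unfolding form_eq_\<Phi>[OF t(2,3)] \<Psi>_integral[OF e, symmetric] by (rule \<Phi>_tendsto[OF t(1-3)])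

end

section \<open>Cox processes and their Papangelou intensity\<close>

text \<open>The locally integrable mean \<open>g_mean\<close> serves twice: almost every realization
  is a locally finite intensity, and for almost every \<open>x\<close> the conditional expectation
  of g(x) is that of an integrable variable.\<close>

locale cox_process = prob_space P for P :: "'w measure" +
  fixes g :: "'a::euclidean_space \<Rightarrow> 'w \<Rightarrow> real"
  assumes g_meas: "(\<lambda>(x, \<omega>). g x \<omega>) \<in> borel_measurable (lborel \<Otimes>\<^sub>M P)"
    and g_nonneg: "\<And>x \<omega>. 0 \<le> g x \<omega>"
    and g_mean: "\<And>n::nat. (\<integral>\<^sup>+x\<in>ball 0 (real n). (\<integral>\<^sup>+\<omega>. ennreal (g x \<omega>) \<partial>P) \<partial>lborel) < \<infinity>"
begin

lemma g_meas1[measurable]: "(\<lambda>(x, \<omega>). g x \<omega>) \<in> borel_measurable (borel \<Otimes>\<^sub>M P)"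
  using g_meas by (simp cong: measurable_cong_sets sets_pair_measure_cong)

lemma g_section[measurable]: "g x \<in> borel_measurable P"
  using measurable_compose[OF measurable_Pair1' g_meas1, of x] by simp

lemma g_meas2[measurable]: "(\<lambda>(\<omega>, x). g x \<omega>) \<in> borel_measurable (P \<Otimes>\<^sub>M borel)"
  by measurable

definition good :: "'w \<Rightarrow> bool" where
  "good \<omega> \<longleftrightarrow> (\<forall>n::nat. (\<integral>\<^sup>+x\<in>ball 0 (real n). ennreal (g x \<omega>) \<partial>lborel) < \<infinity>)"

lemma good_measurable[measurable]: "Measurable.pred P good"
  unfolding good_def by measurable

lemma AE_good: "AE \<omega> in P. good \<omega>"
  unfolding good_def
proof (subst AE_all_countable, intro allI)
  fix n :: nat
  interpret pair_sigma_finite P lborel ..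
  have "(\<integral>\<^sup>+\<omega>. (\<integral>\<^sup>+x\<in>ball 0 (real n). ennreal (g x \<omega>) \<partial>lborel) \<partial>P) = (\<integral>\<^sup>+x. \<integral>\<^sup>+\<omega>. ennreal (g x \<omega>) * indicator (ball 0 (real n)) x \<partial>P \<partial>lborel)"
    by (rule Fubini'[symmetric]) measurable
  also have "\<dots> = (\<integral>\<^sup>+x\<in>ball 0 (real n). (\<integral>\<^sup>+\<omega>. ennreal (g x \<omega>) \<partial>P) \<partial>lborel)"
    by (intro nn_integral_cong nn_integral_multc) measurable
  also have "\<dots> \<noteq> \<infinity>" using g_mean[of n] by simp
  finally have "AE \<omega> in P. (\<integral>\<^sup>+x\<in>ball 0 (real n). ennreal (g x \<omega>) \<partial>lborel) \<noteq> \<infinity>"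
    by (intro nn_integral_noteq_infinite) measurable
  then show "AE \<omega> in P. (\<integral>\<^sup>+x\<in>ball 0 (real n). ennreal (g x \<omega>) \<partial>lborel) < \<infinity>"
    by eventually_elim (simp add: less_top)
qed

text \<open>\<open>pi_pp\<close> is an unspecified \<open>THE\<close> value when the intensity is not locally integrable; \<open>g'\<close> avoids
  this by changing \<open>g\<close> on a null set.\<close>

definition g' :: "'w \<Rightarrow> 'a \<Rightarrow> real" where
  "g' \<omega> x = (if good \<omega> then g x \<omega> else 0)"

lemma g'_meas[measurable]: "(\<lambda>(\<omega>, x). g' \<omega> x) \<in> borel_measurable (P \<Otimes>\<^sub>M borel)"
  unfolding g'_def by measurable

lemma loc_fin_g': "\<omega> \<in> space P \<Longrightarrow> loc_fin (\<lambda>x. ennreal (g' \<omega> x))"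
  unfolding loc_fin_def
proof (intro conjI allI)
  assume w: "\<omega> \<in> space P"
  show "(\<lambda>x. ennreal (g' \<omega> x)) \<in> borel_measurable borel" using w by measurable
  show "(\<integral>\<^sup>+x\<in>ball 0 (real n). ennreal (g' \<omega> x) \<partial>lborel) < \<infinity>" for n :: nat
  proof (cases "good \<omega>")
    case True
    then have "(\<integral>\<^sup>+x\<in>ball 0 (real n). ennreal (g x \<omega>) \<partial>lborel) < \<infinity>" unfolding good_def by blast
    then show ?thesis using True by (simp add: g'_def)
  qed (simp add: g'_def)
qed

definition K :: "'w \<Rightarrow> 'a set measure" where "K \<omega> = pi_pp (g' \<omega>)"

lemma K_measurable[measurable]: "K \<in> P \<rightarrow>\<^sub>M prob_algebra Gamma_M"
  unfolding K_def by (rule pi_pp_measurable) (auto intro: loc_fin_g')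

lemma K_measurable_subprob[measurable]: "K \<in> P \<rightarrow>\<^sub>M subprob_algebra Gamma_M"
  by (rule measurable_prob_algebraD) simp

lemma K_eq: "good \<omega> \<Longrightarrow> pi_pp (\<lambda>x. g x \<omega>) = K \<omega>"
  unfolding K_def g'_def by simp

lemma K_mecke: "\<omega> \<in> space P \<Longrightarrow> mecke (\<lambda>x. ennreal (g' \<omega> x)) (K \<omega>)"
  unfolding K_def by (rule pi_pp_mecke) (rule loc_fin_g')

lemma sets_K: "\<omega> \<in> space P \<Longrightarrow> sets (K \<omega>) = sets Gamma_M"
  using meckeD(1)[OF K_mecke] .

lemma P_in_prob_algebra: "P \<in> space (prob_algebra P)"
  by (simp add: space_prob_algebra prob_space_axioms)

abbreviation "\<mu> \<equiv> cox P g"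
abbreviation "J \<equiv> cox_joint P g"

text \<open>\<open>measure_of\<close> returns the given set function only if that function is
  countably additive. Comparison with a monadic bind, whose kernel agrees almost surely with the
  prescribed one, settles this.\<close>

lemma cox_eq_bind: "\<mu> = P \<bind> K"
proof -
  have s: "sets (P \<bind> K) = sets Gamma_M" using sets_bind'[OF P_in_prob_algebra K_measurable] .
  have "\<mu> = measure_of (space Gamma_M) (sets Gamma_M) (emeasure (P \<bind> K))"
    unfolding cox_def
  proof (rule measure_of_eq)
    show "sets Gamma_M \<subseteq> Pow (space (Gamma_M :: 'a set measure))" by (rule sets.space_closed)
    fix A :: "'a set set" assume "A \<in> sigma_sets (space Gamma_M) (sets Gamma_M)"
    then have A: "A \<in> sets Gamma_M" unfolding sets.sigma_sets_eq .
    have "(\<integral>\<^sup>+\<omega>. emeasure (pi_pp (\<lambda>x. g x \<omega>)) A \<partial>P) = (\<integral>\<^sup>+\<omega>. emeasure (K \<omega>) A \<partial>P)"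
      by (intro nn_integral_cong_AE) (use AE_good in \<open>auto simp: K_eq\<close>)
    also have "\<dots> = emeasure (P \<bind> K) A"
      by (rule emeasure_bind_prob_algebra[OF P_in_prob_algebra K_measurable A, symmetric])
    finally show "(\<integral>\<^sup>+\<omega>. emeasure (pi_pp (\<lambda>x. g x \<omega>)) A \<partial>P) = emeasure (P \<bind> K) A" .
  qed
  also have "\<dots> = P \<bind> K"
    using measure_of_of_measure[of "P \<bind> K"] unfolding s sets_eq_imp_space_eq[OF s] .
  finally show ?thesis .
qed

lemma sets_cox[simp, measurable_cong]: "sets \<mu> = sets Gamma_M"
  unfolding cox_eq_bind using sets_bind'[OF P_in_prob_algebra K_measurable] .

lemma space_cox[simp]: "space \<mu> = Gamma"
  using sets_eq_imp_space_eq[OF sets_cox] by simp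

lemma prob_space_cox: "prob_space \<mu>"
  unfolding cox_eq_bind by (rule prob_space_bind'[OF P_in_prob_algebra K_measurable])

definition JK :: "'w \<Rightarrow> ('w \<times> 'a set) measure" where
  "JK \<omega> = distr (K \<omega>) (P \<Otimes>\<^sub>M Gamma_M) (Pair \<omega>)"

lemma JK_measurable[measurable]: "JK \<in> P \<rightarrow>\<^sub>M prob_algebra (P \<Otimes>\<^sub>M Gamma_M)"
  unfolding JK_def by (rule measurable_distr_prob_space2[OF K_measurable]) measurable

lemma Pair_K: "\<omega> \<in> space P \<Longrightarrow> Pair \<omega> \<in> K \<omega> \<rightarrow>\<^sub>M P \<Otimes>\<^sub>M Gamma_M"
  using measurable_Pair1'[of \<omega> P "Gamma_M :: 'a set measure"] sets_K by (simp cong: measurable_cong_sets)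

lemma cox_joint_eq_bind: "J = P \<bind> JK"
proof -
  have s: "sets (P \<bind> JK) = sets (P \<Otimes>\<^sub>M Gamma_M)" using sets_bind'[OF P_in_prob_algebra JK_measurable] .
  have "J = measure_of (space P \<times> space Gamma_M) (sets (P \<Otimes>\<^sub>M Gamma_M)) (emeasure (P \<bind> JK))"
    unfolding cox_joint_def
  proof (rule measure_of_eq)
    show "sets (P \<Otimes>\<^sub>M Gamma_M) \<subseteq> Pow (space P \<times> space (Gamma_M :: 'a set measure))"
      using sets.space_closed[of "P \<Otimes>\<^sub>M (Gamma_M :: 'a set measure)"] by (simp add: space_pair_measure)
    fix A :: "('w \<times> 'a set) set" assume "A \<in> sigma_sets (space P \<times> space Gamma_M) (sets (P \<Otimes>\<^sub>M Gamma_M))"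
    then have A: "A \<in> sets (P \<Otimes>\<^sub>M Gamma_M)" unfolding space_pair_measure[symmetric] sets.sigma_sets_eq .
    then have A_sub: "A \<subseteq> space P \<times> Gamma" using sets.sets_into_space by (fastforce simp: space_pair_measure)
    have "(\<integral>\<^sup>+\<omega>. emeasure (pi_pp (\<lambda>x. g x \<omega>)) (Pair \<omega> -` A) \<partial>P) = (\<integral>\<^sup>+\<omega>. emeasure (JK \<omega>) A \<partial>P)"
    proof (intro nn_integral_cong_AE)
      show "AE \<omega> in P. emeasure (pi_pp (\<lambda>x. g x \<omega>)) (Pair \<omega> -` A) = emeasure (JK \<omega>) A"
        using AE_good AE_space
      proof eventually_elim
        case (elim \<omega>)
        have "Pair \<omega> -` A \<inter> space (K \<omega>) = Pair \<omega> -` A"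
          using A_sub sets_eq_imp_space_eq[OF sets_K[OF elim(2)]] by auto
        then show ?case unfolding JK_def K_eq[OF elim(1)]
          using elim(2) A by (subst emeasure_distr) (auto intro: Pair_K)
      qed
    qed
    also have "\<dots> = emeasure (P \<bind> JK) A"
      by (rule emeasure_bind_prob_algebra[OF P_in_prob_algebra JK_measurable A, symmetric])
    finally show "(\<integral>\<^sup>+\<omega>. emeasure (pi_pp (\<lambda>x. g x \<omega>)) (Pair \<omega> -` A) \<partial>P) = emeasure (P \<bind> JK) A" .
  qed
  also have "\<dots> = P \<bind> JK"
    using measure_of_of_measure[of "P \<bind> JK"] unfolding s sets_eq_imp_space_eq[OF s] space_pair_measure .
  finally show ?thesis .
qed

lemma sets_cox_joint[simp, measurable_cong]: "sets J = sets (P \<Otimes>\<^sub>M Gamma_M)"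
  unfolding cox_joint_eq_bind using sets_bind'[OF P_in_prob_algebra JK_measurable] .

lemma space_cox_joint: "space J = space P \<times> Gamma"
  using sets_eq_imp_space_eq[OF sets_cox_joint] by (simp add: space_pair_measure)

lemma prob_space_cox_joint: "prob_space J"
  unfolding cox_joint_eq_bind by (rule prob_space_bind'[OF P_in_prob_algebra JK_measurable])

lemma nn_integral_cox:
  "h \<in> borel_measurable Gamma_M \<Longrightarrow> (\<integral>\<^sup>+\<gamma>. h \<gamma> \<partial>\<mu>) = (\<integral>\<^sup>+\<omega>. \<integral>\<^sup>+\<gamma>. h \<gamma> \<partial>K \<omega> \<partial>P)"
  unfolding cox_eq_bind by (rule nn_integral_bind[OF _ K_measurable_subprob])

lemma nn_integral_cox_joint:
  assumes h[measurable]: "h \<in> borel_measurable (P \<Otimes>\<^sub>M Gamma_M)"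
  shows "(\<integral>\<^sup>+p. h p \<partial>J) = (\<integral>\<^sup>+\<omega>. \<integral>\<^sup>+\<gamma>. h (\<omega>, \<gamma>) \<partial>K \<omega> \<partial>P)"
proof -
  have "(\<integral>\<^sup>+p. h p \<partial>J) = (\<integral>\<^sup>+\<omega>. \<integral>\<^sup>+p. h p \<partial>JK \<omega> \<partial>P)"
    unfolding cox_joint_eq_bind by (rule nn_integral_bind[OF h measurable_prob_algebraD[OF JK_measurable]])
  also have "\<dots> = (\<integral>\<^sup>+\<omega>. \<integral>\<^sup>+\<gamma>. h (\<omega>, \<gamma>) \<partial>K \<omega> \<partial>P)"
    unfolding JK_def by (intro nn_integral_cong nn_integral_distr) (auto intro: Pair_K)
  finally show ?thesis .
qed

lemma distr_cox_joint_snd: "distr J Gamma_M snd = \<mu>"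
proof (rule measure_eqI)
  fix A assume "A \<in> sets (distr J Gamma_M snd)"
  then have A[measurable]: "A \<in> sets Gamma_M" by simp
  have "emeasure (distr J Gamma_M snd) A = (\<integral>\<^sup>+\<gamma>. indicator A \<gamma> \<partial>distr J Gamma_M snd)" by simp
  also have "\<dots> = (\<integral>\<^sup>+p. indicator A (snd p) \<partial>J)" by (rule nn_integral_distr) auto
  also have "\<dots> = (\<integral>\<^sup>+\<omega>. \<integral>\<^sup>+\<gamma>. indicator A \<gamma> \<partial>K \<omega> \<partial>P)" by (subst nn_integral_cox_joint) auto
  also have "\<dots> = (\<integral>\<^sup>+\<gamma>. indicator A \<gamma> \<partial>\<mu>)" by (rule nn_integral_cox[symmetric]) simp
  also have "\<dots> = emeasure \<mu> A" by simp
  finally show "emeasure (distr J Gamma_M snd) A = emeasure \<mu> A" .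
qed simp

lemma AE_mean_finite: "AE x in lborel. (\<integral>\<^sup>+\<omega>. ennreal (g x \<omega>) \<partial>P) < \<infinity>"
proof -
  have "AE x in lborel. \<forall>n::nat. (\<integral>\<^sup>+\<omega>. ennreal (g x \<omega>) \<partial>P) * indicator (ball 0 (real n)) x \<noteq> \<infinity>"
    unfolding AE_all_countable
  proof
    fix n :: nat
    show "AE x in lborel. (\<integral>\<^sup>+\<omega>. ennreal (g x \<omega>) \<partial>P) * indicator (ball 0 (real n)) x \<noteq> \<infinity>"
      using g_mean[of n] by (intro nn_integral_noteq_infinite) auto
  qed
  then show ?thesis
  proof eventually_elim
    case (elim x)
    obtain n :: nat where "norm x < real n" using reals_Archimedean2 by blast
    then show ?case using elim[rule_format, of n] by (simp add: less_top)
  qed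
qed

end

section \<open>The Papangelou intensity as a conditional expectation\<close>

locale cox_papangelou = cox_process P g for P :: "'w measure" and g :: "'a::euclidean_space \<Rightarrow> 'w \<Rightarrow> real" +
  fixes r :: "'a \<Rightarrow> 'a set \<Rightarrow> real"
  assumes r_pap: "is_papangelou P g r"
begin

lemma r_meas[measurable]: "(\<lambda>(x, \<gamma>). r x \<gamma>) \<in> borel_measurable (borel \<Otimes>\<^sub>M Gamma_M)"
  using r_pap unfolding is_papangelou_def by (auto cong: measurable_cong_sets sets_pair_measure_cong)

abbreviation "\<F> \<equiv> cox_F P g"

lemma subalg: "subalgebra J \<F>"
proof -
  have "snd \<in> J \<rightarrow>\<^sub>M Gamma_M" by measurable
  moreover have "sets (vimage_algebra (space J) snd Gamma_M) = {snd -` A \<inter> space J |A. A \<in> sets (Gamma_M :: 'a set measure)}"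
    by (rule sets_vimage_algebra2) (auto simp: space_cox_joint)
  ultimately show ?thesis
    unfolding subalgebra_def cox_F_def using measurable_sets by (auto simp del: sets_cox_joint)
qed

text \<open>\<open>real_cond_exp\<close> is the difference of the conditional expectations of
  positive and negative part; the latter is 0 since g is nonnegative. The exceptional null set of
  \<open>x\<close> is chosen before the test function \<open>h\<close>, so \<open>h\<close> may
  later depend on \<open>x\<close>.\<close>

lemma r_cond_exp:
  "AE x in lborel. (AE p in J. 0 \<le> r x (snd p)) \<and>
     (\<forall>h\<in>borel_measurable Gamma_M. (\<integral>\<^sup>+\<gamma>. ennreal (r x \<gamma>) * h \<gamma> \<partial>\<mu>) = (\<integral>\<^sup>+p. ennreal (g x (fst p)) * h (snd p) \<partial>J))"
proof -
  have r: "AE x in lborel. AE p in J. r x (snd p) = real_cond_exp J \<F> (\<lambda>q. g x (fst q)) p"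
    using r_pap unfolding is_papangelou_def by blast
  interpret J: prob_space J by (rule prob_space_cox_joint)
  interpret finite_measure_subalgebra J \<F>
    by unfold_locales (rule subalg)
  have snd_F: "snd \<in> \<F> \<rightarrow>\<^sub>M Gamma_M"
    unfolding cox_F_def by (rule measurable_vimage_algebra1) (auto simp: space_cox_joint)
  show ?thesis
    using r AE_mean_finite
  proof eventually_elim
    case (elim x)
    define N where "N = nn_cond_exp J \<F> (\<lambda>q. ennreal (g x (fst q)))"
    have [measurable]: "N \<in> borel_measurable J" unfolding N_def by (rule borel_measurable_nn_cond_exp2)
    have gJ[measurable]: "(\<lambda>q. ennreal (g x (fst q))) \<in> borel_measurable J" by measurable
    have N: "(\<integral>\<^sup>+p. f p * N p \<partial>J) = (\<integral>\<^sup>+p. f p * ennreal (g x (fst p)) \<partial>J)" if "f \<in> borel_measurable \<F>" for f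
      unfolding N_def by (rule nn_cond_exp_intg[OF that gJ])
    have "(\<integral>\<^sup>+p. N p \<partial>J) = (\<integral>\<^sup>+p. ennreal (g x (fst p)) \<partial>J)" using N[of "\<lambda>_. 1"] by simp
    also have "\<dots> = (\<integral>\<^sup>+\<omega>. \<integral>\<^sup>+\<gamma>. ennreal (g x \<omega>) \<partial>K \<omega> \<partial>P)" by (subst nn_integral_cox_joint) auto
    also have "\<dots> = (\<integral>\<^sup>+\<omega>. ennreal (g x \<omega>) \<partial>P)"
      by (intro nn_integral_cong) (simp add: prob_space.emeasure_space_1[OF meckeD(2)[OF K_mecke]])
    finally have "(\<integral>\<^sup>+p. N p \<partial>J) \<noteq> \<infinity>" using elim(2) by simp
    \<comment> \<open>\<open>enn2real\<close> sends \<infinity> to 0, so \<open>N\<close> can be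
      recovered from \<open>r\<close> only where it is finite.\<close>
    then have Nfin: "AE p in J. N p \<noteq> \<infinity>" by (intro nn_integral_noteq_infinite) auto
    have "(\<lambda>q::'w \<times> 'a set. ennreal (- g x (fst q))) = (\<lambda>_. 0)" using g_nonneg by (auto simp: ennreal_neg)
    then have zero: "AE p in J. nn_cond_exp J \<F> (\<lambda>q. ennreal (- g x (fst q))) p = 0"
      using nn_cond_exp_F_meas[of "\<lambda>_. 0"] by (auto elim: eventually_mono)
    have rN: "AE p in J. ennreal (r x (snd p)) = N p \<and> 0 \<le> r x (snd p)"
      using elim(1) zero Nfin
    proof eventually_elim
      case (elim p)
      have "r x (snd p) = enn2real (N p)"
        unfolding elim(1) real_cond_exp_def elim(2) N_def by simp
      then show ?case using elim(3) by (simp add: less_top)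
    qed
    show ?case
    proof (intro conjI ballI)
      show "AE p in J. 0 \<le> r x (snd p)" using rN by eventually_elim simp
      fix h :: "'a set \<Rightarrow> ennreal" assume h[measurable]: "h \<in> borel_measurable Gamma_M"
      have "(\<integral>\<^sup>+\<gamma>. ennreal (r x \<gamma>) * h \<gamma> \<partial>\<mu>) = (\<integral>\<^sup>+p. ennreal (r x (snd p)) * h (snd p) \<partial>J)"
        unfolding distr_cox_joint_snd[symmetric] by (subst nn_integral_distr) auto
      also have "\<dots> = (\<integral>\<^sup>+p. h (snd p) * N p \<partial>J)"
        by (rule nn_integral_cong_AE) (use rN in \<open>auto simp: mult.commute\<close>)
      also have "\<dots> = (\<integral>\<^sup>+p. h (snd p) * ennreal (g x (fst p)) \<partial>J)"
        by (rule N) (rule measurable_compose[OF snd_F h])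
      finally show "(\<integral>\<^sup>+\<gamma>. ennreal (r x \<gamma>) * h \<gamma> \<partial>\<mu>) = (\<integral>\<^sup>+p. ennreal (g x (fst p)) * h (snd p) \<partial>J)"
        by (simp add: mult.commute)
    qed
  qed
qed

text \<open>The defining property holds for almost every \<open>x\<close> and then almost every
  \<gamma>. The analysis of a fixed configuration needs the opposite order, which Fubini for null
  sets provides.\<close>

lemma AE_r_nonneg: "AE \<gamma> in \<mu>. AE x in lborel. 0 \<le> r x \<gamma>"
proof -
  interpret C: prob_space \<mu> by (rule prob_space_cox)
  interpret pair_sigma_finite lborel \<mu> ..
  have "AE x in lborel. AE \<gamma> in \<mu>. 0 \<le> r x \<gamma>"
    using r_cond_exp
  proof eventually_elim
    case (elim x)
    then have "AE p in J. 0 \<le> r x (snd p)" by simp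
    moreover have "{\<gamma>\<in>space Gamma_M. 0 \<le> r x \<gamma>} \<in> sets Gamma_M" by measurable
    ultimately show ?case unfolding distr_cox_joint_snd[symmetric] by (subst AE_distr_iff) auto
  qed
  moreover have m: "{p \<in> space (lborel \<Otimes>\<^sub>M \<mu>). 0 \<le> r (fst p) (snd p)} \<in> sets (lborel \<Otimes>\<^sub>M \<mu>)"
    by measurable
  ultimately show ?thesis by (simp only: AE_commute[OF m])
qed

lemma cox_r_swap:
  assumes h[measurable]: "(\<lambda>(\<gamma>, x). h \<gamma> x) \<in> borel_measurable (Gamma_M \<Otimes>\<^sub>M borel)"
  shows "(\<integral>\<^sup>+\<gamma>. \<integral>\<^sup>+x. ennreal (r x \<gamma>) * h \<gamma> x \<partial>lborel \<partial>\<mu>) =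
    (\<integral>\<^sup>+p. \<integral>\<^sup>+x. ennreal (g x (fst p)) * h (snd p) x \<partial>lborel \<partial>J)"
proof -
  interpret C: prob_space \<mu> by (rule prob_space_cox)
  interpret J: prob_space J by (rule prob_space_cox_joint)
  interpret CL: pair_sigma_finite \<mu> lborel ..
  interpret JL: pair_sigma_finite J lborel ..
  have "(\<integral>\<^sup>+\<gamma>. \<integral>\<^sup>+x. ennreal (r x \<gamma>) * h \<gamma> x \<partial>lborel \<partial>\<mu>) = (\<integral>\<^sup>+x. \<integral>\<^sup>+\<gamma>. ennreal (r x \<gamma>) * h \<gamma> x \<partial>\<mu> \<partial>lborel)"
    by (rule CL.Fubini'[symmetric]) measurable
  also have "\<dots> = (\<integral>\<^sup>+x. \<integral>\<^sup>+p. ennreal (g x (fst p)) * h (snd p) x \<partial>J \<partial>lborel)"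
  proof (rule nn_integral_cong_AE)
    show "AE x in lborel. (\<integral>\<^sup>+\<gamma>. ennreal (r x \<gamma>) * h \<gamma> x \<partial>\<mu>) = (\<integral>\<^sup>+p. ennreal (g x (fst p)) * h (snd p) x \<partial>J)"
      using r_cond_exp
    proof eventually_elim
      case (elim x)
      have hx: "(\<lambda>\<gamma>. h \<gamma> x) \<in> borel_measurable Gamma_M" by measurable
      show ?case using elim[THEN conjunct2, THEN bspec, OF hx] .
    qed
  qed
  also have "\<dots> = (\<integral>\<^sup>+p. \<integral>\<^sup>+x. ennreal (g x (fst p)) * h (snd p) x \<partial>lborel \<partial>J)"
    by (rule JL.Fubini') measurable
  finally show ?thesis .
qed

text \<open>Given \<omega> the process is Poisson with weight g(x,\<omega>). The remaining factor
  depends on \<omega> only through \<gamma>, so g may be replaced by its conditional expectation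
  r.\<close>

lemma mecke_cox:
  assumes f[measurable]: "(\<lambda>(\<gamma>, x). f \<gamma> x) \<in> borel_measurable (Gamma_M \<Otimes>\<^sub>M borel)"
  shows "(\<integral>\<^sup>+\<gamma>. \<integral>\<^sup>+x. f \<gamma> x \<partial>count_space \<gamma> \<partial>\<mu>) =
    (\<integral>\<^sup>+\<gamma>. \<integral>\<^sup>+x. ennreal (r x \<gamma>) * f (insert x \<gamma>) x \<partial>lborel \<partial>\<mu>)"
proof -
  have "(\<integral>\<^sup>+\<gamma>. \<integral>\<^sup>+x. f \<gamma> x \<partial>count_space \<gamma> \<partial>\<mu>) = (\<integral>\<^sup>+\<omega>. \<integral>\<^sup>+\<gamma>. \<integral>\<^sup>+x. f \<gamma> x \<partial>count_space \<gamma> \<partial>K \<omega> \<partial>P)"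
    by (rule nn_integral_cox) measurable
  also have "\<dots> = (\<integral>\<^sup>+\<omega>. \<integral>\<^sup>+\<gamma>. \<integral>\<^sup>+x. ennreal (g' \<omega> x) * f (insert x \<gamma>) x \<partial>lborel \<partial>K \<omega> \<partial>P)"
    by (intro nn_integral_cong meckeD(3)[OF K_mecke] f)
  also have "\<dots> = (\<integral>\<^sup>+\<omega>. \<integral>\<^sup>+\<gamma>. \<integral>\<^sup>+x. ennreal (g x \<omega>) * f (insert x \<gamma>) x \<partial>lborel \<partial>K \<omega> \<partial>P)"
    by (rule nn_integral_cong_AE) (use AE_good in eventually_elim, simp add: g'_def)
  also have "\<dots> = (\<integral>\<^sup>+p. \<integral>\<^sup>+x. ennreal (g x (fst p)) * f (insert x (snd p)) x \<partial>lborel \<partial>J)"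
    by (subst nn_integral_cox_joint) auto
  also have "\<dots> = (\<integral>\<^sup>+\<gamma>. \<integral>\<^sup>+x. ennreal (r x \<gamma>) * f (insert x \<gamma>) x \<partial>lborel \<partial>\<mu>)"
    by (rule cox_r_swap[symmetric]) measurable
  finally show ?thesis .
qed

text \<open>A test function independent of \<gamma> removes the conditioning, so r and g have the
  same mean mass on a ball.\<close>

lemma r_mean_finite:
  "(\<integral>\<^sup>+\<gamma>. (\<integral>\<^sup>+x\<in>ball 0 (real n). ennreal (r x \<gamma>) \<partial>lborel) \<partial>\<mu>) < \<infinity>"
proof -
  interpret pair_sigma_finite P lborel ..
  have "(\<integral>\<^sup>+\<gamma>. (\<integral>\<^sup>+x\<in>ball 0 (real n). ennreal (r x \<gamma>) \<partial>lborel) \<partial>\<mu>) =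
    (\<integral>\<^sup>+p. \<integral>\<^sup>+x. ennreal (g x (fst p)) * indicator (ball 0 (real n)) x \<partial>lborel \<partial>J)"
    by (rule cox_r_swap) measurable
  also have "\<dots> = (\<integral>\<^sup>+\<omega>. \<integral>\<^sup>+\<gamma>. \<integral>\<^sup>+x. ennreal (g x \<omega>) * indicator (ball 0 (real n)) x \<partial>lborel \<partial>K \<omega> \<partial>P)"
    by (subst nn_integral_cox_joint) auto
  also have "\<dots> = (\<integral>\<^sup>+\<omega>. \<integral>\<^sup>+x. ennreal (g x \<omega>) * indicator (ball 0 (real n)) x \<partial>lborel \<partial>P)"
    by (intro nn_integral_cong) (simp add: prob_space.emeasure_space_1[OF meckeD(2)[OF K_mecke]])
  also have "\<dots> = (\<integral>\<^sup>+x. \<integral>\<^sup>+\<omega>. ennreal (g x \<omega>) * indicator (ball 0 (real n)) x \<partial>P \<partial>lborel)"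
    by (rule Fubini'[symmetric]) measurable
  also have "\<dots> = (\<integral>\<^sup>+x\<in>ball 0 (real n). (\<integral>\<^sup>+\<omega>. ennreal (g x \<omega>) \<partial>P) \<partial>lborel)"
    by (intro nn_integral_cong nn_integral_multc) measurable
  also have "\<dots> < \<infinity>" by (rule g_mean)
  finally show ?thesis .
qed

end

section \<open>Second moments of the Gaussian field\<close>

lemma ball_not_null:
  fixes c :: "'a::euclidean_space"
  assumes "0 < e"
  shows "ball c e \<notin> null_sets lborel"
proof
  assume "ball c e \<in> null_sets lborel"
  then have "negligible (ball c e)" by (simp add: negligible_iff_null_sets null_sets_completionI)
  then show False using open_not_negligible[of "ball c e"] assms by simp
qed

lemma AE_lborel_ex_ball:
  fixes c :: "'a::euclidean_space"
  assumes "AE x in lborel. Q x" "0 < e"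
  shows "\<exists>x\<in>ball c e. Q x"
proof (rule ccontr)
  assume "\<not> (\<exists>x\<in>ball c e. Q x)"
  then have "AE x in lborel. x \<notin> ball c e" using assms(1) by (auto elim: eventually_mono)
  then have "ball c e \<in> null_sets lborel" by (subst AE_iff_null_sets) auto
  then show False using ball_not_null[OF assms(2)] by blast
qed

text \<open>The map from (x, h) to (x, x + h) preserves null sets. A property of almost every pair
  therefore holds on almost every shifted diagonal, and in particular for arbitrarily small
  shifts.\<close>

lemma AE_lborel_pair_shift:
  fixes F :: "'a::euclidean_space \<Rightarrow> 'a \<Rightarrow> real"
  assumes F[measurable]: "(\<lambda>(x, y). F x y) \<in> borel_measurable (lborel \<Otimes>\<^sub>M lborel)"
    and ae: "AE p in lborel \<Otimes>\<^sub>M lborel. F (fst p) (snd p) \<le> C"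
  shows "AE h in lborel. AE x in lborel. F x (x + h) \<le> C"
proof -
  have "AE x in lborel. AE y in lborel. F (fst (x, y)) (snd (x, y)) \<le> C"
    by (rule lborel_pair.AE_pair[OF ae])
  then have "AE x in lborel. AE h in lborel. F x (x + h) \<le> C"
  proof eventually_elim
    case (elim x)
    then have "AE y in distr lborel borel ((+) x). F x y \<le> C" unfolding lborel_distr_plus by simp
    then show ?case by (rule AE_distrD[rotated]) simp
  qed
  moreover have m: "{p \<in> space (lborel \<Otimes>\<^sub>M lborel). F (fst p) (fst p + snd p) \<le> C} \<in> sets (lborel \<Otimes>\<^sub>M lborel)"
    by measurable
  ultimately show ?thesis by (simp only: lborel_pair.AE_commute[OF m])
qed

text \<open>Reduces \<open>L\<^sup>2\<close>-continuity of translations of \<open>u\<close> to \<open>L\<^sup>1\<close>-continuity for \<open>u * \<bar>u\<bar>\<close>.\<close>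

lemma square_diff_le_signed_square:
  fixes a b :: real
  shows "(a - b)\<^sup>2 \<le> 2 * \<bar>a * \<bar>a\<bar> - b * \<bar>b\<bar>\<bar>"
proof -
  consider "0 \<le> a" "0 \<le> b" | "a \<le> 0" "b \<le> 0" | "0 \<le> a" "b \<le> 0" | "a \<le> 0" "0 \<le> b" by linarith
  then show ?thesis
  proof cases
    case 1
    have "(a - b)\<^sup>2 = \<bar>a - b\<bar> * \<bar>a - b\<bar>" by (simp add: power2_eq_square)
    also have "\<dots> \<le> \<bar>a - b\<bar> * (a + b)" using 1 by (intro mult_left_mono) auto
    also have "\<dots> = \<bar>(a - b) * (a + b)\<bar>" using 1 by (simp add: abs_mult)
    also have "(a - b) * (a + b) = a * \<bar>a\<bar> - b * \<bar>b\<bar>" using 1 by (simp add: algebra_simps)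
    finally show ?thesis by (rule order_trans) simp
  next
    case 2
    have "(a - b)\<^sup>2 = \<bar>a - b\<bar> * \<bar>a - b\<bar>" by (simp add: power2_eq_square)
    also have "\<dots> \<le> \<bar>a - b\<bar> * (- a - b)" using 2 by (intro mult_left_mono) auto
    also have "\<dots> = \<bar>(a - b) * (- a - b)\<bar>" using 2 by (simp add: abs_mult)
    also have "(a - b) * (- a - b) = a * \<bar>a\<bar> - b * \<bar>b\<bar>" using 2 by (simp add: algebra_simps abs_if)
    finally show ?thesis by (rule order_trans) simp
  next
    case 3
    have "(a - b)\<^sup>2 \<le> 2 * (a\<^sup>2 + b\<^sup>2)" using sum_squares_ge_zero[of "a + b" 0] by (simp add: power2_eq_square algebra_simps)
    also have "a\<^sup>2 + b\<^sup>2 = a * \<bar>a\<bar> - b * \<bar>b\<bar>" using 3 by (simp add: power2_eq_square abs_if)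
    finally show ?thesis by (rule order_trans[OF _ mult_left_mono[OF abs_ge_self]]) simp
  next
    case 4
    have "(a - b)\<^sup>2 \<le> 2 * (a\<^sup>2 + b\<^sup>2)" using sum_squares_ge_zero[of "a + b" 0] by (simp add: power2_eq_square algebra_simps)
    also have "a\<^sup>2 + b\<^sup>2 = - (a * \<bar>a\<bar> - b * \<bar>b\<bar>)" using 4 by (simp add: power2_eq_square abs_if)
    finally show ?thesis by (rule order_trans[OF _ mult_left_mono[OF abs_ge_minus_self]]) simp
  qed
qed

text \<open>The covariance is known for almost every pair of points only, which says nothing about the diagonal.
  The diagonal is reached along a sequence of admissible shifts tending to 0, using continuity of
  translations.\<close>

lemma (in prob_space) second_moment_le_covariance:
  fixes Y :: "'b::euclidean_space \<Rightarrow> 'a \<Rightarrow> real" and A :: "'b set"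
  assumes Y[measurable]: "(\<lambda>(x, \<omega>). Y x \<omega>) \<in> borel_measurable (lborel \<Otimes>\<^sub>M M)"
    and Yfin: "\<And>x. integrable M (\<lambda>\<omega>. (Y x \<omega>)\<^sup>2)"
    and cov: "AE p in lborel \<Otimes>\<^sub>M lborel. expectation (\<lambda>\<omega>. Y (fst p) \<omega> * Y (snd p) \<omega>) \<le> C"
    and C: "0 \<le> C"
    and A[measurable]: "A \<in> sets borel" and A_fin: "emeasure lborel A < \<infinity>"
    and A_bd: "\<And>x. x \<in> A \<Longrightarrow> expectation (\<lambda>\<omega>. (Y x \<omega>)\<^sup>2) \<le> B"
  shows "(\<integral>\<^sup>+x\<in>A. (\<integral>\<^sup>+\<omega>. ennreal ((Y x \<omega>)\<^sup>2) \<partial>M) \<partial>lborel) \<le> ennreal C * emeasure lborel A"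
proof -
  interpret LM: pair_sigma_finite lborel M ..
  have Ysec[measurable]: "Y x \<in> borel_measurable M" for x
    using measurable_compose[OF measurable_Pair1' Y, of x] by simp
  define u where "u x \<omega> = indicator A x * Y x \<omega>" for x \<omega>
  have u[measurable]: "(\<lambda>(x, \<omega>). u x \<omega>) \<in> borel_measurable (lborel \<Otimes>\<^sub>M M)" unfolding u_def by measurable
  have usec[measurable]: "u x \<in> borel_measurable M" for x unfolding u_def by measurable
  have usec2[measurable]: "(\<lambda>x. u x \<omega>) \<in> borel_measurable borel" if "\<omega> \<in> space M" for \<omega>
    using measurable_compose[OF measurable_Pair2'[OF that] u] by simp
  define \<sigma> where "\<sigma> x = expectation (\<lambda>\<omega>. (u x \<omega>)\<^sup>2)" for x
  have u_int: "integrable M (\<lambda>\<omega>. (u x \<omega>)\<^sup>2)" for x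
    using Yfin[of x] by (simp add: u_def power_mult_distrib)
  have uu_int: "integrable M (\<lambda>\<omega>. u x \<omega> * u y \<omega>)" for x y
  proof (rule Bochner_Integration.integrable_bound[OF Bochner_Integration.integrable_add[OF u_int[of x] u_int[of y]]])
    show "AE \<omega> in M. norm (u x \<omega> * u y \<omega>) \<le> norm ((u x \<omega>)\<^sup>2 + (u y \<omega>)\<^sup>2)"
    proof (rule AE_I2)
      fix \<omega>
      have "0 \<le> (\<bar>u x \<omega>\<bar> - \<bar>u y \<omega>\<bar>)\<^sup>2" by simp
      then have "2 * (\<bar>u x \<omega>\<bar> * \<bar>u y \<omega>\<bar>) \<le> (u x \<omega>)\<^sup>2 + (u y \<omega>)\<^sup>2" by (simp add: power2_diff)
      then show "norm (u x \<omega> * u y \<omega>) \<le> norm ((u x \<omega>)\<^sup>2 + (u y \<omega>)\<^sup>2)"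
        by (simp add: abs_mult) (smt (verit) mult_nonneg_nonneg abs_ge_zero)
    qed
  qed measurable
  \<comment> \<open>\<open>B\<close> enters only through this finiteness; it does not appear in the
    final estimate.\<close>
  have nnB: "(\<integral>\<^sup>+x. \<integral>\<^sup>+\<omega>. ennreal ((u x \<omega>)\<^sup>2) \<partial>M \<partial>lborel) < \<infinity>"
  proof -
    have "(\<integral>\<^sup>+x. \<integral>\<^sup>+\<omega>. ennreal ((u x \<omega>)\<^sup>2) \<partial>M \<partial>lborel) \<le> (\<integral>\<^sup>+x. ennreal B * indicator A x \<partial>lborel)"
    proof (rule nn_integral_mono)
      fix x :: 'b
      have "(\<integral>\<^sup>+\<omega>. ennreal ((u x \<omega>)\<^sup>2) \<partial>M) = ennreal (\<sigma> x)"
        unfolding \<sigma>_def by (rule nn_integral_eq_integral[OF u_int]) simp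
      also have "\<dots> \<le> ennreal B * indicator A x"
        using A_bd[of x] by (auto simp: \<sigma>_def u_def indicator_def intro: ennreal_leI)
      finally show "(\<integral>\<^sup>+\<omega>. ennreal ((u x \<omega>)\<^sup>2) \<partial>M) \<le> ennreal B * indicator A x" .
    qed
    also have "\<dots> = ennreal B * emeasure lborel A" by (rule nn_integral_cmult_indicator) simp
    also have "\<dots> < \<infinity>" using A_fin by (simp add: ennreal_mult_less_top)
    finally show ?thesis .
  qed
  have u2: "integrable (lborel \<Otimes>\<^sub>M M) (\<lambda>(x, \<omega>). (u (x + h) \<omega>)\<^sup>2)" for h
  proof (rule integrableI_bounded)
    have "(\<integral>\<^sup>+p. ennreal (norm (case p of (x, \<omega>) \<Rightarrow> (u (x + h) \<omega>)\<^sup>2)) \<partial>(lborel \<Otimes>\<^sub>M M)) = (\<integral>\<^sup>+x. \<integral>\<^sup>+\<omega>. ennreal ((u (x + h) \<omega>)\<^sup>2) \<partial>M \<partial>lborel)"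
    proof -
      have "(\<lambda>(x, \<omega>). ennreal ((u (x + h) \<omega>)\<^sup>2)) \<in> borel_measurable (lborel \<Otimes>\<^sub>M M)" by measurable
      from nn_integral_fst[OF this] show ?thesis
        by (simp add: split_beta')
    qed
    also have "\<dots> = (\<integral>\<^sup>+x. \<integral>\<^sup>+\<omega>. ennreal ((u x \<omega>)\<^sup>2) \<partial>M \<partial>lborel)"
      by (rule nn_integral_lborel_translate[of "\<lambda>x. \<integral>\<^sup>+\<omega>. ennreal ((u x \<omega>)\<^sup>2) \<partial>M"]) measurable
    finally show "(\<integral>\<^sup>+p. ennreal (norm (case p of (x, \<omega>) \<Rightarrow> (u (x + h) \<omega>)\<^sup>2)) \<partial>(lborel \<Otimes>\<^sub>M M)) < \<infinity>"
      using nnB by simp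
  qed measurable
  have u20: "integrable (lborel \<Otimes>\<^sub>M M) (\<lambda>(x, \<omega>). (u x \<omega>)\<^sup>2)" using u2[of 0] by simp
  have \<sigma>_int: "integrable lborel \<sigma>" using LM.integrable_fst'[OF u20] by (simp add: \<sigma>_def[abs_def])
  have [measurable]: "\<sigma> \<in> borel_measurable borel" using \<sigma>_int by auto
  define D where "D h \<omega> = (\<integral>x. (u (x + h) \<omega> - u x \<omega>)\<^sup>2 \<partial>lborel)" for h \<omega>
  have q_int: "integrable (lborel \<Otimes>\<^sub>M M) (\<lambda>(x, \<omega>). (u (x + h) \<omega> - u x \<omega>)\<^sup>2)" for h
  proof (rule Bochner_Integration.integrable_bound)
    show "integrable (lborel \<Otimes>\<^sub>M M) (\<lambda>p. 2 * (case p of (x, \<omega>) \<Rightarrow> (u (x + h) \<omega>)\<^sup>2) + 2 * (case p of (x, \<omega>) \<Rightarrow> (u x \<omega>)\<^sup>2))"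
      by (intro Bochner_Integration.integrable_add integrable_mult_right u2 u20)
    have "(a - b)\<^sup>2 \<le> 2 * a\<^sup>2 + 2 * b\<^sup>2" for a b :: real
      using sum_squares_ge_zero[of "a + b" 0] by (simp add: power2_eq_square algebra_simps)
    then show "AE p in lborel \<Otimes>\<^sub>M M. norm (case p of (x, \<omega>) \<Rightarrow> (u (x + h) \<omega> - u x \<omega>)\<^sup>2) \<le>
      norm (2 * (case p of (x, \<omega>) \<Rightarrow> (u (x + h) \<omega>)\<^sup>2) + 2 * (case p of (x, \<omega>) \<Rightarrow> (u x \<omega>)\<^sup>2))"
      by (auto intro!: AE_I2)
  qed measurable
  define good where "good h \<longleftrightarrow> (AE x in lborel. expectation (\<lambda>\<omega>. Y x \<omega> * Y (x + h) \<omega>) \<le> C)" for h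
  have "AE h in lborel. good h"
    unfolding good_def by (rule AE_lborel_pair_shift[OF _ cov]) measurable
  then have ex: "\<exists>h\<in>ball 0 (1 / real (Suc n)). good h" for n by (rule AE_lborel_ex_ball) simp
  have "\<forall>n. \<exists>h. norm h < 1 / real (Suc n) \<and> good h"
  proof
    fix n show "\<exists>h. norm h < 1 / real (Suc n) \<and> good h" using ex[of n] by (auto simp: dist_norm)
  qed
  from choice[OF this] obtain h where h: "\<And>n. norm (h n) < 1 / real (Suc n)" "\<And>n. good (h n)"
    by blast
  have h0: "h \<longlonglongrightarrow> 0"
    by (rule Lim_null_comparison[OF _ LIMSEQ_inverse_real_of_nat])
       (use h(1) in \<open>auto simp: inverse_eq_divide intro!: always_eventually less_imp_le\<close>)
  \<comment> \<open>Expanding the square leaves two second moments, with equal integrals by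
    translation invariance, minus twice a covariance that is at most \<open>C\<close> on
    \<open>A\<close>. Off \<open>A\<close>, or when the shifted point leaves \<open>A\<close>, the
    product is 0, and there 0 \<le> C is used.\<close>
  have lower: "2 * (\<integral>x. \<sigma> x \<partial>lborel) - 2 * C * measure lborel A \<le> (\<integral>\<omega>. D (h n) \<omega> \<partial>M)" for n
  proof -
    have iA: "integrable lborel (indicat_real A)" using A_fin by (subst integrable_indicator_iff) auto
    have i\<sigma>: "integrable lborel (\<lambda>x. \<sigma> (x + h n))" by (rule integrable_lborel_translate[OF \<sigma>_int])
    have "(\<integral>x. \<sigma> (x + h n) + \<sigma> x - 2 * C * indicator A x \<partial>lborel) \<le> (\<integral>x. \<integral>\<omega>. (u (x + h n) \<omega> - u x \<omega>)\<^sup>2 \<partial>M \<partial>lborel)"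
    proof (rule integral_mono_AE)
      show "integrable lborel (\<lambda>x. \<integral>\<omega>. (u (x + h n) \<omega> - u x \<omega>)\<^sup>2 \<partial>M)"
        using LM.integrable_fst'[OF q_int[of "h n"]] by simp
      show "integrable lborel (\<lambda>x. \<sigma> (x + h n) + \<sigma> x - 2 * C * indicator A x)"
        using iA i\<sigma> \<sigma>_int by auto
      show "AE x in lborel. \<sigma> (x + h n) + \<sigma> x - 2 * C * indicator A x \<le> (\<integral>\<omega>. (u (x + h n) \<omega> - u x \<omega>)\<^sup>2 \<partial>M)"
        using h(2)[of n, unfolded good_def]
      proof eventually_elim
        case (elim x)
        have "(\<integral>\<omega>. (u (x + h n) \<omega> - u x \<omega>)\<^sup>2 \<partial>M) = (\<integral>\<omega>. (u (x + h n) \<omega>)\<^sup>2 + (u x \<omega>)\<^sup>2 - 2 * (u x \<omega> * u (x + h n) \<omega>) \<partial>M)"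
          by (intro Bochner_Integration.integral_cong) (auto simp: power2_diff)
        also have "\<dots> = \<sigma> (x + h n) + \<sigma> x - 2 * (\<integral>\<omega>. u x \<omega> * u (x + h n) \<omega> \<partial>M)"
          using u_int uu_int by (simp add: \<sigma>_def)
        finally have e: "(\<integral>\<omega>. (u (x + h n) \<omega> - u x \<omega>)\<^sup>2 \<partial>M) = \<sigma> (x + h n) + \<sigma> x - 2 * (\<integral>\<omega>. u x \<omega> * u (x + h n) \<omega> \<partial>M)" .
        have "(\<integral>\<omega>. u x \<omega> * u (x + h n) \<omega> \<partial>M) \<le> C * indicator A x"
          using elim C by (auto simp: u_def indicator_def)
        then show ?case unfolding e by simp
      qed
    qed
    also have "(\<integral>x. \<integral>\<omega>. (u (x + h n) \<omega> - u x \<omega>)\<^sup>2 \<partial>M \<partial>lborel) = (\<integral>\<omega>. D (h n) \<omega> \<partial>M)"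
      unfolding D_def using LM.integral_fst'[OF q_int[of "h n"]] LM.integral_snd[OF q_int[of "h n"]] by simp
    also have "(\<integral>x. \<sigma> (x + h n) + \<sigma> x - 2 * C * indicator A x \<partial>lborel) = (\<integral>x. \<sigma> (x + h n) \<partial>lborel) + (\<integral>x. \<sigma> x \<partial>lborel) - 2 * C * measure lborel A"
      using iA i\<sigma> \<sigma>_int by simp
    also have "(\<integral>x. \<sigma> (x + h n) \<partial>lborel) = (\<integral>x. \<sigma> x \<partial>lborel)" by (rule integral_lborel_translate) simp
    finally show ?thesis by simp
  qed
  have "(\<lambda>n. \<integral>\<omega>. D (h n) \<omega> \<partial>M) \<longlonglongrightarrow> (\<integral>\<omega>. 0 \<partial>M)"
  \<comment> \<open>The factor 4 is the 2 of \<open>square_diff_le_signed_square\<close> times the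
    two translates, each with the integral of the square of \<open>u\<close>.\<close>
  proof (rule integral_dominated_convergence[where w="\<lambda>\<omega>. 4 * (\<integral>x. (u x \<omega>)\<^sup>2 \<partial>lborel)"])
    show "integrable M (\<lambda>\<omega>. 4 * (\<integral>x. (u x \<omega>)\<^sup>2 \<partial>lborel))"
      using LM.integrable_snd[OF u20] by simp
    show "(\<lambda>\<omega>. D (h n) \<omega>) \<in> borel_measurable M" for n
      unfolding D_def using LM.integrable_snd[OF q_int[of "h n"]] by simp
    \<comment> \<open>The exceptional set does not depend on the shift: everything follows from
      integrability of the square of \<open>u\<close> in \<open>x\<close> for the given
      \<omega>.\<close>
    have Dw: "AE \<omega> in M. (\<forall>h. D h \<omega> \<le> 2 * (\<integral>x. \<bar>u (x + h) \<omega> * \<bar>u (x + h) \<omega>\<bar> - u x \<omega> * \<bar>u x \<omega>\<bar>\<bar> \<partial>lborel)) \<and>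
        integrable lborel (\<lambda>x. u x \<omega> * \<bar>u x \<omega>\<bar>)"
      using LM.AE_integrable_snd[OF u20] AE_space
    proof eventually_elim
      case (elim \<omega>)
      note [measurable] = usec2[OF elim(2)]
      have wi: "integrable lborel (\<lambda>x. u x \<omega> * \<bar>u x \<omega>\<bar>)"
        by (rule Bochner_Integration.integrable_bound[OF elim(1)]) (auto simp: abs_mult power2_eq_square)
      have "D h \<omega> \<le> (\<integral>x. 2 * \<bar>u (x + h) \<omega> * \<bar>u (x + h) \<omega>\<bar> - u x \<omega> * \<bar>u x \<omega>\<bar>\<bar> \<partial>lborel)" for h
        unfolding D_def
      proof (rule integral_mono')
        show "integrable lborel (\<lambda>x. 2 * \<bar>u (x + h) \<omega> * \<bar>u (x + h) \<omega>\<bar> - u x \<omega> * \<bar>u x \<omega>\<bar>\<bar>)"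
          using wi integrable_lborel_translate[OF wi, of h] by auto
        show "(u (x + h) \<omega> - u x \<omega>)\<^sup>2 \<le> 2 * \<bar>u (x + h) \<omega> * \<bar>u (x + h) \<omega>\<bar> - u x \<omega> * \<bar>u x \<omega>\<bar>\<bar>" for x
          by (rule square_diff_le_signed_square)
      qed simp
      then show ?case using wi by simp
    qed
    show "AE \<omega> in M. (\<lambda>n. D (h n) \<omega>) \<longlonglongrightarrow> 0"
      using Dw
    proof eventually_elim
      case (elim \<omega>)
      have "(\<lambda>n. \<integral>x. \<bar>u (x + h n) \<omega> * \<bar>u (x + h n) \<omega>\<bar> - u x \<omega> * \<bar>u x \<omega>\<bar>\<bar> \<partial>lborel) \<longlonglongrightarrow> 0"
        by (rule translation_continuity_L1[OF elim[THEN conjunct2] h0])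
      from tendsto_mult_left[OF this, of 2] have l: "(\<lambda>n. 2 * (\<integral>x. \<bar>u (x + h n) \<omega> * \<bar>u (x + h n) \<omega>\<bar> - u x \<omega> * \<bar>u x \<omega>\<bar>\<bar> \<partial>lborel)) \<longlonglongrightarrow> 0"
        by simp
      show ?case
        by (rule tendsto_sandwich[OF _ _ tendsto_const l]) (use elim in \<open>auto intro!: always_eventually simp: D_def\<close>)
    qed
    show "AE \<omega> in M. norm (D (h n) \<omega>) \<le> 4 * (\<integral>x. (u x \<omega>)\<^sup>2 \<partial>lborel)" for n
      using Dw AE_space
    proof eventually_elim
      case (elim \<omega>)
      note [measurable] = usec2[OF elim(2)]
      note wi = elim(1)[THEN conjunct2]
      note wi' = integrable_lborel_translate[OF wi, of "h n"]
      have "(\<integral>x. \<bar>u (x + h n) \<omega> * \<bar>u (x + h n) \<omega>\<bar> - u x \<omega> * \<bar>u x \<omega>\<bar>\<bar> \<partial>lborel) \<le>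
         (\<integral>x. \<bar>u (x + h n) \<omega> * \<bar>u (x + h n) \<omega>\<bar>\<bar> + \<bar>u x \<omega> * \<bar>u x \<omega>\<bar>\<bar> \<partial>lborel)"
        using wi wi' by (intro integral_mono) auto
      also have "\<dots> = (\<integral>x. \<bar>u (x + h n) \<omega> * \<bar>u (x + h n) \<omega>\<bar>\<bar> \<partial>lborel) + (\<integral>x. \<bar>u x \<omega> * \<bar>u x \<omega>\<bar>\<bar> \<partial>lborel)"
        using wi wi' by simp
      also have "(\<integral>x. \<bar>u (x + h n) \<omega> * \<bar>u (x + h n) \<omega>\<bar>\<bar> \<partial>lborel) = (\<integral>x. \<bar>u x \<omega> * \<bar>u x \<omega>\<bar>\<bar> \<partial>lborel)"
        by (rule integral_lborel_translate[of "\<lambda>x. \<bar>u x \<omega> * \<bar>u x \<omega>\<bar>\<bar>"]) measurable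
      also have "(\<integral>x. \<bar>u x \<omega> * \<bar>u x \<omega>\<bar>\<bar> \<partial>lborel) = (\<integral>x. (u x \<omega>)\<^sup>2 \<partial>lborel)"
        by (simp add: abs_mult power2_eq_square)
      finally have "D (h n) \<omega> \<le> 4 * (\<integral>x. (u x \<omega>)\<^sup>2 \<partial>lborel)"
        using elim(1)[THEN conjunct1, rule_format, of "h n"] by linarith
      moreover have "0 \<le> D (h n) \<omega>" by (simp add: D_def)
      ultimately show ?case by simp
    qed
  qed simp
  then have "2 * (\<integral>x. \<sigma> x \<partial>lborel) - 2 * C * measure lborel A \<le> 0"
    using lower by (intro LIMSEQ_le_const) auto
  then have le: "(\<integral>x. \<sigma> x \<partial>lborel) \<le> C * measure lborel A" by simp
  have "(\<integral>\<^sup>+x\<in>A. (\<integral>\<^sup>+\<omega>. ennreal ((Y x \<omega>)\<^sup>2) \<partial>M) \<partial>lborel) = (\<integral>\<^sup>+x. ennreal (\<sigma> x) \<partial>lborel)"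
  proof (rule nn_integral_cong)
    fix x :: 'b
    have "(\<integral>\<^sup>+\<omega>. ennreal ((u x \<omega>)\<^sup>2) \<partial>M) = ennreal (\<sigma> x)"
      unfolding \<sigma>_def by (rule nn_integral_eq_integral[OF u_int]) simp
    then show "(\<integral>\<^sup>+\<omega>. ennreal ((Y x \<omega>)\<^sup>2) \<partial>M) * indicator A x = ennreal (\<sigma> x)"
      by (cases "x \<in> A") (auto simp: u_def)
  qed
  also have "\<dots> = ennreal (\<integral>x. \<sigma> x \<partial>lborel)"
    by (rule nn_integral_eq_integral[OF \<sigma>_int]) (simp add: \<sigma>_def)
  also have "\<dots> \<le> ennreal (C * measure lborel A)" using le by (rule ennreal_leI)
  also have "\<dots> = ennreal C * emeasure lborel A"
    using A_fin C by (simp add: ennreal_mult emeasure_eq_ennreal_measure less_top)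
  finally show ?thesis .
qed

section \<open>From the trace class condition to locally integrable second moments\<close>

lemma nn_integral_lborel_reflect:
  fixes f :: "'a::euclidean_space \<Rightarrow> ennreal"
  assumes [measurable]: "f \<in> borel_measurable borel"
  shows "(\<integral>\<^sup>+z. f (x - z) \<partial>lborel) = (\<integral>\<^sup>+z. f z \<partial>lborel)"
proof -
  have "(\<integral>\<^sup>+z. f z \<partial>lborel) = (\<integral>\<^sup>+z. f z \<partial>density (distr lborel borel (\<lambda>z. x + (-1) *\<^sub>R z)) (\<lambda>_. ennreal (\<bar>-1\<bar> ^ DIM('a))))"
    by (subst lborel_affine[of "-1" x, symmetric]) auto
  also have "\<dots> = (\<integral>\<^sup>+z. f (x - z) \<partial>lborel)"
    by (simp add: density_1 nn_integral_distr)
  finally show ?thesis by simp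
qed

text \<open>The integral of the square of \<kappa>(x - z) in z does not depend on x, so
  integrability of this constant over a single ball forces it to be finite. It bounds the kernel
  because a product is at most the mean of the two squares.\<close>

lemma kern_bounded:
  fixes \<kappa> :: "'a::euclidean_space \<Rightarrow> real"
  assumes \<kappa>: "\<kappa> \<in> borel_measurable lborel" and ltc: "locally_trace_class \<kappa>"
  shows "\<exists>C\<ge>0. \<forall>x y. kern \<kappa> x y \<le> C"
proof -
  have [measurable]: "\<kappa> \<in> borel_measurable borel" using \<kappa> by simp
  define q where "q = (\<integral>\<^sup>+z. ennreal ((\<kappa> z)\<^sup>2) \<partial>lborel)"
  have q: "(\<integral>\<^sup>+z. ennreal ((\<kappa> (x - z))\<^sup>2) \<partial>lborel) = q" for x
    unfolding q_def by (rule nn_integral_lborel_reflect) measurable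
  have fin: "q < \<infinity>"
  proof (rule ccontr)
    assume "\<not> q < \<infinity>"
    then have q_top: "q = \<infinity>" by (simp add: less_top[symmetric])
    have "(\<integral>\<^sup>+x\<in>ball (0::'a) 1. q \<partial>lborel) < \<infinity>"
      using ltc[unfolded locally_trace_class_def, rule_format, of "ball 0 1"] by (simp add: q)
    then have "q * emeasure lborel (ball (0::'a) 1) < \<infinity>" by (simp add: nn_integral_cmult_indicator)
    then have "emeasure lborel (ball (0::'a) 1) = 0"
      unfolding q_top by (auto simp: ennreal_top_mult split: if_splits)
    then have "ball (0::'a) 1 \<in> null_sets lborel" by auto
    then show False using ball_not_null[of 1 "0::'a"] by simp
  qed
  define C where "C = enn2real q"
  have int: "integrable lborel (\<lambda>z. (\<kappa> (x - z))\<^sup>2)" "(\<integral>z. (\<kappa> (x - z))\<^sup>2 \<partial>lborel) = C" for x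
  proof -
    show i: "integrable lborel (\<lambda>z. (\<kappa> (x - z))\<^sup>2)"
      by (rule integrableI_bounded) (use q[of x] fin in auto)
    show "(\<integral>z. (\<kappa> (x - z))\<^sup>2 \<partial>lborel) = C"
      unfolding C_def q[of x, symmetric] by (rule integral_eq_nn_integral) auto
  qed
  have "kern \<kappa> x y \<le> C" for x y
  proof -
    have "kern \<kappa> x y \<le> (\<integral>z. ((\<kappa> (x - z))\<^sup>2 + (\<kappa> (y - z))\<^sup>2) / 2 \<partial>lborel)"
      unfolding kern_def
    proof (rule integral_mono')
      show "integrable lborel (\<lambda>z. ((\<kappa> (x - z))\<^sup>2 + (\<kappa> (y - z))\<^sup>2) / 2)" using int(1) by simp
      fix z
      have "0 \<le> (\<kappa> (x - z) - \<kappa> (y - z))\<^sup>2" by simp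
      then show "\<kappa> (x - z) * \<kappa> (y - z) \<le> ((\<kappa> (x - z))\<^sup>2 + (\<kappa> (y - z))\<^sup>2) / 2"
        by (simp add: power2_diff)
    qed simp
    also have "\<dots> = C" using int by simp
    finally show ?thesis .
  qed
  then show ?thesis by (intro exI[of _ C]) (auto simp: C_def)
qed

lemma centered_gaussian_square_integrable:
  assumes X[measurable]: "X \<in> borel_measurable P" and g: "centered_gaussian P X"
  shows "integrable P (\<lambda>\<omega>. (X \<omega>)\<^sup>2)"
  using g unfolding centered_gaussian_def
proof (elim disjE exE conjE)
  assume "AE \<omega> in P. X \<omega> = 0"
  then have "AE \<omega> in P. 0 = (X \<omega>)\<^sup>2" by auto
  then show ?thesis by (intro integrable_cong_AE_imp[OF integrable_zero]) measurable
next
  fix \<sigma> :: real assume \<sigma>: "0 < \<sigma>" and d: "distributed P lborel X (\<lambda>t. ennreal (normal_density 0 \<sigma> t))"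
  have "integrable lborel (\<lambda>x. normal_density 0 \<sigma> x * x\<^sup>2)"
    using integrable_normal_moment[OF \<sigma>, of 0 2] by simp
  then show ?thesis by (subst (asm) distributed_integrable[OF d]) auto
qed

text \<open>\<open>second_moment_le_covariance\<close> needs an a priori bound on the set
  considered. Pointwise finiteness of Gaussian second moments lets the sets \<open>A N\<close>
  exhaust the ball, and the resulting estimate does not depend on \<open>N\<close>.\<close>

lemma gaussian_field_second_moment:
  fixes Y :: "'a::euclidean_space \<Rightarrow> 'w \<Rightarrow> real"
  assumes P: "prob_space P" and Y: "gaussian_field P Y (kern \<kappa>)"
    and \<kappa>: "\<kappa> \<in> borel_measurable lborel" and ltc: "locally_trace_class \<kappa>"
  shows "(\<integral>\<^sup>+x\<in>ball 0 R. (\<integral>\<^sup>+\<omega>. ennreal ((Y x \<omega>)\<^sup>2) \<partial>P) \<partial>lborel) < \<infinity>"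
proof -
  interpret prob_space P by fact
  have Ym[measurable]: "(\<lambda>(x, \<omega>). Y x \<omega>) \<in> borel_measurable (lborel \<Otimes>\<^sub>M P)"
    using Y by (simp add: gaussian_field_def)
  have Ysec[measurable]: "Y x \<in> borel_measurable P" for x
    using measurable_compose[OF measurable_Pair1' Ym, of x] by simp
  have Yint: "integrable P (\<lambda>\<omega>. (Y x \<omega>)\<^sup>2)" for x
  proof (rule centered_gaussian_square_integrable[OF Ysec])
    have "\<forall>S c. finite S \<longrightarrow> centered_gaussian P (\<lambda>\<omega>. \<Sum>x\<in>S. c x * Y x \<omega>)"
      using Y unfolding gaussian_field_def by (elim conjE)
    from this[rule_format, of "{x}" "\<lambda>_. 1"] show "centered_gaussian P (Y x)" by simp
  qed
  obtain C where C: "0 \<le> C" "\<And>x y. kern \<kappa> x y \<le> C" using kern_bounded[OF \<kappa> ltc] by blast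
  have cov: "AE p in lborel \<Otimes>\<^sub>M lborel. expectation (\<lambda>\<omega>. Y (fst p) \<omega> * Y (snd p) \<omega>) \<le> C"
    using Y C(2) unfolding gaussian_field_def by (auto elim: eventually_mono)
  define s where "s x = expectation (\<lambda>\<omega>. (Y x \<omega>)\<^sup>2)" for x
  have [measurable]: "s \<in> borel_measurable borel" unfolding s_def[abs_def] by measurable
  define A where "A N = {x\<in>ball (0::'a) R. s x \<le> real N}" for N
  have A[measurable]: "A N \<in> sets borel" for N
  proof -
    have "{x\<in>space borel. x \<in> ball (0::'a) R \<and> s x \<le> real N} \<in> sets borel" by measurable
    then show ?thesis by (simp add: A_def)
  qed
  define S where "S x = (\<integral>\<^sup>+\<omega>. ennreal ((Y x \<omega>)\<^sup>2) \<partial>P)" for x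
  have [measurable]: "S \<in> borel_measurable borel" unfolding S_def[abs_def] by measurable
  have ball_fin: "emeasure lborel (ball (0::'a) R) < \<infinity>" using emeasure_bounded_finite[OF bounded_ball] by simp
  have bound: "(\<integral>\<^sup>+x\<in>A N. S x \<partial>lborel) \<le> ennreal C * emeasure lborel (ball (0::'a) R)" for N
  proof -
    have sub: "A N \<subseteq> ball 0 R" by (auto simp: A_def)
    have le: "emeasure lborel (A N) \<le> emeasure lborel (ball (0::'a) R)" by (rule emeasure_mono[OF sub]) simp
    have "(\<integral>\<^sup>+x\<in>A N. S x \<partial>lborel) \<le> ennreal C * emeasure lborel (A N)"
      unfolding S_def
    proof (rule second_moment_le_covariance[OF Ym Yint cov C(1) A])
      show "emeasure lborel (A N) < \<infinity>" using le ball_fin by simp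
      show "x \<in> A N \<Longrightarrow> expectation (\<lambda>\<omega>. (Y x \<omega>)\<^sup>2) \<le> real N" for x by (simp add: A_def s_def)
    qed
    also have "\<dots> \<le> ennreal C * emeasure lborel (ball (0::'a) R)" using le by (rule mult_left_mono) simp
    finally show ?thesis .
  qed
  have "(\<integral>\<^sup>+x\<in>ball 0 R. S x \<partial>lborel) \<le> (\<integral>\<^sup>+x. (SUP N. S x * indicator (A N) x) \<partial>lborel)"
  proof (rule nn_integral_mono)
    fix x :: 'a
    obtain N :: nat where N: "s x \<le> real N" using real_arch_simple by blast
    have "S x * indicator (ball 0 R) x = S x * indicator (A N) x"
      using N by (auto simp: A_def indicator_def)
    also have "\<dots> \<le> (SUP N. S x * indicator (A N) x)" by (rule SUP_upper) simp
    finally show "S x * indicator (ball 0 R) x \<le> (SUP N. S x * indicator (A N) x)" .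
  qed
  also have "\<dots> = (SUP N. \<integral>\<^sup>+x\<in>A N. S x \<partial>lborel)"
  proof (rule nn_integral_monotone_convergence_SUP)
    show "incseq (\<lambda>N x. S x * indicator (A N) x)"
      by (auto simp: incseq_def le_fun_def A_def indicator_def intro!: mult_left_mono)
  qed measurable
  also have "\<dots> \<le> ennreal C * emeasure lborel (ball (0::'a) R)" using bound by (rule SUP_least)
  also have "\<dots> < \<infinity>" using ball_fin by (simp add: ennreal_mult_less_top)
  finally show ?thesis by (simp add: S_def)
qed

text \<open>A second moment at one point is a functional of the law on the product space, through
  the projection at that point.\<close>

lemma nn_integral_square_eq_of_law:
  assumes X: "(\<lambda>(x, \<omega>). X x \<omega>) \<in> borel_measurable (lborel \<Otimes>\<^sub>M P)"
    and Y: "(\<lambda>(x, \<omega>). Y x \<omega>) \<in> borel_measurable (lborel \<Otimes>\<^sub>M P)"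
    and law: "distr P (Pi\<^sub>M UNIV (\<lambda>_. borel)) (\<lambda>\<omega> x. X x \<omega>) = distr P (Pi\<^sub>M UNIV (\<lambda>_. borel)) (\<lambda>\<omega> x. Y x \<omega>)"
  shows "(\<integral>\<^sup>+\<omega>. ennreal ((X x \<omega>)\<^sup>2) \<partial>P) = (\<integral>\<^sup>+\<omega>. ennreal ((Y x \<omega>)\<^sup>2) \<partial>P)"
proof -
  have *: "(\<integral>\<^sup>+\<omega>. ennreal ((Z x \<omega>)\<^sup>2) \<partial>P) = (\<integral>\<^sup>+y. ennreal ((y x)\<^sup>2) \<partial>distr P (Pi\<^sub>M UNIV (\<lambda>_. borel)) (\<lambda>\<omega> x. Z x \<omega>))"
    if Z: "(\<lambda>(x, \<omega>). Z x \<omega>) \<in> borel_measurable (lborel \<Otimes>\<^sub>M P)" for Z :: "'a \<Rightarrow> 'b \<Rightarrow> real"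
  proof -
    have Zs: "Z x \<in> borel_measurable P" for x
      using measurable_compose[OF measurable_Pair1' Z, of x] by simp
    have "(\<lambda>\<omega> x. Z x \<omega>) \<in> P \<rightarrow>\<^sub>M Pi\<^sub>M UNIV (\<lambda>_. borel)"
      by (rule measurable_PiM_single') (use Zs in auto)
    then show ?thesis by (subst nn_integral_distr) auto
  qed
  show ?thesis unfolding *[OF X] *[OF Y] law ..
qed

section \<open>Cylinder functions\<close>

lemma lipschitz_of_bounded_partials:
  fixes f :: "'a::euclidean_space \<Rightarrow> real"
  assumes d: "\<And>x. f differentiable (at x)"
    and b: "\<And>b. b \<in> Basis \<Longrightarrow> bounded (range (\<lambda>x. frechet_derivative f (at x) b))"
  shows "\<exists>L\<ge>0. \<forall>x y. \<bar>f x - f y\<bar> \<le> L * norm (x - y)"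
proof -
  have "\<forall>b\<in>Basis. \<exists>B. \<forall>x. \<bar>frechet_derivative f (at x) b\<bar> \<le> B"
    using b unfolding bounded_iff by auto
  from bchoice[OF this] obtain B where B: "\<And>b x. b \<in> Basis \<Longrightarrow> \<bar>frechet_derivative f (at x) b\<bar> \<le> B b" by blast
  define L where "L = (\<Sum>b\<in>(Basis :: 'a set). \<bar>B b\<bar>)"
  have "norm (f x - f y) \<le> L * norm (x - y)" for x y
  proof (rule differentiable_bound[OF convex_UNIV])
    fix z :: 'a
    show "(f has_derivative frechet_derivative f (at z)) (at z within UNIV)"
      using frechet_derivative_works[THEN iffD1, OF d[of z]] by simp
    show "onorm (frechet_derivative f (at z)) \<le> L"
    proof (rule onorm_le)
      fix v :: 'a
      have "frechet_derivative f (at z) v = (\<Sum>b\<in>Basis. frechet_derivative f (at z) b * (b \<bullet> v))"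
        using frechet_derivative_eq_grad[OF d, of z v] by (simp add: grad_def inner_sum_left)
      also have "\<bar>\<dots>\<bar> \<le> (\<Sum>b\<in>Basis. \<bar>frechet_derivative f (at z) b * (b \<bullet> v)\<bar>)" by (rule sum_abs)
      also have "\<dots> \<le> (\<Sum>b\<in>Basis. \<bar>B b\<bar> * norm v)"
        unfolding abs_mult
      proof (intro sum_mono mult_mono)
        fix b :: 'a assume b: "b \<in> Basis"
        show "\<bar>frechet_derivative f (at z) b\<bar> \<le> \<bar>B b\<bar>" using B[OF b] by (meson abs_ge_self order_trans)
        show "\<bar>b \<bullet> v\<bar> \<le> norm v" using Basis_le_norm[OF b, of v] by (simp add: inner_commute)
      qed auto
      finally show "norm (frechet_derivative f (at z) v) \<le> L * norm v" by (simp add: L_def sum_distrib_right)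
    qed
  qed auto
  moreover have "0 \<le> L" unfolding L_def by (intro sum_nonneg) auto
  ultimately show ?thesis by auto
qed

lemma smooth_bdd_imp:
  assumes "smooth_bdd h"
  shows "h differentiable (at x)" "\<exists>L\<ge>0. \<forall>x y. \<bar>h x - h y\<bar> \<le> L * norm (x - y)"
proof -
  have d: "h differentiable (at x)" for x
    using assms unfolding smooth_bdd_def smooth_fun_def by (metis empty_subsetI list.set(1) pderivs.simps(1))
  show "h differentiable (at x)" by (rule d)
  show "\<exists>L\<ge>0. \<forall>x y. \<bar>h x - h y\<bar> \<le> L * norm (x - y)"
  proof (rule lipschitz_of_bounded_partials[OF d])
    fix b :: 'a assume "b \<in> Basis"
    then show "bounded (range (\<lambda>x. frechet_derivative h (at x) b))"
      using assms[unfolded smooth_bdd_def, THEN conjunct2, rule_format, of "[b]"] by simp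
  qed
qed

lemma test_fun_imp:
  fixes \<phi> :: "'a::euclidean_space \<Rightarrow> real"
  assumes "test_fun \<phi>"
  shows test_fun_differentiable: "\<phi> differentiable (at x)"
    and test_fun_lipschitz: "\<exists>L\<ge>0. \<forall>x y. \<bar>\<phi> x - \<phi> y\<bar> \<le> L * norm (x - y)"
    and test_fun_support: "\<exists>S\<ge>0. \<forall>x. S \<le> norm x \<longrightarrow> \<phi> x = 0"
    and test_fun_measurable: "\<phi> \<in> borel_measurable borel"
proof -
  have sm: "smooth_fun \<phi>" and cs: "compact (closure {x. \<phi> x \<noteq> 0})" using assms by (auto simp: test_fun_def)
  have d: "\<phi> differentiable (at x)" for x
    using sm unfolding smooth_fun_def by (metis empty_subsetI list.set(1) pderivs.simps(1))
  show "\<phi> differentiable (at x)" by (rule d)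
  show "\<phi> \<in> borel_measurable borel"
    by (rule differentiable_imp_borel_measurable[OF d])
  let ?K = "closure {x. \<phi> x \<noteq> 0}"
  show "\<exists>L\<ge>0. \<forall>x y. \<bar>\<phi> x - \<phi> y\<bar> \<le> L * norm (x - y)"
  proof (rule lipschitz_of_bounded_partials[OF d])
    fix b :: 'a assume b: "b \<in> Basis"
    let ?D = "\<lambda>x. frechet_derivative \<phi> (at x) b"
    have "\<And>x. pderivs [b] \<phi> differentiable (at x)" using sm b unfolding smooth_fun_def by (metis empty_subsetI insert_subset list.set)
    then have "?D differentiable_on ?K" unfolding differentiable_on_def by (auto intro: differentiable_at_withinI)
    then have "compact (?D ` ?K)"
      by (intro compact_continuous_image differentiable_imp_continuous_on cs)
    then have bd: "bounded (?D ` ?K)" by (rule compact_imp_bounded)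
    have z: "?D x = 0" if "x \<notin> ?K" for x
    proof -
      have "(\<phi> has_derivative (\<lambda>_. 0)) (at x)"
      proof (rule has_derivative_transform_within_open[of "\<lambda>_. 0"])
        show "open (- ?K)" "x \<in> - ?K" using that by auto
        show "0 = \<phi> y" if "y \<in> - ?K" for y using that closure_subset[of "{x. \<phi> x \<noteq> 0}"] by auto
      qed simp
      then have "frechet_derivative \<phi> (at x) = (\<lambda>_. 0)" by (rule frechet_derivative_at[symmetric])
      then show ?thesis by simp
    qed
    have "range ?D \<subseteq> insert 0 (?D ` ?K)" using z by auto
    then show "bounded (range ?D)" using bd by (meson bounded_insert bounded_subset)
  qed
  obtain S where S: "\<And>x. x \<in> ?K \<Longrightarrow> norm x \<le> S" using compact_imp_bounded[OF cs] unfolding bounded_iff by auto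
  have "\<phi> x = 0" if "max 0 S + 1 \<le> norm x" for x
  proof (rule ccontr)
    assume "\<phi> x \<noteq> 0"
    then have "norm x \<le> S" using S closure_subset[of "{x. \<phi> x \<noteq> 0}"] by auto
    then show False using that by simp
  qed
  then show "\<exists>S\<ge>0. \<forall>x. S \<le> norm x \<longrightarrow> \<phi> x = 0" by (intro exI[of _ "max 0 S + 1"]) auto
qed

lemma finite_test_fun_support:
  assumes "test_fun \<phi>" "\<gamma> \<in> Gamma"
  shows "finite {x\<in>\<gamma>. \<phi> x \<noteq> 0}"
proof -
  obtain S where S: "\<forall>x. S \<le> norm x \<longrightarrow> \<phi> x = 0" using test_fun_support[OF assms(1)] by auto
  have "{x\<in>\<gamma>. \<phi> x \<noteq> 0} \<subseteq> \<gamma> \<inter> ball 0 S"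
    using S by (auto simp: not_le[symmetric])
  then show ?thesis using finite_Gamma[OF assms(2) bounded_ball] by (rule finite_subset)
qed

lemma pairing_insert:
  assumes "test_fun \<phi>" "\<gamma> \<in> Gamma" "x \<notin> \<gamma>"
  shows "pairing \<phi> (insert x \<gamma>) = pairing \<phi> \<gamma> + \<phi> x"
proof (cases "\<phi> x = 0")
  case True
  then have "{y\<in>insert x \<gamma>. \<phi> y \<noteq> 0} = {y\<in>\<gamma>. \<phi> y \<noteq> 0}" by auto
  then show ?thesis using True by (simp add: pairing_def)
next
  case False
  then have "{y\<in>insert x \<gamma>. \<phi> y \<noteq> 0} = insert x {y\<in>\<gamma>. \<phi> y \<noteq> 0}" by auto
  then show ?thesis using assms finite_test_fun_support[OF assms(1,2)] by (simp add: pairing_def)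
qed

text \<open>Positive and negative part are finite sums over the configuration, hence nonnegative
  integrals against its counting measure.\<close>

lemma pairing_measurable:
  fixes \<phi> :: "'a::euclidean_space \<Rightarrow> real"
  assumes \<phi>: "test_fun \<phi>"
  shows "pairing \<phi> \<in> borel_measurable Gamma_M"
proof -
  have [measurable]: "\<phi> \<in> borel_measurable borel" by (rule test_fun_measurable[OF \<phi>])
  have "(\<lambda>\<gamma>. enn2real (\<integral>\<^sup>+x. ennreal (\<phi> x) \<partial>count_space \<gamma>) - enn2real (\<integral>\<^sup>+x. ennreal (- \<phi> x) \<partial>count_space \<gamma>)) \<in> borel_measurable Gamma_M"
    by measurable
  also have "?this \<longleftrightarrow> pairing \<phi> \<in> borel_measurable Gamma_M"
  proof (rule measurable_cong)
    fix \<gamma> :: "'a set" assume "\<gamma> \<in> space Gamma_M"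
    then have fin: "finite {x\<in>\<gamma>. \<phi> x \<noteq> 0}" using finite_test_fun_support[OF \<phi>] by simp
    have *: "enn2real (\<integral>\<^sup>+x. ennreal (\<psi> x) \<partial>count_space \<gamma>) = (\<Sum>x\<in>{x\<in>\<gamma>. \<phi> x \<noteq> 0}. max 0 (\<psi> x))"
      if "\<And>x. \<phi> x = 0 \<Longrightarrow> \<psi> x = 0" for \<psi> :: "'a \<Rightarrow> real"
    proof -
      have "(\<integral>\<^sup>+x. ennreal (\<psi> x) \<partial>count_space \<gamma>) = (\<Sum>x\<in>{x\<in>\<gamma>. \<phi> x \<noteq> 0}. ennreal (\<psi> x))"
        by (rule nn_integral_count_space') (use fin that in auto)
      also have "\<dots> = (\<Sum>x\<in>{x\<in>\<gamma>. \<phi> x \<noteq> 0}. ennreal (max 0 (\<psi> x)))"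
        by (intro sum.cong) (auto simp: max_def ennreal_neg)
      also have "\<dots> = ennreal (\<Sum>x\<in>{x\<in>\<gamma>. \<phi> x \<noteq> 0}. max 0 (\<psi> x))" by (rule sum_ennreal) simp
      finally show ?thesis by (simp add: sum_nonneg)
    qed
    have "pairing \<phi> \<gamma> = (\<Sum>x\<in>{x\<in>\<gamma>. \<phi> x \<noteq> 0}. max 0 (\<phi> x) - max 0 (- \<phi> x))"
      unfolding pairing_def by (intro sum.cong) auto
    also have "\<dots> = enn2real (\<integral>\<^sup>+x. ennreal (\<phi> x) \<partial>count_space \<gamma>) - enn2real (\<integral>\<^sup>+x. ennreal (- \<phi> x) \<partial>count_space \<gamma>)"
      by (simp add: * sum_subtractf)
    finally show "enn2real (\<integral>\<^sup>+x. ennreal (\<phi> x) \<partial>count_space \<gamma>) - enn2real (\<integral>\<^sup>+x. ennreal (- \<phi> x) \<partial>count_space \<gamma>) = pairing \<phi> \<gamma>" ..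
  qed
  finally show ?thesis .
qed

text \<open>As a finite sum of scaled axis vectors, the argument of a cylinder function falls under
  the measurability and differentiability rules for sums.\<close>

lemma vec_lambda_eq_sum_axis: "(\<chi> i. c i) = (\<Sum>i\<in>UNIV. c i *\<^sub>R (axis i 1 :: real ^ 'n))"
  by (simp add: vec_eq_iff axis_def if_distrib[of "(*) _"] cong: if_cong)

locale cylinder =
  fixes F :: "'a::euclidean_space set \<Rightarrow> real" and \<phi> :: "'n::finite \<Rightarrow> 'a \<Rightarrow> real" and h :: "real ^ 'n \<Rightarrow> real"
  assumes cyl: "cyl_fun F \<phi> h"
begin

text \<open>The smooth substitute for \<open>F (insert x \<gamma>)\<close>: at points of \<gamma>,
  where insertion has no effect, it still adds the values of the test functions.\<close>

definition lift :: "'a set \<Rightarrow> 'a \<Rightarrow> real" where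
  "lift \<gamma> x = h (\<chi> i. pairing (\<phi> i) \<gamma> + \<phi> i x)"

lemma test: "test_fun (\<phi> i)" and h: "smooth_bdd h"
  using cyl by (auto simp: cyl_fun_def)

lemma F_insert: "\<gamma> \<in> Gamma \<Longrightarrow> x \<notin> \<gamma> \<Longrightarrow> F (insert x \<gamma>) = lift \<gamma> x"
  using cyl by (simp add: cyl_fun_def lift_def pairing_insert[OF test])

lemma h_meas[measurable]: "h \<in> borel_measurable borel"
  by (rule differentiable_imp_borel_measurable[OF smooth_bdd_imp(1)[OF h]])

lemma \<phi>_meas[measurable]: "\<phi> i \<in> borel_measurable borel" by (rule test_fun_measurable[OF test])

lemma pairing_meas[measurable]: "pairing (\<phi> i) \<in> borel_measurable Gamma_M" by (rule pairing_measurable[OF test])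

lemma F_meas[measurable]: "F \<in> borel_measurable Gamma_M"
proof -
  have "(\<lambda>\<gamma>. h (\<Sum>i\<in>UNIV. pairing (\<phi> i) \<gamma> *\<^sub>R axis i 1)) \<in> borel_measurable Gamma_M" by measurable
  also have "?this \<longleftrightarrow> F \<in> borel_measurable Gamma_M"
    using cyl by (intro measurable_cong) (simp add: cyl_fun_def vec_lambda_eq_sum_axis)
  finally show ?thesis .
qed

lemma lift_meas[measurable]: "(\<lambda>(\<gamma>, x). lift \<gamma> x) \<in> borel_measurable (Gamma_M \<Otimes>\<^sub>M borel)"
  unfolding lift_def vec_lambda_eq_sum_axis by measurable

lemma lift_differentiable: "lift \<gamma> differentiable (at x)"
proof -
  have 1: "(\<lambda>x. \<Sum>i\<in>UNIV. (pairing (\<phi> i) \<gamma> + \<phi> i x) *\<^sub>R (axis i 1 :: real ^ 'n)) differentiable (at x)"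
    by (intro differentiable_sum differentiable_scaleR differentiable_add ballI test_fun_differentiable[OF test]) auto
  have "lift \<gamma> = h \<circ> (\<lambda>x. \<Sum>i\<in>UNIV. (pairing (\<phi> i) \<gamma> + \<phi> i x) *\<^sub>R axis i 1)"
    by (auto simp: lift_def vec_lambda_eq_sum_axis)
  then show ?thesis using differentiable_chain_at[OF 1 smooth_bdd_imp(1)[OF h]] by simp
qed

lemma lift_lipschitz: "\<exists>L\<ge>0. \<forall>\<gamma> x y. \<bar>lift \<gamma> x - lift \<gamma> y\<bar> \<le> L * norm (x - y)"
proof -
  obtain Lh where Lh: "0 \<le> Lh" "\<And>u v. \<bar>h u - h v\<bar> \<le> Lh * norm (u - v)" using smooth_bdd_imp(2)[OF h] by blast
  have "\<forall>i. \<exists>L. 0 \<le> L \<and> (\<forall>x y. \<bar>\<phi> i x - \<phi> i y\<bar> \<le> L * norm (x - y))" using test_fun_lipschitz[OF test] by blast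
  from choice[OF this] obtain L where L: "\<And>i. 0 \<le> L i" "\<And>i x y. \<bar>\<phi> i x - \<phi> i y\<bar> \<le> L i * norm (x - y)" by blast
  have "\<bar>lift \<gamma> x - lift \<gamma> y\<bar> \<le> (Lh * sum L UNIV) * norm (x - y)" for \<gamma> x y
  proof -
    have "\<bar>lift \<gamma> x - lift \<gamma> y\<bar> \<le> Lh * norm ((\<chi> i. pairing (\<phi> i) \<gamma> + \<phi> i x) - (\<chi> i. pairing (\<phi> i) \<gamma> + \<phi> i y))"
      unfolding lift_def by (rule Lh)
    also have "\<dots> \<le> Lh * (\<Sum>i\<in>UNIV. L i * norm (x - y))"
    proof (rule mult_left_mono[OF _ Lh(1)])
      have "norm ((\<chi> i. pairing (\<phi> i) \<gamma> + \<phi> i x) - (\<chi> i. pairing (\<phi> i) \<gamma> + \<phi> i y)) \<le>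
         (\<Sum>i\<in>UNIV. \<bar>((\<chi> i. pairing (\<phi> i) \<gamma> + \<phi> i x) - (\<chi> i. pairing (\<phi> i) \<gamma> + \<phi> i y)) $ i\<bar>)"
        by (rule norm_le_l1_cart)
      also have "\<dots> \<le> (\<Sum>i\<in>UNIV. L i * norm (x - y))" using L(2) by (intro sum_mono) simp
      finally show "norm ((\<chi> i. pairing (\<phi> i) \<gamma> + \<phi> i x) - (\<chi> i. pairing (\<phi> i) \<gamma> + \<phi> i y)) \<le> (\<Sum>i\<in>UNIV. L i * norm (x - y))" .
    qed
    finally show ?thesis by (simp add: sum_distrib_right mult.assoc)
  qed
  then show ?thesis using Lh(1) L(1) by (intro exI[of _ "Lh * sum L UNIV"]) (auto intro!: mult_nonneg_nonneg sum_nonneg)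
qed

lemma lift_support: "\<exists>S\<ge>0. \<forall>\<gamma> x y. S \<le> norm x \<longrightarrow> S \<le> norm y \<longrightarrow> lift \<gamma> x = lift \<gamma> y"
proof -
  have "\<forall>i. \<exists>S. 0 \<le> S \<and> (\<forall>x. S \<le> norm x \<longrightarrow> \<phi> i x = 0)" using test_fun_support[OF test] by blast
  from choice[OF this] obtain S where S: "\<And>i. 0 \<le> S i" "\<And>i x. S i \<le> norm x \<Longrightarrow> \<phi> i x = 0" by blast
  have le: "S i \<le> sum S UNIV" for i using S(1) by (intro member_le_sum) auto
  have z: "\<phi> i x = 0" if "sum S UNIV \<le> norm x" for i x
    using S(2)[of i x] le[of i] that by linarith
  show ?thesis
    using z S(1) by (intro exI[of _ "sum S UNIV"]) (auto simp: lift_def intro!: sum_nonneg)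
qed

text \<open>Local finiteness gives \<open>x\<close> a neighbourhood free of points of \<gamma>, and
  there \<open>F (insert z \<gamma>)\<close> and \<open>lift \<gamma> z\<close> coincide.\<close>

lemma grad_F_insert:
  assumes \<gamma>: "\<gamma> \<in> Gamma" and x: "x \<notin> \<gamma>"
  shows "grad (\<lambda>z. F (insert z \<gamma>)) x = grad (lift \<gamma>) x"
proof -
  have fin: "finite (\<gamma> \<inter> ball x 1)" using \<gamma> by (rule finite_Gamma) simp
  define U where "U = ball x 1 - \<gamma> \<inter> ball x 1"
  have U: "open U" "x \<in> U" using fin x by (auto simp: U_def finite_imp_closed)
  have "(lift \<gamma> has_derivative frechet_derivative (lift \<gamma>) (at x)) (at x)"
    using lift_differentiable frechet_derivative_works by blast
  then have "((\<lambda>z. F (insert z \<gamma>)) has_derivative frechet_derivative (lift \<gamma>) (at x)) (at x)"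
    by (rule has_derivative_transform_within_open[OF _ U]) (auto simp: U_def F_insert[OF \<gamma>])
  then have "frechet_derivative (\<lambda>z. F (insert z \<gamma>)) (at x) = frechet_derivative (lift \<gamma>) (at x)"
    by (rule frechet_derivative_at[symmetric])
  then show ?thesis by (simp add: grad_def)
qed

end

text \<open>Each coordinate is a sequential limit of jointly measurable difference
  quotients.\<close>

lemma borel_measurable_grad:
  fixes v :: "'p \<Rightarrow> 'a::euclidean_space \<Rightarrow> real"
  assumes v[measurable]: "(\<lambda>(p, x). v p x) \<in> borel_measurable (M \<Otimes>\<^sub>M borel)"
    and d: "\<And>p x. v p differentiable (at x)"
  shows "(\<lambda>(p, x). grad (v p) x) \<in> borel_measurable (M \<Otimes>\<^sub>M borel)"
  unfolding borel_measurable_euclidean_space[where f="\<lambda>(p, x). grad (v p) x"]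
proof
  fix b :: 'a assume "b \<in> Basis"
  have t: "(\<lambda>n. 1 / real (Suc n)) \<longlonglongrightarrow> 0" "\<And>n. 0 < 1 / real (Suc n)"
    using LIMSEQ_inverse_real_of_nat by (simp_all add: inverse_eq_divide)
  show "(\<lambda>q. (case q of (p, x) \<Rightarrow> grad (v p) x) \<bullet> b) \<in> borel_measurable (M \<Otimes>\<^sub>M borel)"
  proof (rule borel_measurable_LIMSEQ_real)
    show "(\<lambda>n. (v (fst q) (snd q + (1 / real (Suc n)) *\<^sub>R b) - v (fst q) (snd q)) / (1 / real (Suc n))) \<longlonglongrightarrow> (case q of (p, x) \<Rightarrow> grad (v p) x) \<bullet> b" for q
      unfolding split_beta' by (rule difference_quotient_tendsto_grad[OF d t])
    show "(\<lambda>q. (v (fst q) (snd q + (1 / real (Suc n)) *\<^sub>R b) - v (fst q) (snd q)) / (1 / real (Suc n))) \<in> borel_measurable (M \<Otimes>\<^sub>M borel)" for n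
      by measurable
  qed
qed

section \<open>Convergence of the forms\<close>

lemma ennreal_max_zero: "ennreal (max 0 x) = ennreal x"
  by (auto simp: max_def ennreal_neg)

text \<open>The inner measure varies with \<gamma>, being \<open>count_space \<gamma>\<close> in one
  application, so integrability is expressed by the two iterated nonnegative integrals. This allows
  a formula for nonnegative functions to be transferred to iterated Bochner integrals.\<close>

lemma integral_eq_pos_part_minus_neg_part:
  fixes N :: "'b \<Rightarrow> 'c measure" and \<phi> :: "'b \<Rightarrow> 'c \<Rightarrow> real"
  assumes m: "\<And>\<gamma>. \<gamma> \<in> space M \<Longrightarrow> \<phi> \<gamma> \<in> borel_measurable (N \<gamma>)"
    and P[measurable]: "(\<lambda>\<gamma>. \<integral>\<^sup>+x. ennreal (\<phi> \<gamma> x) \<partial>N \<gamma>) \<in> borel_measurable M"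
    and Q[measurable]: "(\<lambda>\<gamma>. \<integral>\<^sup>+x. ennreal (- \<phi> \<gamma> x) \<partial>N \<gamma>) \<in> borel_measurable M"
    and fin: "(\<integral>\<^sup>+\<gamma>. \<integral>\<^sup>+x. ennreal (\<phi> \<gamma> x) \<partial>N \<gamma> \<partial>M) < \<infinity>" "(\<integral>\<^sup>+\<gamma>. \<integral>\<^sup>+x. ennreal (- \<phi> \<gamma> x) \<partial>N \<gamma> \<partial>M) < \<infinity>"
  shows "(\<integral>\<gamma>. (\<integral>x. \<phi> \<gamma> x \<partial>N \<gamma>) \<partial>M) =
    enn2real (\<integral>\<^sup>+\<gamma>. \<integral>\<^sup>+x. ennreal (\<phi> \<gamma> x) \<partial>N \<gamma> \<partial>M) - enn2real (\<integral>\<^sup>+\<gamma>. \<integral>\<^sup>+x. ennreal (- \<phi> \<gamma> x) \<partial>N \<gamma> \<partial>M)"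
proof -
  define p where "p \<gamma> = (\<integral>\<^sup>+x. ennreal (\<phi> \<gamma> x) \<partial>N \<gamma>)" for \<gamma>
  define q where "q \<gamma> = (\<integral>\<^sup>+x. ennreal (- \<phi> \<gamma> x) \<partial>N \<gamma>)" for \<gamma>
  have [measurable]: "p \<in> borel_measurable M" "q \<in> borel_measurable M" using P Q by (simp_all add: p_def[abs_def] q_def[abs_def])
  have pf: "AE \<gamma> in M. p \<gamma> \<noteq> \<infinity>" and qf: "AE \<gamma> in M. q \<gamma> \<noteq> \<infinity>"
    by (rule nn_integral_noteq_infinite; use fin in \<open>simp add: p_def q_def\<close>)+
  have part: "integrable M (\<lambda>\<gamma>. enn2real (u \<gamma>))" "(\<integral>\<gamma>. enn2real (u \<gamma>) \<partial>M) = enn2real (\<integral>\<^sup>+\<gamma>. u \<gamma> \<partial>M)"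
    if [measurable]: "u \<in> borel_measurable M" and uf: "AE \<gamma> in M. u \<gamma> \<noteq> \<infinity>" and ui: "(\<integral>\<^sup>+\<gamma>. u \<gamma> \<partial>M) < \<infinity>" for u
  proof -
    have e: "(\<integral>\<^sup>+\<gamma>. ennreal (enn2real (u \<gamma>)) \<partial>M) = (\<integral>\<^sup>+\<gamma>. u \<gamma> \<partial>M)"
      by (rule nn_integral_cong_AE) (use uf in eventually_elim, simp add: less_top)
    show "integrable M (\<lambda>\<gamma>. enn2real (u \<gamma>))" by (rule integrableI_nonneg) (use e ui in auto)
    show "(\<integral>\<gamma>. enn2real (u \<gamma>) \<partial>M) = enn2real (\<integral>\<^sup>+\<gamma>. u \<gamma> \<partial>M)"
      by (subst integral_eq_nn_integral) (auto simp: e)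
  qed
  have pi: "(\<integral>\<^sup>+\<gamma>. p \<gamma> \<partial>M) < \<infinity>" and qi: "(\<integral>\<^sup>+\<gamma>. q \<gamma> \<partial>M) < \<infinity>" using fin by (simp_all add: p_def q_def)
  \<comment> \<open>Where one part is infinite the Bochner integral takes its default value 0; the
    finite means make this a null set of \<gamma>.\<close>
  have I: "(\<integral>x. \<phi> \<gamma> x \<partial>N \<gamma>) = (if p \<gamma> \<noteq> \<infinity> \<and> q \<gamma> \<noteq> \<infinity> then enn2real (p \<gamma>) - enn2real (q \<gamma>) else 0)"
    if \<gamma>: "\<gamma> \<in> space M" for \<gamma>
  proof (cases "p \<gamma> \<noteq> \<infinity> \<and> q \<gamma> \<noteq> \<infinity>")
    case True
    then have "integrable (N \<gamma>) (\<phi> \<gamma>)" using m[OF \<gamma>] unfolding real_integrable_def p_def q_def by simp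
    then show ?thesis using True by (simp add: real_lebesgue_integral_def p_def q_def)
  next
    case False
    then have "\<not> integrable (N \<gamma>) (\<phi> \<gamma>)" unfolding real_integrable_def p_def q_def by auto
    then show ?thesis unfolding if_not_P[OF False] by (rule not_integrable_integral_eq)
  qed
  have "(\<integral>\<gamma>. (\<integral>x. \<phi> \<gamma> x \<partial>N \<gamma>) \<partial>M) = (\<integral>\<gamma>. (if p \<gamma> \<noteq> \<infinity> \<and> q \<gamma> \<noteq> \<infinity> then enn2real (p \<gamma>) - enn2real (q \<gamma>) else 0) \<partial>M)"
    by (rule Bochner_Integration.integral_cong[OF refl]) (rule I)
  also have "\<dots> = (\<integral>\<gamma>. enn2real (p \<gamma>) - enn2real (q \<gamma>) \<partial>M)"
  proof (rule integral_cong_AE)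
    show "AE \<gamma> in M. (if p \<gamma> \<noteq> \<infinity> \<and> q \<gamma> \<noteq> \<infinity> then enn2real (p \<gamma>) - enn2real (q \<gamma>) else 0) = enn2real (p \<gamma>) - enn2real (q \<gamma>)"
      using pf qf by eventually_elim simp
  qed measurable
  also have "\<dots> = enn2real (\<integral>\<^sup>+\<gamma>. p \<gamma> \<partial>M) - enn2real (\<integral>\<^sup>+\<gamma>. q \<gamma> \<partial>M)"
    using part[of p] part[of q] pf qf pi qi by simp
  finally show ?thesis by (simp add: p_def q_def)
qed

text \<open>Positive and negative part are treated together through a sign c. The weight is max 0 r
  because r is nonnegative only almost everywhere; under \<open>ennreal\<close> both are the
  same.\<close>

lemma (in cox_papangelou) mecke_cox_integral:
  fixes f :: "'a set \<Rightarrow> 'a \<Rightarrow> real"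
  assumes f[measurable]: "(\<lambda>(\<gamma>, x). f \<gamma> x) \<in> borel_measurable (Gamma_M \<Otimes>\<^sub>M borel)"
    and fin: "(\<integral>\<^sup>+\<gamma>. \<integral>\<^sup>+x. ennreal \<bar>max 0 (r x \<gamma>) * f (insert x \<gamma>) x\<bar> \<partial>lborel \<partial>\<mu>) < \<infinity>"
  shows "(\<integral>\<gamma>. (\<integral>x. f \<gamma> x \<partial>count_space \<gamma>) \<partial>\<mu>) = (\<integral>\<gamma>. (\<integral>x. max 0 (r x \<gamma>) * f (insert x \<gamma>) x \<partial>lborel) \<partial>\<mu>)"
proof -
  have *: "(\<integral>\<^sup>+\<gamma>. \<integral>\<^sup>+x. ennreal (c * f \<gamma> x) \<partial>count_space \<gamma> \<partial>\<mu>) = (\<integral>\<^sup>+\<gamma>. \<integral>\<^sup>+x. ennreal (c * (max 0 (r x \<gamma>) * f (insert x \<gamma>) x)) \<partial>lborel \<partial>\<mu>)" for c :: real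
  proof -
    have "(\<integral>\<^sup>+\<gamma>. \<integral>\<^sup>+x. ennreal (c * f \<gamma> x) \<partial>count_space \<gamma> \<partial>\<mu>) = (\<integral>\<^sup>+\<gamma>. \<integral>\<^sup>+x. ennreal (r x \<gamma>) * ennreal (c * f (insert x \<gamma>) x) \<partial>lborel \<partial>\<mu>)"
      by (rule mecke_cox) measurable
    also have "\<dots> = (\<integral>\<^sup>+\<gamma>. \<integral>\<^sup>+x. ennreal (c * (max 0 (r x \<gamma>) * f (insert x \<gamma>) x)) \<partial>lborel \<partial>\<mu>)"
    proof (intro nn_integral_cong)
      fix \<gamma> x
      have "c * (max 0 (r x \<gamma>) * f (insert x \<gamma>) x) = max 0 (r x \<gamma>) * (c * f (insert x \<gamma>) x)" by (simp add: mult_ac)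
      then show "ennreal (r x \<gamma>) * ennreal (c * f (insert x \<gamma>) x) = ennreal (c * (max 0 (r x \<gamma>) * f (insert x \<gamma>) x))"
        by (simp only: ennreal_mult'[OF max.cobounded1] ennreal_max_zero)
    qed
    finally show ?thesis .
  qed
  have fin': "(\<integral>\<^sup>+\<gamma>. \<integral>\<^sup>+x. ennreal (c * (max 0 (r x \<gamma>) * f (insert x \<gamma>) x)) \<partial>lborel \<partial>\<mu>) < \<infinity>" if "\<bar>c\<bar> = 1" for c :: real
  proof -
    have "(\<integral>\<^sup>+\<gamma>. \<integral>\<^sup>+x. ennreal (c * (max 0 (r x \<gamma>) * f (insert x \<gamma>) x)) \<partial>lborel \<partial>\<mu>) \<le> (\<integral>\<^sup>+\<gamma>. \<integral>\<^sup>+x. ennreal \<bar>max 0 (r x \<gamma>) * f (insert x \<gamma>) x\<bar> \<partial>lborel \<partial>\<mu>)"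
    proof (intro nn_integral_mono ennreal_leI)
      fix \<gamma> x
      have "c * (max 0 (r x \<gamma>) * f (insert x \<gamma>) x) \<le> \<bar>c * (max 0 (r x \<gamma>) * f (insert x \<gamma>) x)\<bar>" by (rule abs_ge_self)
      also have "\<dots> = \<bar>max 0 (r x \<gamma>) * f (insert x \<gamma>) x\<bar>" unfolding abs_mult[of c] that by simp
      finally show "c * (max 0 (r x \<gamma>) * f (insert x \<gamma>) x) \<le> \<bar>max 0 (r x \<gamma>) * f (insert x \<gamma>) x\<bar>" .
    qed
    then show ?thesis using fin by simp
  qed
  have m\<mu>: "u \<in> borel_measurable Gamma_M \<Longrightarrow> u \<in> borel_measurable \<mu>" for u :: "'a set \<Rightarrow> ennreal"
    by (simp cong: measurable_cong_sets)
  have m1: "(\<lambda>\<gamma>. \<integral>\<^sup>+x. ennreal (c * f \<gamma> x) \<partial>count_space \<gamma>) \<in> borel_measurable \<mu>" for c :: real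
    by (rule m\<mu>, rule nn_integral_count_space_Gamma_measurable) measurable
  have m2: "(\<lambda>\<gamma>. \<integral>\<^sup>+x. ennreal (c * (max 0 (r x \<gamma>) * f (insert x \<gamma>) x)) \<partial>lborel) \<in> borel_measurable \<mu>" for c :: real
    by (rule m\<mu>) measurable
  have m3: "(\<lambda>x. max 0 (r x \<gamma>) * f (insert x \<gamma>) x) \<in> borel_measurable lborel" if "\<gamma> \<in> space \<mu>" for \<gamma>
  proof -
    have [measurable]: "\<gamma> \<in> space Gamma_M" using that by simp
    show ?thesis by measurable
  qed
  have "(\<integral>\<gamma>. (\<integral>x. f \<gamma> x \<partial>count_space \<gamma>) \<partial>\<mu>) =
    enn2real (\<integral>\<^sup>+\<gamma>. \<integral>\<^sup>+x. ennreal (f \<gamma> x) \<partial>count_space \<gamma> \<partial>\<mu>) - enn2real (\<integral>\<^sup>+\<gamma>. \<integral>\<^sup>+x. ennreal (- f \<gamma> x) \<partial>count_space \<gamma> \<partial>\<mu>)"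
    using *[of 1] *[of "- 1"] fin'[of 1] fin'[of "- 1"] m1[of 1] m1[of "- 1"]
    by (intro integral_eq_pos_part_minus_neg_part) simp_all
  also have "\<dots> = enn2real (\<integral>\<^sup>+\<gamma>. \<integral>\<^sup>+x. ennreal (max 0 (r x \<gamma>) * f (insert x \<gamma>) x) \<partial>lborel \<partial>\<mu>)
     - enn2real (\<integral>\<^sup>+\<gamma>. \<integral>\<^sup>+x. ennreal (- (max 0 (r x \<gamma>) * f (insert x \<gamma>) x)) \<partial>lborel \<partial>\<mu>)"
    using *[of 1] *[of "- 1"] by simp
  also have "\<dots> = (\<integral>\<gamma>. (\<integral>x. max 0 (r x \<gamma>) * f (insert x \<gamma>) x \<partial>lborel) \<partial>\<mu>)"
    using fin'[of 1] fin'[of "- 1"] m2[of 1] m2[of "- 1"] m3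
    by (intro integral_eq_pos_part_minus_neg_part[symmetric]) simp_all
  finally show ?thesis .
qed

lemma (in cox_papangelou) E_eps_tendsto:
  fixes a :: "'a \<Rightarrow> real" and e1 :: 'a and F G :: "'a set \<Rightarrow> real"
    and \<phi>F :: "'n::finite \<Rightarrow> 'a \<Rightarrow> real" and hF :: "real ^ 'n \<Rightarrow> real"
    and \<phi>G :: "'m::finite \<Rightarrow> 'a \<Rightarrow> real" and hG :: "real ^ 'm \<Rightarrow> real"
  assumes a_nonneg: "\<And>x. a x \<ge> 0" and a_bdd: "bounded (range a)"
    and a_meas: "a \<in> borel_measurable lborel" and a_supp: "compact (closure {x. a x \<noteq> 0})"
    and a_radial: "\<exists>a_rad. \<forall>x. a x = a_rad (norm x)" and e1: "e1 \<in> Basis"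
    and F_cyl: "cyl_fun F \<phi>F hF" and G_cyl: "cyl_fun G \<phi>G hG"
  shows "((\<lambda>\<epsilon>. E_eps \<mu> a r \<epsilon> F G) \<longlongrightarrow> E_0 \<mu> a r e1 F G) (at_right 0)"
proof -
  interpret F: cylinder F \<phi>F hF by unfold_locales (rule F_cyl)
  interpret G: cylinder G \<phi>G hG by unfold_locales (rule G_cyl)
  obtain KF where KF: "0 \<le> KF" "\<And>\<gamma> x y. \<bar>F.lift \<gamma> x - F.lift \<gamma> y\<bar> \<le> KF * norm (x - y)"
    using F.lift_lipschitz by blast
  obtain KG where KG: "0 \<le> KG" "\<And>\<gamma> x y. \<bar>G.lift \<gamma> x - G.lift \<gamma> y\<bar> \<le> KG * norm (x - y)"
    using G.lift_lipschitz by blast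
  define K0 where "K0 = max KF KG"
  have K0: "0 \<le> K0" "KF \<le> K0" "KG \<le> K0" using KF(1) by (auto simp: K0_def)
  have lipF: "\<bar>F.lift \<gamma> x - F.lift \<gamma> y\<bar> \<le> K0 * norm (x - y)" for \<gamma> x y
    using KF(2)[of \<gamma> x y] mult_right_mono[OF K0(2) norm_ge_zero[of "x - y"]] by linarith
  have lipG: "\<bar>G.lift \<gamma> x - G.lift \<gamma> y\<bar> \<le> K0 * norm (x - y)" for \<gamma> x y
    using KG(2)[of \<gamma> x y] mult_right_mono[OF K0(3) norm_ge_zero[of "x - y"]] by linarith
  obtain S where S: "0 \<le> S" "\<And>\<gamma> x y. S \<le> norm x \<Longrightarrow> S \<le> norm y \<Longrightarrow> F.lift \<gamma> x = F.lift \<gamma> y"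
    using F.lift_support by blast
  obtain A where A: "\<And>x. a x \<le> A" using a_bdd unfolding bounded_iff by (auto intro: abs_le_D1)
  obtain R0 where R0: "\<And>x. x \<in> closure {x. a x \<noteq> 0} \<Longrightarrow> norm x \<le> R0"
    using compact_imp_bounded[OF a_supp] unfolding bounded_iff by blast
  define R where "R = max R0 1"
  have R: "0 < R" by (simp add: R_def)
  have aR: "a x = 0" if "R < norm x" for x
  proof (rule ccontr)
    assume "a x \<noteq> 0"
    then have "norm x \<le> R0" using R0 closure_subset[of "{x. a x \<noteq> 0}"] by blast
    then show False using that by (simp add: R_def)
  qed
  \<comment> \<open>\<open>r_mean_finite\<close> speaks of balls of integer radius; this one
    contains all points that can matter.\<close>
  obtain n :: nat where n: "S + 2 * R + 2 \<le> real n" using real_arch_simple by blast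
  have am[measurable]: "a \<in> borel_measurable borel" using a_meas by simp
  have aem[measurable]: "a_eps a t \<in> borel_measurable borel" for t unfolding a_eps_def[abs_def] by measurable
  have rad: "a x = a y" if "norm x = norm y" for x y
  proof -
    obtain a_rad where "\<forall>x. a x = a_rad (norm x)" using a_radial ..
    then show ?thesis using that by simp
  qed
  define m where "m = (\<integral>h. a h * (h \<bullet> e1)\<^sup>2 \<partial>lborel)"
  \<comment> \<open>The estimates for a fixed configuration need an intensity that is nonnegative at
    every point. Values of r at or below 0 are cut off by \<open>c_eps\<close> in any case.\<close>
  define \<rho> where "\<rho> \<gamma> x = max 0 (r x \<gamma>)" for \<gamma> x
  have \<rho>_meas[measurable]: "(\<lambda>(\<gamma>, x). \<rho> \<gamma> x) \<in> borel_measurable (Gamma_M \<Otimes>\<^sub>M borel)"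
    unfolding \<rho>_def by measurable
  define T where "T \<gamma> = (\<integral>\<^sup>+x\<in>ball 0 (real n). ennreal (r x \<gamma>) \<partial>lborel)" for \<gamma>
  have [measurable]: "T \<in> borel_measurable Gamma_M" unfolding T_def[abs_def] by measurable
  have T_fin: "(\<integral>\<^sup>+\<gamma>. T \<gamma> \<partial>\<mu>) < \<infinity>" unfolding T_def by (rule r_mean_finite)
  have AE_T: "AE \<gamma> in \<mu>. T \<gamma> < \<infinity>"
  proof -
    have "AE \<gamma> in \<mu>. T \<gamma> \<noteq> \<infinity>" by (rule nn_integral_noteq_infinite) (use T_fin in auto)
    then show ?thesis by eventually_elim (simp add: less_top)
  qed
  have AE_Gamma: "AE \<gamma> in \<mu>. \<gamma> \<in> Gamma" using AE_space[of \<mu>] by simp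
  have \<rho>_T: "(\<integral>\<^sup>+x. ennreal (norm (indicator (ball 0 (S + 2 * R + 2)) x * \<rho> \<gamma> x)) \<partial>lborel) \<le> T \<gamma>" for \<gamma>
    unfolding T_def
  proof (rule nn_integral_mono)
    fix x :: 'a
    have "norm x < real n" if "norm x < S + 2 * R + 2" using that n by linarith
    then show "ennreal (norm (indicator (ball 0 (S + 2 * R + 2)) x * \<rho> \<gamma> x)) \<le> ennreal (r x \<gamma>) * indicator (ball 0 (real n)) x"
      by (auto simp: \<rho>_def indicator_def ennreal_max_zero)
  qed
  have \<rho>_sec[measurable]: "\<rho> \<gamma> \<in> borel_measurable borel" if "\<gamma> \<in> Gamma" for \<gamma>
  proof -
    have [measurable]: "\<gamma> \<in> space Gamma_M" using that by simp
    show ?thesis by measurable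
  qed
  have \<rho>_int: "integrable lborel (\<lambda>x. indicator (ball 0 (S + 2 * R + 2)) x * \<rho> \<gamma> x)" if "\<gamma> \<in> Gamma" "T \<gamma> < \<infinity>" for \<gamma>
  proof (rule integrableI_bounded)
    have [measurable]: "\<rho> \<gamma> \<in> borel_measurable borel" using \<rho>_sec[OF that(1)] .
    show "(\<lambda>x. indicator (ball 0 (S + 2 * R + 2)) x * \<rho> \<gamma> x) \<in> borel_measurable lborel" by measurable
    show "(\<integral>\<^sup>+x. ennreal (norm (indicator (ball 0 (S + 2 * R + 2)) x * \<rho> \<gamma> x)) \<partial>lborel) < \<infinity>"
      using \<rho>_T[of \<gamma>] that(2) by (rule le_less_trans)
  qed
  \<comment> \<open>The constants \<open>A\<close>, \<open>R\<close>, \<open>K0\<close>,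
    \<open>S\<close> are the same for all \<gamma>, so the bounds vary with \<gamma> only through
    the local mass \<open>Q \<gamma>\<close>.\<close>
  have nf: "nonlocal_form a (\<rho> \<gamma>) (F.lift \<gamma>) (G.lift \<gamma>) A R K0 S" if "\<gamma> \<in> Gamma" "T \<gamma> < \<infinity>" for \<gamma>
  proof (rule nonlocal_form.intro)
    show "\<And>x. 0 \<le> \<rho> \<gamma> x" by (simp add: \<rho>_def)
  qed (rule am a_nonneg A aR rad \<rho>_sec[OF that(1)] \<rho>_int[OF that] F.lift_differentiable G.lift_differentiable lipF lipG S R K0; assumption)+
  define Q where "Q \<gamma> = (\<integral>x. indicator (ball 0 (S + 2 * R + 2)) x * \<rho> \<gamma> x \<partial>lborel)" for \<gamma>
  have Q_meas[measurable]: "Q \<in> borel_measurable Gamma_M" unfolding Q_def[abs_def] by measurable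
  have Q_nonneg: "0 \<le> Q \<gamma>" for \<gamma> unfolding Q_def \<rho>_def by (intro Bochner_Integration.integral_nonneg) auto
  have Q_T: "ennreal (Q \<gamma>) \<le> T \<gamma>" if \<gamma>: "\<gamma> \<in> Gamma" for \<gamma>
  proof (cases "T \<gamma> < \<infinity>")
    case True
    have "ennreal (norm (Q \<gamma>)) \<le> (\<integral>\<^sup>+x. ennreal (norm (indicator (ball 0 (S + 2 * R + 2)) x * \<rho> \<gamma> x)) \<partial>lborel)"
      unfolding Q_def by (rule integral_norm_bound_ennreal[OF \<rho>_int[OF \<gamma> True]])
    also have "\<dots> \<le> T \<gamma>" by (rule \<rho>_T)
    finally show ?thesis using Q_nonneg by simp
  next
    case False
    then show ?thesis by (simp add: less_top[symmetric])
  qed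
  have Q_fin: "(\<integral>\<^sup>+\<gamma>. ennreal (Q \<gamma>) \<partial>\<mu>) < \<infinity>"
  proof -
    have "(\<integral>\<^sup>+\<gamma>. ennreal (Q \<gamma>) \<partial>\<mu>) \<le> (\<integral>\<^sup>+\<gamma>. T \<gamma> \<partial>\<mu>)" by (intro nn_integral_mono Q_T) simp
    then show ?thesis using T_fin by (rule le_less_trans)
  qed
  have Q_int: "integrable \<mu> Q" by (rule integrableI_nonneg) (use Q_fin Q_nonneg in auto)
  define C where "C = A * K0\<^sup>2 * R\<^sup>2 * measure lborel (cball (0::'a) R)"
  have A0: "0 \<le> A" using a_nonneg[of 0] A[of 0] by linarith
  have C: "0 \<le> C" unfolding C_def using A0 by simp
  define inner where "inner t \<gamma> x = (\<integral>y. a_eps a t (x - y) * (sqrt (\<rho> \<gamma> x) * sqrt (\<rho> \<gamma> y)) *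
      ((F.lift \<gamma> y - F.lift \<gamma> x) * (G.lift \<gamma> y - G.lift \<gamma> x)) \<partial>lborel)" for t \<gamma> x
  have inner_meas[measurable]: "(\<lambda>(\<gamma>, x). inner t \<gamma> x) \<in> borel_measurable (Gamma_M \<Otimes>\<^sub>M borel)" for t
    unfolding inner_def by measurable
  define I where "I t \<gamma> = (\<integral>x. inner t \<gamma> x \<partial>lborel)" for t \<gamma>
  have I_meas[measurable]: "I t \<in> borel_measurable Gamma_M" for t unfolding I_def[abs_def] by measurable
  have inner_bound: "(\<integral>\<^sup>+x. ennreal \<bar>inner t \<gamma> x\<bar> \<partial>lborel) \<le> ennreal (C * Q \<gamma>)" and I_bound: "\<bar>I t \<gamma>\<bar> \<le> C * Q \<gamma>"
    if "\<gamma> \<in> Gamma" "T \<gamma> < \<infinity>" "0 < t" "t \<le> 1" for t \<gamma>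
    using nonlocal_form.form_nn_bound[OF nf[OF that(1,2)] that(3,4)] nonlocal_form.form_bound[OF nf[OF that(1,2)] that(3,4)]
    unfolding nonlocal_form.C0_def[OF nf[OF that(1,2)]] C_def I_def inner_def Q_def by simp_all
  have I_tendsto: "(\<lambda>k. I (X k) \<gamma>) \<longlonglongrightarrow> m * (\<integral>x. \<rho> \<gamma> x * (grad (F.lift \<gamma>) x \<bullet> grad (G.lift \<gamma>) x) \<partial>lborel)"
    if "\<gamma> \<in> Gamma" "T \<gamma> < \<infinity>" "X \<longlonglongrightarrow> 0" "\<And>k. 0 < X k" "\<And>k. X k \<le> 1" for X \<gamma>
    unfolding I_def inner_def m_def by (rule nonlocal_form.form_tendsto[OF nf[OF that(1,2)] that(3-5) e1])
  define H where "H t \<gamma> x = (\<integral>y. c_eps a r t x y (\<gamma> - {x}) * (F (insert y (\<gamma> - {x})) - F \<gamma>) *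
      (G (insert y (\<gamma> - {x})) - G \<gamma>) \<partial>lborel)" for t \<gamma> x
  have H_meas[measurable]: "(\<lambda>(\<gamma>, x). H t \<gamma> x) \<in> borel_measurable (Gamma_M \<Otimes>\<^sub>M borel)" for t
    unfolding H_def c_eps_def by measurable
  \<comment> \<open>r(x) sqrt(r(y)) / sqrt(r(x)) is the symmetric product of roots; if either
    intensity is not positive, both sides vanish.\<close>
  have cancel: "max 0 (r x \<gamma>) * (c_eps a r t x y \<gamma> * u * v) = a_eps a t (x - y) * (sqrt (\<rho> \<gamma> x) * sqrt (\<rho> \<gamma> y)) * (u * v)" for t x y \<gamma> u v
  proof (cases "r x \<gamma> > 0 \<and> r y \<gamma> > 0")
    case True
    then have s: "sqrt (r x \<gamma>) > 0" "r x \<gamma> = sqrt (r x \<gamma>) * sqrt (r x \<gamma>)" by auto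
    have e: "r x \<gamma> * (a_eps a t (x - y) * sqrt (r y \<gamma>) / sqrt (r x \<gamma>)) = a_eps a t (x - y) * (sqrt (r x \<gamma>) * sqrt (r y \<gamma>))"
      using s(1) by (subst s(2)) (simp add: field_simps)
    have "max 0 (r x \<gamma>) * (c_eps a r t x y \<gamma> * u * v) = (r x \<gamma> * (a_eps a t (x - y) * sqrt (r y \<gamma>) / sqrt (r x \<gamma>))) * (u * v)"
      using True by (simp add: c_eps_def max_def mult_ac)
    then show ?thesis unfolding e using True by (simp add: \<rho>_def max_def)
  next
    case False
    then have "sqrt (\<rho> \<gamma> x) * sqrt (\<rho> \<gamma> y) = 0" by (auto simp: \<rho>_def max_def)
    moreover have "c_eps a r t x y \<gamma> = 0" using False by (auto simp: c_eps_def)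
    ultimately show ?thesis by simp
  qed
  \<comment> \<open>Off \<gamma>, removing \<open>x\<close> after inserting it restores \<gamma>,
    and \<open>F\<close>, \<open>G\<close> agree with their lifts. This is used first for almost
    every \<open>x\<close> and then for almost every \<open>y\<close>.\<close>
  have H_inner: "AE x in lborel. max 0 (r x \<gamma>) * H t (insert x \<gamma>) x = inner t \<gamma> x" if \<gamma>: "\<gamma> \<in> Gamma" for t \<gamma>
    using AE_notin_Gamma[OF \<gamma>]
  proof eventually_elim
    case (elim x)
    have [measurable]: "\<gamma> \<in> space Gamma_M" using \<gamma> by simp
    have d: "insert x \<gamma> - {x} = \<gamma>" using elim by simp
    have "max 0 (r x \<gamma>) * H t (insert x \<gamma>) x = (\<integral>y. max 0 (r x \<gamma>) * (c_eps a r t x y \<gamma> * (F (insert y \<gamma>) - F (insert x \<gamma>)) *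
       (G (insert y \<gamma>) - G (insert x \<gamma>))) \<partial>lborel)"
      unfolding H_def d by (rule integral_mult_right_zero[symmetric])
    also have "\<dots> = inner t \<gamma> x"
      unfolding inner_def
    proof (rule integral_cong_AE)
      show "(\<lambda>y. max 0 (r x \<gamma>) * (c_eps a r t x y \<gamma> * (F (insert y \<gamma>) - F (insert x \<gamma>)) *
       (G (insert y \<gamma>) - G (insert x \<gamma>)))) \<in> borel_measurable lborel" unfolding c_eps_def by measurable
      show "(\<lambda>y. a_eps a t (x - y) * (sqrt (\<rho> \<gamma> x) * sqrt (\<rho> \<gamma> y)) *
          ((F.lift \<gamma> y - F.lift \<gamma> x) * (G.lift \<gamma> y - G.lift \<gamma> x))) \<in> borel_measurable lborel" by measurable
      show "AE y in lborel. max 0 (r x \<gamma>) * (c_eps a r t x y \<gamma> * (F (insert y \<gamma>) - F (insert x \<gamma>)) *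
          (G (insert y \<gamma>) - G (insert x \<gamma>))) = a_eps a t (x - y) * (sqrt (\<rho> \<gamma> x) * sqrt (\<rho> \<gamma> y)) *
          ((F.lift \<gamma> y - F.lift \<gamma> x) * (G.lift \<gamma> y - G.lift \<gamma> x))"
        using AE_notin_Gamma[OF \<gamma>]
      proof eventually_elim
        case (elim y)
        then show ?case unfolding cancel using \<open>x \<notin> \<gamma>\<close> by (simp add: F.F_insert[OF \<gamma>] G.F_insert[OF \<gamma>])
      qed
    qed
    finally show ?case .
  qed
  \<comment> \<open>The finite mean of \<open>Q\<close> provides absolute integrability; only then
    may the sum over the points of \<gamma> become an integral against r.\<close>
  have E_eps_eq: "E_eps \<mu> a r t F G = 1/2 * (\<integral>\<gamma>. I t \<gamma> \<partial>\<mu>)" if t: "0 < t" "t \<le> 1" for t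
  proof -
    have "(\<integral>\<^sup>+\<gamma>. \<integral>\<^sup>+x. ennreal \<bar>max 0 (r x \<gamma>) * H t (insert x \<gamma>) x\<bar> \<partial>lborel \<partial>\<mu>) \<le> (\<integral>\<^sup>+\<gamma>. ennreal C * ennreal (Q \<gamma>) \<partial>\<mu>)"
    proof (rule nn_integral_mono_AE)
      show "AE \<gamma> in \<mu>. (\<integral>\<^sup>+x. ennreal \<bar>max 0 (r x \<gamma>) * H t (insert x \<gamma>) x\<bar> \<partial>lborel) \<le> ennreal C * ennreal (Q \<gamma>)"
        using AE_T AE_Gamma
      proof eventually_elim
        case (elim \<gamma>)
        have "(\<integral>\<^sup>+x. ennreal \<bar>max 0 (r x \<gamma>) * H t (insert x \<gamma>) x\<bar> \<partial>lborel) = (\<integral>\<^sup>+x. ennreal \<bar>inner t \<gamma> x\<bar> \<partial>lborel)"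
          by (rule nn_integral_cong_AE, rule eventually_mono[OF H_inner[OF elim(2), of t]]) (simp only:)
        also have "\<dots> \<le> ennreal (C * Q \<gamma>)" by (rule inner_bound[OF elim(2,1) t])
        finally show ?case using C Q_nonneg by (simp add: ennreal_mult)
      qed
    qed
    also have "\<dots> = ennreal C * (\<integral>\<^sup>+\<gamma>. ennreal (Q \<gamma>) \<partial>\<mu>)" by (rule nn_integral_cmult) measurable
    also have "\<dots> < \<infinity>" using Q_fin by (simp add: ennreal_mult_less_top)
    finally have fin: "(\<integral>\<^sup>+\<gamma>. \<integral>\<^sup>+x. ennreal \<bar>max 0 (r x \<gamma>) * H t (insert x \<gamma>) x\<bar> \<partial>lborel \<partial>\<mu>) < \<infinity>" .
    have "E_eps \<mu> a r t F G = 1/2 * (\<integral>\<gamma>. (\<integral>x. H t \<gamma> x \<partial>count_space \<gamma>) \<partial>\<mu>)"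
      unfolding E_eps_def H_def ..
    also have "(\<integral>\<gamma>. (\<integral>x. H t \<gamma> x \<partial>count_space \<gamma>) \<partial>\<mu>) = (\<integral>\<gamma>. (\<integral>x. max 0 (r x \<gamma>) * H t (insert x \<gamma>) x \<partial>lborel) \<partial>\<mu>)"
      by (rule mecke_cox_integral[OF H_meas fin])
    also have "\<dots> = (\<integral>\<gamma>. I t \<gamma> \<partial>\<mu>)"
    proof (rule Bochner_Integration.integral_cong[OF refl])
      fix \<gamma> assume "\<gamma> \<in> space \<mu>"
      then have \<gamma>: "\<gamma> \<in> Gamma" and [measurable]: "\<gamma> \<in> space Gamma_M" by simp_all
      show "(\<integral>x. max 0 (r x \<gamma>) * H t (insert x \<gamma>) x \<partial>lborel) = I t \<gamma>"
        unfolding I_def by (rule integral_cong_AE[OF _ _ H_inner[OF \<gamma>]]) measurable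
    qed
    finally show ?thesis .
  qed
  have gF[measurable]: "(\<lambda>(\<gamma>, x). grad (F.lift \<gamma>) x) \<in> borel_measurable (Gamma_M \<Otimes>\<^sub>M borel)"
    by (rule borel_measurable_grad[OF F.lift_meas F.lift_differentiable])
  have gG[measurable]: "(\<lambda>(\<gamma>, x). grad (G.lift \<gamma>) x) \<in> borel_measurable (Gamma_M \<Otimes>\<^sub>M borel)"
    by (rule borel_measurable_grad[OF G.lift_meas G.lift_differentiable])
  define j where "j \<gamma> = (\<integral>x. \<rho> \<gamma> x * (grad (F.lift \<gamma>) x \<bullet> grad (G.lift \<gamma>) x) \<partial>lborel)" for \<gamma>
  have j_meas[measurable]: "j \<in> borel_measurable Gamma_M" unfolding j_def[abs_def] by measurable
  \<comment> \<open>The limit form contains r itself and the gradient of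
    \<open>F (insert z \<gamma>)\<close>; both differ from \<rho> and the gradient of the lift only
    on null sets.\<close>
  have E_0_eq: "E_0 \<mu> a r e1 F G = 1/2 * (\<integral>\<gamma>. m * j \<gamma> \<partial>\<mu>)"
  proof -
    define j0 where "j0 \<gamma> = (\<integral>x. r x \<gamma> * (grad (F.lift \<gamma>) x \<bullet> grad (G.lift \<gamma>) x) \<partial>lborel)" for \<gamma>
    have j0_meas[measurable]: "j0 \<in> borel_measurable Gamma_M" unfolding j0_def[abs_def] by measurable
    have "(\<integral>\<gamma>. (\<integral>x. r x \<gamma> * (grad (\<lambda>z. F (insert z \<gamma>)) x \<bullet> grad (\<lambda>z. G (insert z \<gamma>)) x) \<partial>lborel) \<partial>\<mu>) = (\<integral>\<gamma>. j0 \<gamma> \<partial>\<mu>)"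
    proof (rule Bochner_Integration.integral_cong[OF refl])
      fix \<gamma> assume "\<gamma> \<in> space \<mu>"
      then have \<gamma>: "\<gamma> \<in> Gamma" and [measurable]: "\<gamma> \<in> space Gamma_M" by simp_all
      have m0: "(\<lambda>x. r x \<gamma> * (grad (F.lift \<gamma>) x \<bullet> grad (G.lift \<gamma>) x)) \<in> borel_measurable lborel" by measurable
      show "(\<integral>x. r x \<gamma> * (grad (\<lambda>z. F (insert z \<gamma>)) x \<bullet> grad (\<lambda>z. G (insert z \<gamma>)) x) \<partial>lborel) = j0 \<gamma>"
        unfolding j0_def
      proof (rule integral_cong_AE[OF _ m0])
        \<comment> \<open>Nothing is claimed about this gradient at the points of \<gamma>; there
          are countably many, so measurability is inherited from the version with the lifts.\<close>
        show "(\<lambda>x. r x \<gamma> * (grad (\<lambda>z. F (insert z \<gamma>)) x \<bullet> grad (\<lambda>z. G (insert z \<gamma>)) x)) \<in> borel_measurable lborel"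
          by (rule measurable_discrete_difference[OF m0 countable_Gamma[OF \<gamma>]])
             (auto simp: F.grad_F_insert[OF \<gamma>] G.grad_F_insert[OF \<gamma>])
        show "AE x in lborel. r x \<gamma> * (grad (\<lambda>z. F (insert z \<gamma>)) x \<bullet> grad (\<lambda>z. G (insert z \<gamma>)) x) =
            r x \<gamma> * (grad (F.lift \<gamma>) x \<bullet> grad (G.lift \<gamma>) x)"
          using AE_notin_Gamma[OF \<gamma>] by eventually_elim (simp add: F.grad_F_insert[OF \<gamma>] G.grad_F_insert[OF \<gamma>])
      qed
    qed
    also have "\<dots> = (\<integral>\<gamma>. j \<gamma> \<partial>\<mu>)"
    proof (rule integral_cong_AE)
      show "AE \<gamma> in \<mu>. j0 \<gamma> = j \<gamma>"
        using AE_r_nonneg AE_Gamma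
      proof eventually_elim
        case (elim \<gamma>)
        have [measurable]: "\<gamma> \<in> space Gamma_M" using elim(2) by simp
        show ?case unfolding j0_def j_def
        proof (rule integral_cong_AE)
          show "AE x in lborel. r x \<gamma> * (grad (F.lift \<gamma>) x \<bullet> grad (G.lift \<gamma>) x) = \<rho> \<gamma> x * (grad (F.lift \<gamma>) x \<bullet> grad (G.lift \<gamma>) x)"
            using elim(1) by eventually_elim (simp add: \<rho>_def)
        qed measurable
      qed
    qed measurable
    finally show ?thesis unfolding E_0_def m_def by simp
  qed
  show ?thesis
  \<comment> \<open>Sequences below 1 suffice for the limit at 0, and the bounds on the form hold
    for scales up to 1.\<close>
  proof (rule tendsto_at_right_sequentially[of 0 1])
    fix X :: "nat \<Rightarrow> real" assume X: "\<And>k. 0 < X k" "\<And>k. X k < 1" "X \<longlonglongrightarrow> 0"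
    have X1: "X k \<le> 1" for k using X(2)[of k] by simp
    have "(\<lambda>k. \<integral>\<gamma>. I (X k) \<gamma> \<partial>\<mu>) \<longlonglongrightarrow> (\<integral>\<gamma>. m * j \<gamma> \<partial>\<mu>)"
    proof (rule integral_dominated_convergence[where w="\<lambda>\<gamma>. C * Q \<gamma>"])
      show "integrable \<mu> (\<lambda>\<gamma>. C * Q \<gamma>)" using Q_int by simp
      show "AE \<gamma> in \<mu>. (\<lambda>k. I (X k) \<gamma>) \<longlonglongrightarrow> m * j \<gamma>"
        using AE_T AE_Gamma
      proof eventually_elim
        case (elim \<gamma>)
        show ?case unfolding j_def by (rule I_tendsto[OF elim(2,1) X(3,1) X1])
      qed
      show "AE \<gamma> in \<mu>. norm (I (X k) \<gamma>) \<le> C * Q \<gamma>" for k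
        using AE_T AE_Gamma
      proof eventually_elim
        case (elim \<gamma>)
        show ?case unfolding real_norm_def by (rule I_bound[OF elim(2,1) X(1) X1])
      qed
    qed measurable
    then have "(\<lambda>k. 1/2 * (\<integral>\<gamma>. I (X k) \<gamma> \<partial>\<mu>)) \<longlonglongrightarrow> 1/2 * (\<integral>\<gamma>. m * j \<gamma> \<partial>\<mu>)" by (rule tendsto_mult_left)
    then show "(\<lambda>k. E_eps \<mu> a r (X k) F G) \<longlonglongrightarrow> E_0 \<mu> a r e1 F G"
      unfolding E_0_eq E_eps_eq[OF X(1) X1] .
  qed simp
qed

text \<open>Every copy has the mean square of \<open>Y\<close>, because this depends on the law
  only. The mean intensity is therefore l times the second moment of \<open>Y\<close>, which is
  locally integrable.\<close>

lemma cox_process_sum_squares: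
  fixes Y :: "'a::euclidean_space \<Rightarrow> 'w \<Rightarrow> real" and Ys :: "nat \<Rightarrow> 'a \<Rightarrow> 'w \<Rightarrow> real"
  assumes P: "prob_space P"
    and \<kappa>: "\<kappa> \<in> borel_measurable lborel" "locally_trace_class \<kappa>"
    and Y: "gaussian_field P Y (kern \<kappa>)"
    and Ys: "\<And>i. i < l \<Longrightarrow> (\<lambda>(x, \<omega>). Ys i x \<omega>) \<in> borel_measurable (lborel \<Otimes>\<^sub>M P)"
    and law: "\<And>i. i < l \<Longrightarrow>
        distr P (Pi\<^sub>M UNIV (\<lambda>_. borel)) (\<lambda>\<omega> x. Ys i x \<omega>) = distr P (Pi\<^sub>M UNIV (\<lambda>_. borel)) (\<lambda>\<omega> x. Y x \<omega>)"
  shows "cox_process P (\<lambda>x \<omega>. \<Sum>i<l. (Ys i x \<omega>)\<^sup>2)"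
proof -
  interpret prob_space P by fact
  have Ym[measurable]: "(\<lambda>(x, \<omega>). Y x \<omega>) \<in> borel_measurable (lborel \<Otimes>\<^sub>M P)" using Y by (simp add: gaussian_field_def)
  have Ysec: "Ys i x \<in> borel_measurable P" if "i < l" for i x
    using measurable_compose[OF measurable_Pair1' Ys[OF that], of x] by simp
  show ?thesis
  proof unfold_locales
    show "(\<lambda>(x, \<omega>). \<Sum>i<l. (Ys i x \<omega>)\<^sup>2) \<in> borel_measurable (lborel \<Otimes>\<^sub>M P)"
      using Ys unfolding split_beta' by (intro borel_measurable_sum borel_measurable_power) auto
    show "0 \<le> (\<Sum>i<l. (Ys i x \<omega>)\<^sup>2)" for x \<omega> by (intro sum_nonneg) simp
    fix n :: nat
    define s where "s x = (\<integral>\<^sup>+\<omega>. ennreal ((Y x \<omega>)\<^sup>2) \<partial>P)" for x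
    have [measurable]: "s \<in> borel_measurable borel" unfolding s_def[abs_def] by measurable
    have "(\<integral>\<^sup>+\<omega>. ennreal (\<Sum>i<l. (Ys i x \<omega>)\<^sup>2) \<partial>P) = of_nat l * s x" for x
    proof -
      have "(\<integral>\<^sup>+\<omega>. ennreal (\<Sum>i<l. (Ys i x \<omega>)\<^sup>2) \<partial>P) = (\<integral>\<^sup>+\<omega>. (\<Sum>i<l. ennreal ((Ys i x \<omega>)\<^sup>2)) \<partial>P)"
        by (simp add: sum_ennreal)
      also have "\<dots> = (\<Sum>i<l. \<integral>\<^sup>+\<omega>. ennreal ((Ys i x \<omega>)\<^sup>2) \<partial>P)"
      proof (rule nn_integral_sum)
        fix i assume "i \<in> {..<l}"
        then have [measurable]: "Ys i x \<in> borel_measurable P" using Ysec by simp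
        show "(\<lambda>\<omega>. ennreal ((Ys i x \<omega>)\<^sup>2)) \<in> borel_measurable P" by measurable
      qed
      also have "\<dots> = (\<Sum>i<l. s x)"
        unfolding s_def by (intro sum.cong refl nn_integral_square_eq_of_law[OF Ys Ym law]) auto
      finally show ?thesis by simp
    qed
    then have "(\<integral>\<^sup>+x\<in>ball 0 (real n). (\<integral>\<^sup>+\<omega>. ennreal (\<Sum>i<l. (Ys i x \<omega>)\<^sup>2) \<partial>P) \<partial>lborel) =
       (\<integral>\<^sup>+x. of_nat l * (s x * indicator (ball 0 (real n)) x) \<partial>lborel)" by (simp add: mult.assoc)
    also have "\<dots> = of_nat l * (\<integral>\<^sup>+x\<in>ball 0 (real n). s x \<partial>lborel)" by (rule nn_integral_cmult) measurable
    also have "\<dots> < \<infinity>"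
      using gaussian_field_second_moment[OF P Y \<kappa>, of "real n"] by (simp add: s_def ennreal_mult_less_top of_nat_less_top)
    finally show "(\<integral>\<^sup>+x\<in>ball 0 (real n). (\<integral>\<^sup>+\<omega>. ennreal (\<Sum>i<l. (Ys i x \<omega>)\<^sup>2) \<partial>P) \<partial>lborel) < \<infinity>" .
  qed
qed

theorem theorem4p1:
  fixes \<kappa> :: "'a::euclidean_space \<Rightarrow> real"
    and a :: "'a \<Rightarrow> real"
    and e1 :: 'a
    and P :: "'w measure"
    and Y :: "'a \<Rightarrow> 'w \<Rightarrow> real"
    and Ys :: "nat \<Rightarrow> 'a \<Rightarrow> 'w \<Rightarrow> real"
    and l :: nat
    and r :: "'a \<Rightarrow> 'a set \<Rightarrow> real"
    and F G :: "'a set \<Rightarrow> real"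
    and \<phi>F :: "'n::finite \<Rightarrow> 'a \<Rightarrow> real" and hF :: "real^'n \<Rightarrow> real"
    and \<phi>G :: "'m::finite \<Rightarrow> 'a \<Rightarrow> real" and hG :: "real^'m \<Rightarrow> real"
  assumes kappa_meas: "\<kappa> \<in> borel_measurable lborel"
    and K_op: "bdd_sa_nonneg_kernel_op \<kappa>"
    and K_ltc: "locally_trace_class \<kappa>"
    and kappa_cont: "((\<lambda>y. \<integral>x. (\<kappa> x - \<kappa> (x + y))\<^sup>2 \<partial>lborel) \<longlongrightarrow> 0) (at 0)"
    and a_nonneg: "\<And>x. a x \<ge> 0"
    and a_bdd: "bounded (range a)"
    and a_meas: "a \<in> borel_measurable lborel"
    and a_int: "integrable lborel a"
    and a_supp: "compact (closure {x. a x \<noteq> 0})"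
    and a_radial: "\<exists>a_rad. \<forall>x. a x = a_rad (norm x)"
    and e1: "e1 \<in> Basis"
    and l_pos: "0 < l"
    and P_prob: "prob_space P"
    and Y_field: "gaussian_field P Y (kern \<kappa>)"
    and Ys_meas: "\<And>i. i < l \<Longrightarrow> (\<lambda>(x, \<omega>). Ys i x \<omega>) \<in> borel_measurable (lborel \<Otimes>\<^sub>M P)"
    and Ys_law: "\<And>i. i < l \<Longrightarrow>
        distr P (Pi\<^sub>M UNIV (\<lambda>_. borel)) (\<lambda>\<omega> x. Ys i x \<omega>) = distr P (Pi\<^sub>M UNIV (\<lambda>_. borel)) (\<lambda>\<omega> x. Y x \<omega>)"
    and Ys_indep: "prob_space.indep_vars P (\<lambda>_. Pi\<^sub>M UNIV (\<lambda>_. borel)) (\<lambda>i \<omega> x. Ys i x \<omega>) {..<l}"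
    and r_pap: "is_papangelou P (\<lambda>x \<omega>. \<Sum>i<l. (Ys i x \<omega>)\<^sup>2) r"
    and F_cyl: "cyl_fun F \<phi>F hF"
    and G_cyl: "cyl_fun G \<phi>G hG"
  shows "((\<lambda>\<epsilon>. E_eps (cox P (\<lambda>x \<omega>. \<Sum>i<l. (Ys i x \<omega>)\<^sup>2)) a r \<epsilon> F G)
           \<longlongrightarrow> E_0 (cox P (\<lambda>x \<omega>. \<Sum>i<l. (Ys i x \<omega>)\<^sup>2)) a r e1 F G) (at_right 0)"
proof -
  interpret cox_process P "\<lambda>x \<omega>. \<Sum>i<l. (Ys i x \<omega>)\<^sup>2"
    by (rule cox_process_sum_squares[OF P_prob kappa_meas K_ltc Y_field Ys_meas Ys_law])
  interpret cox_papangelou P "\<lambda>x \<omega>. \<Sum>i<l. (Ys i x \<omega>)\<^sup>2" r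
    by unfold_locales (rule r_pap)
  show ?thesis
    by (rule E_eps_tendsto[OF a_nonneg a_bdd a_meas a_supp a_radial e1 F_cyl G_cyl])
qed

end
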